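(* For $n,k\in\mathbb{N}$ let $X_n(k)$ be the number of vertices at distance $k$ from the root in the random recursive tree with $n+1$ vertices, where the trees for all $n\in\mathbb{N}$ are constructed jointly as one growing tree. Then, for each fixed $k\in\mathbb{N}$, $$C\bigg(\bigg(\frac{(k-1)!\,(2k-1)^{1/2}\big(X_n(k)-(\log n)^k/k!\big)}{(2(\log n)^{2k-1}\log\log\log n)^{1/2}}: n>\mathrm{e}^{\mathrm{e}}\bigg)\bigg)=[-1,1]\quad\text{a.s.}$$
   Context: $\mathbb{N}=\{1,2,\ldots\}$ and $0!=1$. For a family $(x_n)$ of real numbers, $C((x_n))$ denotes the set of its limit points as $n\to\infty$, i.e. the set of all $x$ such that $x_{n_j}\to x$ for some sequence of indices $n_j\to\infty$. Continuous-time construction of the random recursive tree (RRT): at time $0$, the tree consists of one vertex, the root, located at level $0$. The root generates offspring at the arrival times of a unit intensity Poisson process; these offspring are located at level $1$. More generally, each vertex of the tree, immediately after its birth, starts to generate offspring at rate $1$ (at the arrival times of a unit intensity Poisson process started at its birth), and all vertices act independently. If a vertex is located at level $k$, then its offspring are located at level $k+1$, so that the level of a vertex is its distance to the root. Let $\tau_1<\tau_2<\ldots$ be the birth times of the vertices other than the root (which is born at time $\tau_0=0$). At time $\tau_n$, $n\in\mathbb{N}$, the tree consists of $n+1$ vertices. $X_n(k)$ is the number of vertices of this tree having distance $k$ to the root at time $\tau_n$. *)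

theory Defs
  imports "HOL-Probability.Probability"
begin

(* The limit points C((x_n : n in I)) of a real family indexed by a set I of naturals.
   The indices n_j have to tend to infinity but need not be increasing. *)

definition limit_points :: "nat set \<Rightarrow> (nat \<Rightarrow> real) \<Rightarrow> real set" where
  "limit_points I x =
     {l. \<exists>r :: nat \<Rightarrow> nat. (\<forall>j. r j \<in> I) \<and> filterlim r at_top sequentially \<and>
           (\<lambda>j. x (r j)) \<longlonglongrightarrow> l}"

(* S 0 < S 1 < ... are the arrival times of a Poisson process with intensity 1 on (0, oo).
   The number of arrivals in (s, t] has the Poisson distribution with mean t - s, and the
   numbers of arrivals in consecutive intervals are independent.  The partition
   u 0 \<le> u 1 \<le> ... is infinite only for convenience: independence of an infinite family
   means independence of its finite subfamilies. *)

definition arrivals_between :: "(nat \<Rightarrow> 'a \<Rightarrow> real) \<Rightarrow> real \<Rightarrow> real \<Rightarrow> 'a \<Rightarrow> nat" where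
  "arrivals_between S s t \<omega> = card {i. s < S i \<omega> \<and> S i \<omega> \<le> t}"

definition unit_poisson_arrivals :: "'a measure \<Rightarrow> (nat \<Rightarrow> 'a \<Rightarrow> real) \<Rightarrow> bool" where
  "unit_poisson_arrivals M S \<longleftrightarrow>
     (\<forall>i. S i \<in> borel_measurable M) \<and>
     (AE \<omega> in M. 0 < S 0 \<omega> \<and> strict_mono (\<lambda>i. S i \<omega>) \<and>
        filterlim (\<lambda>i. S i \<omega>) at_top sequentially) \<and>
     (\<forall>s t. 0 \<le> s \<and> s < t \<longrightarrow>
        distr M (count_space UNIV) (arrivals_between S s t) = measure_pmf (poisson_pmf (t - s))) \<and>
     (\<forall>u :: nat \<Rightarrow> real. 0 \<le> u 0 \<and> mono u \<longrightarrow>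
        prob_space.indep_vars M (\<lambda>_. count_space UNIV)
          (\<lambda>j. arrivals_between S (u j) (u (Suc j))) UNIV)"

(* Vertices are lists of naturals (Ulam-Harris labels, written in reverse): [] is the root and
   i # v is the child of v with index i, indices starting at 0.  Hence the level of a vertex,
   i.e. its distance to the root, is the length of the list.
   A v i is the time between the birth of v and the birth of i # v. *)

locale random_recursive_tree = prob_space M
  for M :: "'a measure" +
  fixes A :: "nat list \<Rightarrow> nat \<Rightarrow> 'a \<Rightarrow> real"
  assumes offspring_poisson: "\<And>v. unit_poisson_arrivals M (A v)"
    and offspring_indep:
      "indep_vars (\<lambda>_. Pi\<^sub>M (UNIV :: nat set) (\<lambda>_. borel)) (\<lambda>v \<omega> i. A v i \<omega>) UNIV"

primrec birth :: "(nat list \<Rightarrow> nat \<Rightarrow> 'a \<Rightarrow> real) \<Rightarrow> nat list \<Rightarrow> 'a \<Rightarrow> real" where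
  "birth A [] \<omega> = 0"
| "birth A (i # v) \<omega> = birth A v \<omega> + A v i \<omega>"

(* tau_0 = 0 < tau_1 < tau_2 < ...: the birth times in increasing order.  Almost surely the birth
   times are pairwise distinct and only finitely many lie below any bound, so the infimum is the
   next birth time. *)

primrec tau :: "(nat list \<Rightarrow> nat \<Rightarrow> 'a \<Rightarrow> real) \<Rightarrow> nat \<Rightarrow> 'a \<Rightarrow> real" where
  "tau A 0 \<omega> = 0"
| "tau A (Suc n) \<omega> = Inf {birth A v \<omega> | v. tau A n \<omega> < birth A v \<omega>}"

definition level_size :: "(nat list \<Rightarrow> nat \<Rightarrow> 'a \<Rightarrow> real) \<Rightarrow> nat \<Rightarrow> nat \<Rightarrow> 'a \<Rightarrow> nat" where
  "level_size A n k \<omega> = card {v. birth A v \<omega> \<le> tau A n \<omega> \<and> length v = k}"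

end

(* In continuous time the level sizes satisfy the recursion Z_(k+1)(t) = int_0^t Z_k(s) ds + m(t),
   where m is the sum over the vertices of level k of their centred offspring processes.  These
   processes are independent, so different vertices contribute orthogonally and
   E m(t)^2 <= t^(k+1) / (k+1)!; hence all fluctuations of order t^(k-1/2) sqrt(log log t) of level k
   come from the offspring process of the root, whose centred version is integrated k-1 times.  At
   integer times this is, up to O(t^(k-1/2)), an iterated sum of independent centred Poisson
   variables.  Its law of the iterated logarithm only needs the moment generating function, for the
   upper tails (Chernoff, with a maximal inequality for k = 1) as well as for the lower tails
   (truncation of the exponentially weighted mean), together with the two Borel-Cantelli lemmas.

   The birth times satisfy tau_n = log n + O(sqrt (log n)), because the total population lies between
   exp(t - sqrt t) and exp(t + sqrt t).  The lower bound comes from a second moment argument that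
   yields growth c e^t / t with probability at least 1/16, applied to the independent subtrees of the
   children of the root.  Finally, X_n(k) has jumps of size at most 1, so that the limit points fill
   the whole interval between liminf = -1 and limsup = 1. *)

theory Submission
  imports Defs "HOL-Real_Asymp.Real_Asymp"
begin

section \<open>Exponential tails of weighted centred Poisson sums\<close>

text \<open>The tolerance shapes the proof: at level k an error is negligible once it is
  O(t^(k-1/2)), because the normalisation exceeds this only by sqrt (log log t). Two estimates just
  meet it. A shift of time by O(sqrt t) moves t^k / k! by O(t^(k-1/2)), so crude population bounds
  suffice and the limit of exp (- t) times the population need not be identified. And the
  fluctuation of level j has mean square of order t^(j+1), so that Chebyshev's inequality along the
  times i^2 yields the bound i^(j+2); this is within i^(2j+1), the tolerance of level j + 1,
  precisely when j is at least 1. The root, j = 0, is the exception and its process is kept exactly;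
  its increments over unit intervals are independent Poisson variables with an explicit cumulant.
  Since an iterated sum is a weighted sum of these increments, one pair of tail estimates for
  weighted sums serves all levels, blocks and remainders. Levels are mostly written
  \<open>Suc k\<close>, so that \<open>k\<close> counts the additional summations.\<close>

definition cumulant :: "real \<Rightarrow> real" where
  "cumulant x = exp x - 1 - x"

lemma cumulant_nonneg: "0 \<le> cumulant x"
  using exp_ge_add_one_self[of x] by (simp add: cumulant_def del: exp_ge_add_one_self)

lemma cumulant_approx:
  assumes "\<bar>x\<bar> \<le> 1"
  shows "\<bar>cumulant x - x\<^sup>2 / 2\<bar> \<le> \<bar>x\<bar> ^ 3"
proof -
  obtain t where t: "\<bar>t\<bar> \<le> \<bar>x\<bar>"
      "exp x = (\<Sum>m<3. x ^ m / fact m) + exp t / fact 3 * x ^ 3"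
    using Maclaurin_exp_le[of x 3] by auto
  have "exp t \<le> exp 1"
    using t(1) assms by simp
  also have "exp 1 < (3::real)"
    by (rule e_less_272[THEN less_trans]) simp
  finally have et: "exp t \<le> 3" by simp
  have "cumulant x - x\<^sup>2 / 2 = exp t / 6 * x ^ 3"
    using t(2) by (simp add: cumulant_def eval_nat_numeral fact_numeral)
  hence "\<bar>cumulant x - x\<^sup>2 / 2\<bar> = exp t / 6 * \<bar>x\<bar> ^ 3"
    by (simp only: abs_mult power_abs abs_divide) simp
  also have "\<dots> \<le> 1 * \<bar>x\<bar> ^ 3"
    using et by (intro mult_right_mono) auto
  finally show ?thesis by simp
qed

section \<open>Exponential tail bounds in both directions\<close>

lemma (in prob_space) prob_ge_le_mgf:
  assumes "0 \<le> l" "integrable M (\<lambda>\<omega>. exp (l * V \<omega>))"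
    and [measurable]: "V \<in> borel_measurable M"
  shows "prob {\<omega>\<in>space M. x \<le> V \<omega>} \<le> exp (- l * x) * expectation (\<lambda>\<omega>. exp (l * V \<omega>))"
proof -
  have "prob {\<omega>\<in>space M. x \<le> V \<omega>} \<le> prob {\<omega>\<in>space M. exp (l * x) \<le> exp (l * V \<omega>)}"
    by (rule finite_measure_mono) (use assms in \<open>auto intro!: mult_left_mono\<close>)
  also have "\<dots> \<le> expectation (\<lambda>\<omega>. exp (l * V \<omega>)) / exp (l * x)"
    by (rule integral_Markov_inequality_measure[where A = "{}", OF assms(2)]) auto
  finally show ?thesis by (simp add: exp_minus field_simps)
qed

text \<open>Lower tail bounds without a change of measure: the parts of \<open>E exp (l V)\<close> outside \<open>{a..b}\<close> are
  bounded by the moment generating function at \<open>l + d\<close> and \<open>l - d\<close>.\<close>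

lemma (in prob_space) prob_ge_ge_mgf:
  assumes "0 \<le> l" "0 \<le> d"
    and int: "integrable M (\<lambda>\<omega>. exp (l * V \<omega>))" "integrable M (\<lambda>\<omega>. exp ((l + d) * V \<omega>))"
      "integrable M (\<lambda>\<omega>. exp ((l - d) * V \<omega>))"
    and [measurable]: "V \<in> borel_measurable M"
  shows "exp (- l * b) * (expectation (\<lambda>\<omega>. exp (l * V \<omega>))
            - exp (- d * b) * expectation (\<lambda>\<omega>. exp ((l + d) * V \<omega>))
            - exp (d * a) * expectation (\<lambda>\<omega>. exp ((l - d) * V \<omega>)))
         \<le> prob {\<omega>\<in>space M. a \<le> V \<omega>}"
proof -
  have pt: "exp (l * V \<omega>) - exp (- d * b) * exp ((l + d) * V \<omega>) - exp (d * a) * exp ((l - d) * V \<omega>)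
      \<le> exp (l * b) * indicator {\<omega>\<in>space M. a \<le> V \<omega>} \<omega>" if "\<omega> \<in> space M" for \<omega>
  proof -
    consider "V \<omega> < a" | "b < V \<omega>" | "a \<le> V \<omega>" "V \<omega> \<le> b" by linarith
    thus ?thesis
    proof cases
      case 1
      have "d * V \<omega> \<le> d * a" using 1 assms by (intro mult_left_mono) auto
      hence "exp (l * V \<omega>) \<le> exp (d * a + (l - d) * V \<omega>)" by (simp add: algebra_simps)
      hence "exp (l * V \<omega>) \<le> exp (d * a) * exp ((l - d) * V \<omega>)" by (simp add: exp_add)
      thus ?thesis
        by (smt (verit) exp_gt_zero mult_nonneg_nonneg indicator_pos_le)
    next
      case 2
      have "d * b \<le> d * V \<omega>" using 2 assms by (intro mult_left_mono) auto
      hence "exp (l * V \<omega>) \<le> exp (- d * b + (l + d) * V \<omega>)" by (simp add: algebra_simps)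
      hence "exp (l * V \<omega>) \<le> exp (- d * b) * exp ((l + d) * V \<omega>)" by (simp only: exp_add)
      thus ?thesis
        by (smt (verit) exp_gt_zero mult_nonneg_nonneg indicator_pos_le)
    next
      case 3
      have "l * V \<omega> \<le> l * b" using 3 assms by (intro mult_left_mono) auto
      hence "exp (l * V \<omega>) \<le> exp (l * b)" by simp
      moreover have "0 \<le> exp (- d * b) * exp ((l + d) * V \<omega>)" "0 \<le> exp (d * a) * exp ((l - d) * V \<omega>)"
        by simp_all
      moreover have "indicator {\<omega>\<in>space M. a \<le> V \<omega>} \<omega> = (1::real)" using 3 that by simp
      ultimately show ?thesis by (simp only: mult_1_right)
    qed
  qed
  have "expectation (\<lambda>\<omega>. exp (l * V \<omega>)) - exp (- d * b) * expectation (\<lambda>\<omega>. exp ((l + d) * V \<omega>))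
            - exp (d * a) * expectation (\<lambda>\<omega>. exp ((l - d) * V \<omega>))
     = expectation (\<lambda>\<omega>. exp (l * V \<omega>) - exp (- d * b) * exp ((l + d) * V \<omega>) - exp (d * a) * exp ((l - d) * V \<omega>))"
    using int by simp
  also have "\<dots> \<le> expectation (\<lambda>\<omega>. exp (l * b) * indicator {\<omega>\<in>space M. a \<le> V \<omega>} \<omega>)"
    using int pt by (intro integral_mono integrable_mult_right integrable_real_indicator Bochner_Integration.integrable_diff)
      (auto simp: emeasure_eq_measure)
  also have "\<dots> = exp (l * b) * prob {\<omega>\<in>space M. a \<le> V \<omega>}"
    by simp
  finally show ?thesis
    by (simp add: exp_minus field_simps)
qed

section \<open>Borel-Cantelli lemmas\<close>

lemma (in prob_space) borel_cantelli_powr: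
  assumes [measurable]: "\<And>n. E n \<in> sets M" and "1 < p"
    and le: "eventually (\<lambda>n. prob (E n) \<le> C * real n powr (- p)) sequentially"
  shows "AE \<omega> in M. eventually (\<lambda>n. \<omega> \<notin> E n) sequentially"
proof -
  have "summable (\<lambda>n. prob (E n))"
  proof (rule summable_comparison_test_ev)
    show "eventually (\<lambda>n. norm (prob (E n)) \<le> C * real n powr (- p)) sequentially"
      using le by simp
    show "summable (\<lambda>n. C * real n powr (- p))"
      using assms(2) by (intro summable_mult) (simp add: summable_real_powr_iff)
  qed
  from borel_cantelli_AE1[OF _ _ this] show ?thesis
    by (auto simp: emeasure_eq_measure)
qed

text \<open>Markov's inequality and the first Borel-Cantelli lemma. The mean is a nonnegative
  integral because the second moments of the tree fluctuations, which come out of Fatou's lemma,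
  have that form.\<close>

lemma (in prob_space) borel_cantelli_mean:
  assumes [measurable]: "\<And>n. f n \<in> borel_measurable M"
    and mean: "\<And>n. (\<integral>\<^sup>+\<omega>. ennreal (f n \<omega>) \<partial>M) \<le> ennreal (m n)"
    and le: "eventually (\<lambda>n. 0 < c n \<and> m n / c n \<le> 1 / real n ^ 2) sequentially"
  shows "AE \<omega> in M. eventually (\<lambda>n. f n \<omega> < c n) sequentially"
proof -
  let ?E = "\<lambda>n. {\<omega>\<in>space M. c n \<le> f n \<omega>}"
  have "AE \<omega> in M. eventually (\<lambda>n. \<omega> \<notin> ?E n) sequentially"
  proof (rule borel_cantelli_powr[where p = 2 and C = 1])
    show "?E n \<in> sets M" for n by measurable
    show "eventually (\<lambda>n. prob (?E n) \<le> 1 * real n powr - 2) sequentially"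
      using le eventually_gt_at_top[of 0]
    proof eventually_elim
      case (elim n)
      have "emeasure M (?E n) = (\<integral>\<^sup>+\<omega>. indicator (?E n) \<omega> \<partial>M)" by simp
      also have "\<dots> \<le> (\<integral>\<^sup>+\<omega>. ennreal (1 / c n) * ennreal (f n \<omega>) \<partial>M)"
      proof (rule nn_integral_mono)
        fix \<omega>
        show "indicator (?E n) \<omega> \<le> ennreal (1 / c n) * ennreal (f n \<omega>)"
        proof (cases "\<omega> \<in> ?E n")
          case True
          hence "1 \<le> 1 / c n * f n \<omega>" using elim by (simp add: pos_le_divide_eq)
          hence "ennreal 1 \<le> ennreal (1 / c n * f n \<omega>)" by (rule ennreal_leI)
          also have "\<dots> = ennreal (1 / c n) * ennreal (f n \<omega>)"
            using elim True by (intro ennreal_mult) auto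
          finally show ?thesis using True by simp
        qed simp
      qed
      also have "\<dots> = ennreal (1 / c n) * (\<integral>\<^sup>+\<omega>. ennreal (f n \<omega>) \<partial>M)"
        by (rule nn_integral_cmult) measurable
      also have "\<dots> \<le> ennreal (1 / c n) * ennreal (m n)"
        by (intro mult_left_mono mean) auto
      also have "\<dots> = ennreal (m n / c n)"
        using elim by (subst ennreal_mult'[symmetric]) auto
      also have "\<dots> \<le> ennreal (1 / real n ^ 2)" using elim by (intro ennreal_leI) auto
      finally show ?case using elim by (simp add: emeasure_eq_measure powr_minus_divide)
    qed
  qed simp
  thus ?thesis using AE_space
    by eventually_elim (auto elim!: eventually_mono simp: not_le)
qed

lemma (in prob_space) borel_cantelli_indep:
  assumes ind: "indep_events E UNIV" and ns: "\<not> summable (\<lambda>n. prob (E n))"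
  shows "AE \<omega> in M. frequently (\<lambda>n. \<omega> \<in> E n) sequentially"
proof -
  have [measurable]: "E n \<in> sets M" for n
    using ind by (auto simp: indep_events_def)
  \<comment> \<open>Independence passes from the events to the sigma-algebras they generate, hence
    to the complements, whose intersection is estimated below.\<close>
  have ie: "indep_sets (\<lambda>n. sigma_sets (space M) {E n}) UNIV"
    using ind unfolding indep_events_def_alt
    by (intro indep_sets_sigma) (auto simp: Int_stable_def)
  have compl: "prob (\<Inter>j\<in>J. space M - E j) = (\<Prod>j\<in>J. 1 - prob (E j))" if "finite J" "J \<noteq> {}" for J
  proof -
    have "prob (\<Inter>j\<in>J. space M - E j) = (\<Prod>j\<in>J. prob (space M - E j))"
      using ie that by (intro indep_setsD) (auto intro: sigma_sets.intros)
    thus ?thesis by (simp add: prob_compl)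
  qed
  have "AE \<omega> in M. \<exists>j\<ge>m. \<omega> \<in> E j" for m
  proof -
    let ?A = "\<Inter>j\<in>{m..}. space M - E j"
    have A[measurable]: "?A \<in> sets M" by auto
    have "prob ?A \<le> exp (- (\<Sum>j=m..m+n. prob (E j)))" for n
    proof -
      have "prob ?A \<le> prob (\<Inter>j\<in>{m..m+n}. space M - E j)"
        by (intro finite_measure_mono) auto
      also have "\<dots> = (\<Prod>j=m..m+n. 1 - prob (E j))" by (intro compl) auto
      also have "\<dots> \<le> (\<Prod>j=m..m+n. exp (- prob (E j)))"
        using exp_ge_add_one_self[of "- prob (E _)"] by (intro prod_mono) auto
      also have "\<dots> = exp (- (\<Sum>j=m..m+n. prob (E j)))"
        by (simp add: exp_sum[symmetric] sum_negf)
      finally show ?thesis .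
    qed
    note bnd = this
    have "prob ?A = 0"
    proof (rule ccontr)
      \<comment> \<open>A positive probability would bound all partial sums from \<open>m\<close> on
        by \<open>- ln (prob ?A)\<close>, against divergence.\<close>
      assume "prob ?A \<noteq> 0"
      hence pos: "prob ?A > 0" by (simp add: zero_less_measure_iff)
      have "(\<Sum>j=m..m+n. prob (E j)) \<le> - ln (prob ?A)" for n
      proof -
        have "ln (prob ?A) \<le> ln (exp (- (\<Sum>j=m..m+n. prob (E j))))"
          using bnd[of n] pos by (subst ln_le_cancel_iff) auto
        thus ?thesis by simp
      qed
      hence B: "(\<Sum>j<n. prob (E (j + m))) \<le> - ln (prob ?A)" for n
      proof -
        have "(\<Sum>j<n. prob (E (j + m))) = (\<Sum>j=m..<m+n. prob (E j))"
          using sum.shift_bounds_nat_ivl[of "\<lambda>j. prob (E j)" 0 m n]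
          by (simp add: atLeast0LessThan add.commute)
        also have "\<dots> \<le> (\<Sum>j=m..m+n. prob (E j))" by (intro sum_mono2) auto
        also have "\<dots> \<le> - ln (prob ?A)" by fact
        finally show ?thesis .
      qed
      have "summable (\<lambda>j. prob (E (j + m)))"
      proof (rule bounded_imp_summable)
        show "(\<Sum>j\<le>n. prob (E (j + m))) \<le> - ln (prob ?A)" for n
          using B[of "Suc n"] by (simp only: lessThan_Suc_atMost)
      qed simp
      thus False using ns summable_iff_shift[of "\<lambda>n. prob (E n)" m] by blast
    qed
    hence "AE \<omega> in M. \<omega> \<notin> ?A"
      by (intro AE_not_in) (auto simp: null_sets_def emeasure_eq_measure)
    thus ?thesis by (rule AE_mp) (auto intro!: AE_I2)
  qed
  hence "AE \<omega> in M. \<forall>m. \<exists>j\<ge>m. \<omega> \<in> E j"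
    by (simp add: AE_all_countable)
  thus ?thesis by eventually_elim (auto simp: frequently_sequentially)
qed

text \<open>The last condition is Kolmogorov's: the largest weight is of smaller order than the
  standard deviation divided by \<open>sqrt (L n)\<close>. At exponential tilts of order
  \<open>sqrt (L n)\<close> over the standard deviation every single argument of the cumulant then
  tends to 0, so that only its quadratic part counts. In the uses below \<open>L n\<close> is an
  iterated logarithm.\<close>

definition moderate_weights :: "(nat \<Rightarrow> nat set) \<Rightarrow> (nat \<Rightarrow> nat \<Rightarrow> real) \<Rightarrow> (nat \<Rightarrow> real) \<Rightarrow> bool" where
  "moderate_weights I w L \<longleftrightarrow> (\<forall>n. finite (I n)) \<and> filterlim L at_top sequentially \<and>
     eventually (\<lambda>n. 0 < L2_set (w n) (I n)) sequentially \<and>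
     (\<exists>B. (\<forall>n. \<forall>i\<in>I n. \<bar>w n i\<bar> \<le> B n) \<and> (\<lambda>n. B n * sqrt (L n) / L2_set (w n) (I n)) \<longlonglongrightarrow> 0)"

lemma moderate_weights_uminus:
  "moderate_weights I w L \<Longrightarrow> moderate_weights I (\<lambda>n i. - w n i) L"
  by (simp add: moderate_weights_def L2_set_def)

text \<open>The squares of the arguments add up to exactly \<open>2 * a\<^sup>2 * L n\<close>, and
  the cumulant is half the square up to a cubic error; one factor of the cube is uniformly small by
  the condition on the largest weight.\<close>

lemma cumulant_sum_tendsto:
  assumes "moderate_weights I w L"
  shows "(\<lambda>n. (\<Sum>i\<in>I n. cumulant (a * sqrt (2 * L n) / L2_set (w n) (I n) * w n i)) / L n) \<longlonglongrightarrow> a\<^sup>2"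
proof -
  define s where "s n = L2_set (w n) (I n)" for n
  obtain B where fin: "\<And>n. finite (I n)" and L: "filterlim L at_top sequentially"
    and s: "eventually (\<lambda>n. 0 < s n) sequentially"
    and B: "\<And>n i. i \<in> I n \<Longrightarrow> \<bar>w n i\<bar> \<le> B n" and lim: "(\<lambda>n. B n * sqrt (L n) / s n) \<longlonglongrightarrow> 0"
    using assms unfolding moderate_weights_def s_def by blast
  \<comment> \<open>Bound for the modulus of every argument of the cumulant; \<open>sqrt 2\<close>
    stems from the tilt \<open>sqrt (2 * L n)\<close>.\<close>
  define e where "e n = \<bar>a\<bar> * sqrt 2 * (B n * sqrt (L n) / s n)" for n
  have e0: "e \<longlonglongrightarrow> 0"
    unfolding e_def using tendsto_mult_left[OF lim, of "\<bar>a\<bar> * sqrt 2"] by simp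
  have ev: "eventually (\<lambda>n. e n < 1 \<and> 0 < s n \<and> 0 < L n) sequentially"
    by (intro eventually_conj s order_tendstoD(2)[OF e0] filterlim_at_top_dense[THEN iffD1, OF L, rule_format]) simp
  have bound: "norm ((\<Sum>i\<in>I n. cumulant (a * sqrt (2 * L n) / s n * w n i)) / L n - a\<^sup>2) \<le> e n * (2 * a\<^sup>2)"
    if n: "e n < 1 \<and> 0 < s n \<and> 0 < L n" for n
  proof -
    define c where "c = a * sqrt (2 * L n) / s n"
    have sum2: "(\<Sum>i\<in>I n. (c * w n i)\<^sup>2) = 2 * a\<^sup>2 * L n"
    proof -
      have "(\<Sum>i\<in>I n. (c * w n i)\<^sup>2) = c\<^sup>2 * (s n)\<^sup>2"
        by (simp add: power_mult_distrib sum_distrib_left s_def L2_set_def sum_nonneg)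
      also have "\<dots> = 2 * a\<^sup>2 * L n"
        using n by (simp add: c_def power_divide power_mult_distrib)
      finally show ?thesis .
    qed
    have cw: "\<bar>c * w n i\<bar> \<le> e n" if "i \<in> I n" for i
    proof -
      have "\<bar>c * w n i\<bar> = \<bar>c\<bar> * \<bar>w n i\<bar>" by (simp add: abs_mult)
      also have "\<dots> \<le> \<bar>c\<bar> * B n" using B[OF that] by (intro mult_left_mono) auto
      also have "\<dots> = e n" using n by (simp add: c_def e_def abs_mult real_sqrt_mult)
      finally show ?thesis .
    qed
    have "\<bar>(\<Sum>i\<in>I n. cumulant (c * w n i)) - (\<Sum>i\<in>I n. (c * w n i)\<^sup>2) / 2\<bar>
        = \<bar>\<Sum>i\<in>I n. cumulant (c * w n i) - (c * w n i)\<^sup>2 / 2\<bar>"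
      by (simp add: sum_subtractf sum_divide_distrib)
    also have "\<dots> \<le> (\<Sum>i\<in>I n. \<bar>cumulant (c * w n i) - (c * w n i)\<^sup>2 / 2\<bar>)" by (rule sum_abs)
    also have "\<dots> \<le> (\<Sum>i\<in>I n. e n * (c * w n i)\<^sup>2)"
    proof (rule sum_mono)
      fix i assume i: "i \<in> I n"
      have "\<bar>cumulant (c * w n i) - (c * w n i)\<^sup>2 / 2\<bar> \<le> \<bar>c * w n i\<bar> ^ 3"
        using cw[OF i] n by (intro cumulant_approx) auto
      also have "\<dots> = \<bar>c * w n i\<bar> * (c * w n i)\<^sup>2" by (simp add: power3_eq_cube power2_eq_square)
      also have "\<dots> \<le> e n * (c * w n i)\<^sup>2" using cw[OF i] by (intro mult_right_mono) auto
      finally show "\<bar>cumulant (c * w n i) - (c * w n i)\<^sup>2 / 2\<bar> \<le> e n * (c * w n i)\<^sup>2" .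
    qed
    also have "\<dots> = e n * (2 * a\<^sup>2 * L n)" by (simp only: sum_distrib_left[symmetric] sum2)
    finally have *: "\<bar>(\<Sum>i\<in>I n. cumulant (c * w n i)) - a\<^sup>2 * L n\<bar> \<le> e n * (2 * a\<^sup>2) * L n"
      by (simp add: sum2)
    have "norm ((\<Sum>i\<in>I n. cumulant (c * w n i)) / L n - a\<^sup>2)
        = \<bar>(\<Sum>i\<in>I n. cumulant (c * w n i)) - a\<^sup>2 * L n\<bar> / L n"
      using n by (simp add: diff_divide_distrib abs_div_pos)
    also have "\<dots> \<le> e n * (2 * a\<^sup>2)" using * n by (simp add: pos_divide_le_eq)
    finally show ?thesis by (simp add: c_def)
  qed
  have "(\<lambda>n. (\<Sum>i\<in>I n. cumulant (a * sqrt (2 * L n) / s n * w n i)) / L n - a\<^sup>2) \<longlonglongrightarrow> 0"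
  proof (rule Lim_null_comparison)
    show "eventually (\<lambda>n. norm ((\<Sum>i\<in>I n. cumulant (a * sqrt (2 * L n) / s n * w n i)) / L n - a\<^sup>2) \<le> e n * (2 * a\<^sup>2)) sequentially"
      using ev by eventually_elim (rule bound)
    show "(\<lambda>n. e n * (2 * a\<^sup>2)) \<longlonglongrightarrow> 0"
      using tendsto_mult_right[OF e0, of "2 * a\<^sup>2"] by simp
  qed
  thus ?thesis unfolding s_def by (simp add: LIM_zero_iff)
qed

section \<open>Tails of weighted sums on the iterated-logarithm scale\<close>

locale centred_poisson_walk = prob_space M for M :: "'a measure" +
  fixes X :: "nat \<Rightarrow> 'a \<Rightarrow> real"
  assumes indep_X: "indep_vars (\<lambda>_. borel) X UNIV"
    and mgf_X: "\<And>i c. has_bochner_integral M (\<lambda>\<omega>. exp (c * X i \<omega>)) (exp (cumulant c))"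
begin

lemma measurable_X[measurable]: "X i \<in> borel_measurable M"
  using indep_X by (auto simp: indep_vars_def)

lemma mgf_weighted_sum:
  assumes "finite I"
  shows "has_bochner_integral M (\<lambda>\<omega>. exp (c * (\<Sum>i\<in>I. w i * X i \<omega>))) (exp (\<Sum>i\<in>I. cumulant (c * w i)))"
proof -
  have eq: "exp (c * (\<Sum>i\<in>I. w i * X i \<omega>)) = (\<Prod>i\<in>I. exp ((c * w i) * X i \<omega>))" for \<omega>
    using assms by (simp add: sum_distrib_left exp_sum mult.assoc)
  have ind: "indep_vars (\<lambda>_. borel) (\<lambda>i \<omega>. exp ((c * w i) * X i \<omega>)) I"
    using indep_vars_compose2[OF indep_vars_subset[OF indep_X subset_UNIV, of I], of "\<lambda>i x. exp ((c * w i) * x)" "\<lambda>_. borel"]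
    by simp
  have int: "integrable M (\<lambda>\<omega>. exp ((c * w i) * X i \<omega>))" for i
    using mgf_X has_bochner_integral_iff by blast
  show ?thesis unfolding eq has_bochner_integral_iff
    using indep_vars_lebesgue_integral[OF assms ind int] indep_vars_integrable[OF assms ind int]
      mgf_X[THEN has_bochner_integral_integral_eq] assms
    by (simp add: exp_sum)
qed

text \<open>Chernoff's bound at the optimal tilt: the exponent is
  \<open>- 2 * x\<^sup>2 * L n\<close> plus a cumulant sum close to \<open>x\<^sup>2 * L n\<close>.
  The bound for the product itself is exported too, because the maximal inequality for the plain
  walk ends in the same product.\<close>

lemma weighted_sum_upper_tail:
  assumes mw: "moderate_weights I w L" and x: "0 < x" "y < x\<^sup>2"
  shows "eventually (\<lambda>n. exp (- x * sqrt (2 * L n) / L2_set (w n) (I n) * (x * L2_set (w n) (I n) * sqrt (2 * L n)))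
      * expectation (\<lambda>\<omega>. exp (x * sqrt (2 * L n) / L2_set (w n) (I n) * (\<Sum>i\<in>I n. w n i * X i \<omega>)))
      \<le> exp (- y * L n)) sequentially"
    "eventually (\<lambda>n. prob {\<omega>\<in>space M. x * L2_set (w n) (I n) * sqrt (2 * L n) \<le> (\<Sum>i\<in>I n. w n i * X i \<omega>)}
      \<le> exp (- y * L n)) sequentially"
proof -
  define s where "s n = L2_set (w n) (I n)" for n
  define K where "K n = (\<Sum>i\<in>I n. cumulant (x * sqrt (2 * L n) / s n * w n i))" for n
  have fin: "\<And>n. finite (I n)" and L: "filterlim L at_top sequentially"
    and s: "eventually (\<lambda>n. 0 < s n) sequentially"
    using mw unfolding moderate_weights_def s_def by auto
  have lim: "(\<lambda>n. K n / L n) \<longlonglongrightarrow> x\<^sup>2"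
    using cumulant_sum_tendsto[OF mw, of x] by (simp add: K_def s_def)
  have "eventually (\<lambda>n. K n / L n < 2 * x\<^sup>2 - y \<and> 0 < s n \<and> 0 < L n) sequentially"
    by (intro eventually_conj s order_tendstoD(2)[OF lim] filterlim_at_top_dense[THEN iffD1, OF L, rule_format])
       (use x in simp)
  hence ev: "eventually (\<lambda>n. K n \<le> (2 * x\<^sup>2 - y) * L n \<and> 0 < s n \<and> 0 < L n) sequentially"
    by eventually_elim (auto simp: pos_divide_less_eq)
  have E: "expectation (\<lambda>\<omega>. exp (x * sqrt (2 * L n) / s n * (\<Sum>i\<in>I n. w n i * X i \<omega>))) = exp (K n)"
      and I: "integrable M (\<lambda>\<omega>. exp (x * sqrt (2 * L n) / s n * (\<Sum>i\<in>I n. w n i * X i \<omega>)))" for n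
    using mgf_weighted_sum[OF fin[of n], of "x * sqrt (2 * L n) / s n" "w n"]
    by (auto simp: K_def has_bochner_integral_iff)
  have main: "exp (- x * sqrt (2 * L n) / s n * (x * s n * sqrt (2 * L n))) * exp (K n) \<le> exp (- y * L n)"
    if "K n \<le> (2 * x\<^sup>2 - y) * L n \<and> 0 < s n \<and> 0 < L n" for n
  proof -
    have "- x * sqrt (2 * L n) / s n * (x * s n * sqrt (2 * L n)) = - (2 * x\<^sup>2 * L n)"
      using that by (simp add: power2_eq_square)
    hence "exp (- x * sqrt (2 * L n) / s n * (x * s n * sqrt (2 * L n))) * exp (K n) = exp (K n - 2 * x\<^sup>2 * L n)"
      by (simp only: exp_add[symmetric]) simp
    thus ?thesis using that by (simp add: algebra_simps)
  qed
  show 1: "eventually (\<lambda>n. exp (- x * sqrt (2 * L n) / s n * (x * s n * sqrt (2 * L n)))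
      * expectation (\<lambda>\<omega>. exp (x * sqrt (2 * L n) / s n * (\<Sum>i\<in>I n. w n i * X i \<omega>)))
      \<le> exp (- y * L n)) sequentially"
    unfolding E using ev by eventually_elim (rule main)
  show "eventually (\<lambda>n. prob {\<omega>\<in>space M. x * s n * sqrt (2 * L n) \<le> (\<Sum>i\<in>I n. w n i * X i \<omega>)}
      \<le> exp (- y * L n)) sequentially"
    using 1 ev
  proof eventually_elim
    case (elim n)
    have "prob {\<omega>\<in>space M. x * s n * sqrt (2 * L n) \<le> (\<Sum>i\<in>I n. w n i * X i \<omega>)} \<le>
      exp (- (x * sqrt (2 * L n) / s n) * (x * s n * sqrt (2 * L n))) *
      expectation (\<lambda>\<omega>. exp (x * sqrt (2 * L n) / s n * (\<Sum>i\<in>I n. w n i * X i \<omega>)))"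
      using elim x by (intro prob_ge_le_mgf I) auto
    with elim show ?case by simp
  qed
qed

text \<open>Under the tilt \<open>a = x + h\<close> the sum concentrates between
  \<open>a - h\<close> and \<open>a + h\<close>, in units of the standard deviation times
  \<open>sqrt (2 * L n)\<close>: the parts outside have the exponent
  \<open>a\<^sup>2 - h\<^sup>2\<close> instead of \<open>a\<^sup>2\<close>. Undoing the tilt at the
  upper end of the window costs \<open>2 * a * (a + h)\<close>, so that about
  \<open>- x\<^sup>2\<close> remains for small \<open>h\<close>.\<close>

lemma weighted_sum_lower_tail:
  assumes mw: "moderate_weights I w L" and x: "0 < x" "x\<^sup>2 < y"
  shows "eventually (\<lambda>n. exp (- y * L n) \<le>
    prob {\<omega>\<in>space M. x * L2_set (w n) (I n) * sqrt (2 * L n) \<le> (\<Sum>i\<in>I n. w n i * X i \<omega>)}) sequentially"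
proof -
  define s where "s n = L2_set (w n) (I n)" for n
  define K where "K a n = (\<Sum>i\<in>I n. cumulant (a * sqrt (2 * L n) / s n * w n i))" for a n
  have fin: "\<And>n. finite (I n)" and L: "filterlim L at_top sequentially"
    and s: "eventually (\<lambda>n. 0 < s n) sequentially"
    using mw unfolding moderate_weights_def s_def by auto
  have lim: "(\<lambda>n. K a n / L n) \<longlonglongrightarrow> a\<^sup>2" for a
    using cumulant_sum_tendsto[OF mw, of a] by (simp add: K_def s_def)
  have "((\<lambda>h. 2 * (x + h) * (x + 2 * h) - (x + h)\<^sup>2 + h\<^sup>2 / 2) \<longlongrightarrow> 2 * (x + 0) * (x + 2 * 0) - (x + 0)\<^sup>2 + 0\<^sup>2 / 2) (at_right 0)"
    by (rule tendsto_eq_intros refl | simp)+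
  hence "eventually (\<lambda>h. 2 * (x + h) * (x + 2 * h) - (x + h)\<^sup>2 + h\<^sup>2 / 2 < y) (at_right 0)"
    by (rule order_tendstoD(2)) (use x in \<open>simp add: power2_eq_square\<close>)
  hence "eventually (\<lambda>h. 0 < h \<and> 2 * (x + h) * (x + 2 * h) - (x + h)\<^sup>2 + h\<^sup>2 / 2 < y) (at_right 0)"
    using eventually_at_right_less[of 0] by eventually_elim auto
  then obtain h where h: "0 < h" and hy: "2 * (x + h) * (x + 2 * h) - (x + h)\<^sup>2 + h\<^sup>2 / 2 < y"
    using eventually_happens' trivial_limit_at_right_real by blast
  \<comment> \<open>A quarter of the loss outside the window: with an error \<open>d\<close> in each
    cumulant sum, a gap of \<open>2 * d\<close> still separates the exponents inside and
    outside.\<close>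
  define d where "d = h\<^sup>2 / 4"
  define a where "a = x + h"
  have d: "0 < d" using h by (simp add: d_def)
  have upp: "eventually (\<lambda>n. K b n < (b\<^sup>2 + d) * L n) sequentially" for b
  proof -
    have "eventually (\<lambda>n. K b n / L n < b\<^sup>2 + d \<and> 0 < L n) sequentially"
      by (intro eventually_conj order_tendstoD(2)[OF lim] filterlim_at_top_dense[THEN iffD1, OF L, rule_format])
         (use d in simp)
    thus ?thesis by eventually_elim (auto simp: pos_divide_less_eq)
  qed
  have low: "eventually (\<lambda>n. (a\<^sup>2 - d) * L n < K a n) sequentially"
  proof -
    have "eventually (\<lambda>n. a\<^sup>2 - d < K a n / L n \<and> 0 < L n) sequentially"
      by (intro eventually_conj order_tendstoD(1)[OF lim] filterlim_at_top_dense[THEN iffD1, OF L, rule_format])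
         (use d in simp)
    thus ?thesis by eventually_elim (auto simp: pos_less_divide_eq)
  qed
  have E: "expectation (\<lambda>\<omega>. exp (b * sqrt (2 * L n) / s n * (\<Sum>i\<in>I n. w n i * X i \<omega>))) = exp (K b n)"
      and I: "integrable M (\<lambda>\<omega>. exp (b * sqrt (2 * L n) / s n * (\<Sum>i\<in>I n. w n i * X i \<omega>)))" for b n
    using mgf_weighted_sum[OF fin[of n], of "b * sqrt (2 * L n) / s n" "w n"]
    by (auto simp: K_def has_bochner_integral_iff)
  \<comment> \<open>From here on each outside part is at most a quarter of the main term, and the
    remaining factor 1/2 is paid for by \<open>exp (- d * L n)\<close>.\<close>
  have big: "eventually (\<lambda>n. max (ln 4 / (2 * d)) (ln 2 / d) < L n) sequentially"
    using filterlim_at_top_dense[THEN iffD1, OF L] by blast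
  have "eventually (\<lambda>n. 0 < L n) sequentially"
    using filterlim_at_top_dense[THEN iffD1, OF L] by blast
  from this big s upp[of "a + h"] upp[of "a - h"] low show ?thesis
    unfolding s_def[symmetric]
  proof eventually_elim
    case (elim n)
    define l where "l = a * sqrt (2 * L n) / s n"
    define e where "e = h * sqrt (2 * L n) / s n"
    have sq: "sqrt (2 * L n) * sqrt (2 * L n) = 2 * L n" using elim by simp
    have le: "l + e = (a + h) * sqrt (2 * L n) / s n" "l - e = (a - h) * sqrt (2 * L n) / s n"
      by (auto simp: l_def e_def add_divide_distrib diff_divide_distrib algebra_simps)
    have eq: "l * ((a + h) * s n * sqrt (2 * L n)) = 2 * a * (a + h) * L n"
      "e * ((a + h) * s n * sqrt (2 * L n)) = 2 * h * (a + h) * L n"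
      "e * ((a - h) * s n * sqrt (2 * L n)) = 2 * h * (a - h) * L n"
      using elim sq by (simp_all add: l_def e_def)
    let ?V = "\<lambda>\<omega>. \<Sum>i\<in>I n. w n i * X i \<omega>"
    have bound: "exp (- l * ((a + h) * s n * sqrt (2 * L n))) * (expectation (\<lambda>\<omega>. exp (l * ?V \<omega>))
            - exp (- e * ((a + h) * s n * sqrt (2 * L n))) * expectation (\<lambda>\<omega>. exp ((l + e) * ?V \<omega>))
            - exp (e * ((a - h) * s n * sqrt (2 * L n))) * expectation (\<lambda>\<omega>. exp ((l - e) * ?V \<omega>)))
         \<le> prob {\<omega>\<in>space M. (a - h) * s n * sqrt (2 * L n) \<le> ?V \<omega>}"
      unfolding le unfolding l_def using elim h x
      by (intro prob_ge_ge_mgf[where l = "a * sqrt (2 * L n) / s n" and d = e, unfolded l_def[symmetric] le, unfolded l_def] I)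
         (auto simp: a_def e_def)
    have 1: "exp (- e * ((a + h) * s n * sqrt (2 * L n))) * expectation (\<lambda>\<omega>. exp ((l + e) * ?V \<omega>))
       \<le> exp ((a\<^sup>2 - h\<^sup>2 + d) * L n)"
    proof -
      have "- (2 * h * (a + h) * L n) + K (a + h) n \<le> - (2 * h * (a + h) * L n) + ((a + h)\<^sup>2 + d) * L n"
        using elim by simp
      also have "\<dots> = (a\<^sup>2 - h\<^sup>2 + d) * L n" by (simp add: power2_eq_square algebra_simps)
      finally show ?thesis unfolding le E mult_minus_left eq(2) exp_add[symmetric] by simp
    qed
    have 2: "exp (e * ((a - h) * s n * sqrt (2 * L n))) * expectation (\<lambda>\<omega>. exp ((l - e) * ?V \<omega>))
       \<le> exp ((a\<^sup>2 - h\<^sup>2 + d) * L n)"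
    proof -
      have "(2 * h * (a - h) * L n) + K (a - h) n \<le> (2 * h * (a - h) * L n) + ((a - h)\<^sup>2 + d) * L n"
        using elim by simp
      also have "\<dots> = (a\<^sup>2 - h\<^sup>2 + d) * L n" by (simp add: power2_eq_square algebra_simps)
      finally show ?thesis unfolding le E eq(3) exp_add[symmetric] by simp
    qed
    have 3: "exp ((a\<^sup>2 - d) * L n) \<le> expectation (\<lambda>\<omega>. exp (l * ?V \<omega>))"
      unfolding l_def E using elim by simp
    have 4: "exp ((a\<^sup>2 - h\<^sup>2 + d) * L n) \<le> exp ((a\<^sup>2 - d) * L n) / 4"
    proof -
      have "ln 4 \<le> 2 * d * L n" using elim d by (simp add: pos_divide_less_eq mult.commute)
      hence "(a\<^sup>2 - h\<^sup>2 + d) * L n + ln 4 \<le> (a\<^sup>2 - d) * L n"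
        by (simp add: d_def algebra_simps)
      hence "exp ((a\<^sup>2 - h\<^sup>2 + d) * L n + ln 4) \<le> exp ((a\<^sup>2 - d) * L n)" by simp
      thus ?thesis by (simp add: exp_add)
    qed
    have "exp (- y * L n) \<le> exp (- (2 * a * (a + h) * L n) + (a\<^sup>2 - d) * L n - ln 2)"
    proof -
      have l2: "ln 2 \<le> d * L n" using elim d by (simp add: pos_divide_less_eq mult.commute)
      have "2 * a * (a + h) - a\<^sup>2 + 2 * d \<le> y"
        using hy by (simp add: a_def d_def algebra_simps)
      hence "(2 * a * (a + h) - a\<^sup>2 + 2 * d) * L n \<le> y * L n"
        using elim by (intro mult_right_mono) auto
      thus ?thesis using l2 by (simp add: algebra_simps)
    qed
    also have "\<dots> = exp (- (2 * a * (a + h) * L n)) * (exp ((a\<^sup>2 - d) * L n) / 2)"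
      by (simp add: exp_add exp_diff exp_minus field_simps)
    also have "\<dots> \<le> exp (- l * ((a + h) * s n * sqrt (2 * L n))) * (expectation (\<lambda>\<omega>. exp (l * ?V \<omega>))
            - exp (- e * ((a + h) * s n * sqrt (2 * L n))) * expectation (\<lambda>\<omega>. exp ((l + e) * ?V \<omega>))
            - exp (e * ((a - h) * s n * sqrt (2 * L n))) * expectation (\<lambda>\<omega>. exp ((l - e) * ?V \<omega>)))"
      unfolding mult_minus_left eq(1)
      using 1[unfolded mult_minus_left] 2 3 4 by (intro mult_left_mono) (linarith, simp)
    also note bound
    finally show ?case by (simp add: a_def)
  qed
qed

end

section \<open>Iterated sums of a random walk and their law of the iterated logarithm\<close>

text \<open>Index 0 is already the walk, so \<open>k\<close> counts the discrete integrations
  applied to it; this is the index belonging to level \<open>Suc k\<close>.\<close>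

primrec iterated_sum :: "(nat \<Rightarrow> real) \<Rightarrow> nat \<Rightarrow> nat \<Rightarrow> real" where
  "iterated_sum x 0 n = (\<Sum>i<n. x i)"
| "iterated_sum x (Suc k) n = (\<Sum>i<n. iterated_sum x k i)"

text \<open>The weight of \<open>x i\<close> counts the chains i < m_1 < ... < m_k < n, that is the
  \<open>k\<close>-subsets of the \<open>n - 1 - i\<close> integers between; the induction is
  Pascal's rule.\<close>

lemma iterated_sum_eq:
  "iterated_sum x k n = (\<Sum>i<n. real ((n - 1 - i) choose k) * x i)"
proof (induction k arbitrary: n)
  case 0
  thus ?case by simp
next
  case (Suc k)
  show ?case
  proof (induction n)
    case 0
    thus ?case by simp
  next
    case (Suc n)
    have "(\<Sum>i<Suc n. real ((Suc n - 1 - i) choose Suc k) * x i)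
        = (\<Sum>i<n. real ((n - i) choose Suc k) * x i)" by simp
    also have "\<dots> = (\<Sum>i<n. real ((n - 1 - i) choose Suc k) * x i + real ((n - 1 - i) choose k) * x i)"
    proof (rule sum.cong[OF refl])
      fix i assume "i \<in> {..<n}"
      then obtain d where "n - i = Suc d" "n - 1 - i = d"
        by (metis Suc_diff_Suc diff_Suc_eq_diff_pred diff_commute lessThan_iff)
      thus "real ((n - i) choose Suc k) * x i
          = real ((n - 1 - i) choose Suc k) * x i + real ((n - 1 - i) choose k) * x i"
        by (simp add: algebra_simps)
    qed
    finally show ?case using Suc.IH \<open>\<And>n. iterated_sum x k n = _ n\<close>
      by (simp add: sum.distrib)
  qed
qed

section \<open>Variance of the iterated sums\<close>

lemma sum_power_bounds:
  "(\<Sum>m<n. real m ^ p) \<le> real n ^ Suc p / real (Suc p)"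
  "real n ^ Suc p / real (Suc p) - real n ^ p \<le> (\<Sum>m<n. real m ^ p)"
proof -
  \<comment> \<open>The increments of the power \<open>Suc p\<close> lie between its derivatives at
    both ends; telescoping then compares sum and integral.\<close>
  have step: "real (Suc p) * real m ^ p \<le> real (Suc m) ^ Suc p - real m ^ Suc p"
    "real (Suc m) ^ Suc p - real m ^ Suc p \<le> real (Suc p) * real (Suc m) ^ p" for m
  proof -
    have eq: "real (Suc m) ^ Suc p - real m ^ Suc p = (\<Sum>i<Suc p. real (Suc m) ^ i * real m ^ (p - i))"
      by (subst power_diff_sumr2) (simp add: mult.commute)
    have "(\<Sum>i<Suc p. real m ^ p) \<le> (\<Sum>i<Suc p. real (Suc m) ^ i * real m ^ (p - i))"
    proof (rule sum_mono)
      fix i assume "i \<in> {..<Suc p}"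
      hence "real m ^ p = real m ^ i * real m ^ (p - i)" by (simp flip: power_add)
      also have "\<dots> \<le> real (Suc m) ^ i * real m ^ (p - i)"
        by (intro mult_right_mono power_mono) auto
      finally show "real m ^ p \<le> real (Suc m) ^ i * real m ^ (p - i)" .
    qed
    thus "real (Suc p) * real m ^ p \<le> real (Suc m) ^ Suc p - real m ^ Suc p"
      unfolding eq by simp
    have "(\<Sum>i<Suc p. real (Suc m) ^ i * real m ^ (p - i)) \<le> (\<Sum>i<Suc p. real (Suc m) ^ p)"
    proof (rule sum_mono)
      fix i assume "i \<in> {..<Suc p}"
      hence "real (Suc m) ^ p = real (Suc m) ^ i * real (Suc m) ^ (p - i)" by (simp flip: power_add)
      moreover have "real (Suc m) ^ i * real m ^ (p - i) \<le> real (Suc m) ^ i * real (Suc m) ^ (p - i)"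
        by (intro mult_left_mono power_mono) auto
      ultimately show "real (Suc m) ^ i * real m ^ (p - i) \<le> real (Suc m) ^ p" by simp
    qed
    thus "real (Suc m) ^ Suc p - real m ^ Suc p \<le> real (Suc p) * real (Suc m) ^ p"
      unfolding eq by simp
  qed
  have tele: "(\<Sum>m<n. real (Suc m) ^ Suc p - real m ^ Suc p) = real n ^ Suc p"
    by (subst sum_lessThan_telescope) simp
  have "real (Suc p) * (\<Sum>m<n. real m ^ p) \<le> real n ^ Suc p"
    unfolding tele[symmetric] sum_distrib_left using step(1) by (intro sum_mono) auto
  thus "(\<Sum>m<n. real m ^ p) \<le> real n ^ Suc p / real (Suc p)"
    by (simp add: pos_le_divide_eq mult.commute)
  have "real n ^ Suc p \<le> real (Suc p) * (\<Sum>m<n. real (Suc m) ^ p)"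
    unfolding tele[symmetric] sum_distrib_left using step(2) by (intro sum_mono) auto
  hence "real n ^ Suc p / real (Suc p) \<le> (\<Sum>m<n. real (Suc m) ^ p)"
    by (simp add: pos_divide_le_eq mult.commute)
  also have "\<dots> \<le> (\<Sum>m<n. real m ^ p) + real n ^ p"
  proof -
    have "(\<Sum>m<n. real (Suc m) ^ p - real m ^ p) = real n ^ p - 0 ^ p"
      by (subst sum_lessThan_telescope) simp
    moreover have "(0::real) \<le> 0 ^ p" by simp
    ultimately show ?thesis by (simp only: sum_subtractf)
  qed
  finally show "real n ^ Suc p / real (Suc p) - real n ^ p \<le> (\<Sum>m<n. real m ^ p)" by simp
qed

lemma binomial_ge_pow: "(m - k) ^ k \<le> (m choose k) * fact k"
proof (induction k)
  case (Suc k)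
  have "(m - Suc k) ^ Suc k \<le> (m - k) ^ k * (m - k)"
    by (simp add: mult.commute) (intro mult_mono power_mono; simp)
  also have "\<dots> \<le> ((m choose k) * fact k) * (m - k)"
    using Suc by (intro mult_right_mono) auto
  also have "\<dots> = (m choose Suc k) * fact (Suc k)"
  proof (cases "k < m")
    case True
    have "Suc k * (m choose Suc k) = (m - k) * (m choose k)"
      by (metis True binomial_absorb_comp binomial_absorption less_imp_Suc_add diff_add_inverse mult.commute)
    hence "fact k * (Suc k * (m choose Suc k)) = fact k * ((m - k) * (m choose k))" by simp
    thus ?thesis by (simp only: fact_Suc of_nat_id mult_ac)
  qed auto
  finally show ?case .
qed auto

text \<open>This is the variance of an iterated sum of \<open>n\<close> uncorrelated terms of
  variance 1, compared with the integral of t^(2k) / (k!)^2. Bernoulli's inequality turns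
  \<open>(m - k) ^ k\<close> into \<open>m ^ k\<close> up to order \<open>m ^ (k - 1)\<close>. Only
  a relative error O(1/n) is wanted, so the constant in front of it is crude.\<close>

lemma binomial_sq_sum_bounds:
  "(\<Sum>m<n. (real (m choose k))\<^sup>2) \<le> real n ^ (2 * k + 1) / ((fact k)\<^sup>2 * real (2 * k + 1))"
  "real n ^ (2 * k + 1) / ((fact k)\<^sup>2 * real (2 * k + 1)) - (1 + 2 * real k ^ 2) * real n ^ (2 * k)
     \<le> (\<Sum>m<n. (real (m choose k))\<^sup>2)"
proof -
  have up: "real (m choose k) * fact k \<le> real m ^ k" for m
    using binomial_fact_pow[of m k] by (metis of_nat_fact of_nat_le_iff of_nat_mult of_nat_power)
  have lo: "real m ^ k - real k ^ 2 * real m ^ (k - 1) \<le> real (m choose k) * fact k" for m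
  proof (cases "k \<le> m \<and> 0 < m")
    case True
    have "1 + real k * (- (real k / real m)) \<le> (1 + - (real k / real m)) ^ k"
      using True by (intro Bernoulli_inequality) auto
    hence "real m ^ k * (1 + real k * (- (real k / real m))) \<le> real m ^ k * (1 + - (real k / real m)) ^ k"
      by (intro mult_left_mono) auto
    also have "\<dots> = (real m - real k) ^ k"
      using True by (simp add: power_mult_distrib[symmetric] algebra_simps)
    also have "\<dots> = real ((m - k) ^ k)" using True by (simp add: of_nat_diff)
    also have "\<dots> \<le> real ((m choose k) * fact k)" using binomial_ge_pow[of m k] of_nat_le_iff by blast
    finally have "real m ^ k - real k ^ 2 * (real m ^ k / real m) \<le> real (m choose k) * fact k"
      by (simp add: power2_eq_square algebra_simps)
    also have "real k ^ 2 * (real m ^ k / real m) = real k ^ 2 * real m ^ (k - 1)"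
      using True by (cases k) auto
    finally show ?thesis .
  next
    case False
    show ?thesis
    proof (cases k)
      case 0
      thus ?thesis by simp
    next
      \<comment> \<open>Here \<open>m \<le> k\<close>, so the subtracted term is at least
        \<open>m ^ k\<close> and the left-hand side is not positive.\<close>
      case (Suc j)
      have "real m ^ k = real m * real m ^ (k - 1)" using Suc by simp
      also have "\<dots> \<le> real k ^ 2 * real m ^ (k - 1)"
      proof (rule mult_right_mono)
        have "real m \<le> real k" using False Suc by auto
        also have "\<dots> \<le> real k ^ 2" using Suc by (simp add: power2_eq_square)
        finally show "real m \<le> real k ^ 2" .
      qed auto
      finally show ?thesis by (smt (verit) fact_ge_zero mult_nonneg_nonneg of_nat_0_le_iff)
    qed
  qed
  have up2: "(real (m choose k))\<^sup>2 * (fact k)\<^sup>2 \<le> real m ^ (2 * k)" for m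
    using power_mono[OF up[of m], of 2] by (simp add: power_mult_distrib power_mult[symmetric] mult.commute)
  have lo2: "real m ^ (2 * k) - 2 * real k ^ 2 * real m ^ (2 * k - 1) \<le> (real (m choose k))\<^sup>2 * (fact k)\<^sup>2" for m
  proof -
    let ?b = "real (m choose k) * fact k" and ?a = "real m ^ k"
    have "?a\<^sup>2 - ?b\<^sup>2 = (?a - ?b) * (?a + ?b)" by (simp add: power2_eq_square algebra_simps)
    also have "\<dots> \<le> (real k ^ 2 * real m ^ (k - 1)) * (2 * ?a)"
      using up[of m] lo[of m] by (intro mult_mono) auto
    also have "\<dots> = 2 * real k ^ 2 * real m ^ (2 * k - 1)"
    proof (cases "k = 0")
      case False
      hence "real m ^ (k - 1) * real m ^ k = real m ^ (2 * k - 1)"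
        by (simp add: power_add[symmetric] mult_2)
      thus ?thesis by (simp only: mult_ac)
    qed simp
    finally show ?thesis by (simp add: power_mult_distrib power_mult[symmetric] mult.commute)
  qed
  have pos: "(0::real) < (fact k)\<^sup>2" by simp
  have fk: "(1::real) \<le> (fact k)\<^sup>2" using power_mono[of 1 "fact k :: real" 2] by simp
  have "(fact k)\<^sup>2 * (\<Sum>m<n. (real (m choose k))\<^sup>2) \<le> (\<Sum>m<n. real m ^ (2 * k))"
    unfolding sum_distrib_left using up2 by (intro sum_mono) (simp add: mult.commute)
  also have "\<dots> \<le> real n ^ (2 * k + 1) / real (2 * k + 1)"
    using sum_power_bounds(1)[of "2 * k" n] by simp
  finally have *: "(fact k)\<^sup>2 * (\<Sum>m<n. (real (m choose k))\<^sup>2) \<le> real n ^ (2 * k + 1) / real (2 * k + 1)" .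
  show "(\<Sum>m<n. (real (m choose k))\<^sup>2) \<le> real n ^ (2 * k + 1) / ((fact k)\<^sup>2 * real (2 * k + 1))"
  proof -
    have "(\<Sum>m<n. (real (m choose k))\<^sup>2) \<le> real n ^ (2 * k + 1) / real (2 * k + 1) / (fact k)\<^sup>2"
      using pos * by (simp only: pos_le_divide_eq mult.commute)
    thus ?thesis by (simp only: divide_divide_eq_left mult.commute)
  qed
  have "(\<Sum>m<n. real m ^ (2 * k)) - 2 * real k ^ 2 * (\<Sum>m<n. real m ^ (2 * k - 1))
     = (\<Sum>m<n. real m ^ (2 * k) - 2 * real k ^ 2 * real m ^ (2 * k - 1))"
    by (simp add: sum_subtractf sum_distrib_left)
  also have "\<dots> \<le> (fact k)\<^sup>2 * (\<Sum>m<n. (real (m choose k))\<^sup>2)"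
    unfolding sum_distrib_left using lo2 by (intro sum_mono) (simp add: mult.commute)
  finally have 1: "(\<Sum>m<n. real m ^ (2 * k)) - 2 * real k ^ 2 * (\<Sum>m<n. real m ^ (2 * k - 1))
      \<le> (fact k)\<^sup>2 * (\<Sum>m<n. (real (m choose k))\<^sup>2)" .
  have 2: "2 * real k ^ 2 * (\<Sum>m<n. real m ^ (2 * k - 1)) \<le> 2 * real k ^ 2 * real n ^ (2 * k)"
  proof (cases k)
    case (Suc j)
    have "(\<Sum>m<n. real m ^ (2 * k - 1)) \<le> real n ^ (2 * k) / real (2 * k)"
      using sum_power_bounds(1)[of "2 * k - 1" n] Suc by simp
    also have "\<dots> \<le> real n ^ (2 * k)"
    proof -
      have "real n ^ (2 * k) * 1 \<le> real n ^ (2 * k) * real (2 * k)"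
        using Suc by (intro mult_left_mono) auto
      thus ?thesis using Suc by (subst pos_divide_le_eq) auto
    qed
    finally show ?thesis by (intro mult_left_mono) auto
  qed auto
  have "real n ^ (2 * k + 1) / real (2 * k + 1) - (1 + 2 * real k ^ 2) * real n ^ (2 * k)
      \<le> (fact k)\<^sup>2 * (\<Sum>m<n. (real (m choose k))\<^sup>2)"
    using 1 2 sum_power_bounds(2)[of n "2 * k"] by (simp add: algebra_simps)
  hence "(real n ^ (2 * k + 1) / real (2 * k + 1) - (1 + 2 * real k ^ 2) * real n ^ (2 * k)) / (fact k)\<^sup>2
      \<le> (\<Sum>m<n. (real (m choose k))\<^sup>2)"
    using pos by (simp add: pos_divide_le_eq mult.commute)
  moreover have "(1 + 2 * real k ^ 2) * real n ^ (2 * k) / (fact k)\<^sup>2 \<le> (1 + 2 * real k ^ 2) * real n ^ (2 * k)"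
    using fk by (intro divide_left_mono[of 1, simplified]) auto
  ultimately show "real n ^ (2 * k + 1) / ((fact k)\<^sup>2 * real (2 * k + 1)) - (1 + 2 * real k ^ 2) * real n ^ (2 * k)
     \<le> (\<Sum>m<n. (real (m choose k))\<^sup>2)"
    by (simp add: diff_divide_distrib mult.commute)
qed

definition binomial_sd :: "nat \<Rightarrow> nat \<Rightarrow> real" where
  "binomial_sd k n = sqrt (\<Sum>m<n. (real (m choose k))\<^sup>2)"

text \<open>Origin of the constants of the theorem: at index k - 1 the limit is 1 / ((k-1)!
  (2k-1)^(1/2)).\<close>

lemma binomial_sd_asymp:
  "(\<lambda>n. binomial_sd k n / (real n ^ k * sqrt (real n))) \<longlonglongrightarrow> 1 / (fact k * sqrt (2 * k + 1))"
proof -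
  define c where "c = 1 / ((fact k)\<^sup>2 * real (2 * k + 1))"
  define v where "v n = (\<Sum>m<n. (real (m choose k))\<^sup>2)" for n
  have "(\<lambda>n. v n / real n ^ (2 * k + 1)) \<longlonglongrightarrow> c"
  proof (rule tendsto_sandwich)
    show "(\<lambda>n. c - (1 + 2 * real k ^ 2) / real n) \<longlonglongrightarrow> c" by real_asymp
    show "(\<lambda>n. c) \<longlonglongrightarrow> c" by simp
    show "eventually (\<lambda>n. v n / real n ^ (2 * k + 1) \<le> c) sequentially"
      using eventually_gt_at_top[of 0]
    proof eventually_elim
      case (elim n)
      thus ?case using binomial_sq_sum_bounds(1)[where n = n and k = k]
        by (simp add: pos_divide_le_eq v_def c_def)
    qed
    show "eventually (\<lambda>n. c - (1 + 2 * real k ^ 2) / real n \<le> v n / real n ^ (2 * k + 1)) sequentially"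
      using eventually_gt_at_top[of 0]
    proof eventually_elim
      case (elim n)
      have "(c - (1 + 2 * real k ^ 2) / real n) * real n ^ (2 * k + 1) =
        c * real n ^ (2 * k + 1) - (1 + 2 * real k ^ 2) * real n ^ (2 * k)"
        using elim by (simp add: left_diff_distrib)
      hence "(c - (1 + 2 * real k ^ 2) / real n) * real n ^ (2 * k + 1) =
        real n ^ (2 * k + 1) / ((fact k)\<^sup>2 * real (2 * k + 1)) - (1 + 2 * real k ^ 2) * real n ^ (2 * k)"
        by (simp add: c_def)
      thus ?case using elim binomial_sq_sum_bounds(2)[where n = n and k = k]
        by (simp add: pos_le_divide_eq v_def)
    qed
  qed
  hence "(\<lambda>n. sqrt (v n / real n ^ (2 * k + 1))) \<longlonglongrightarrow> sqrt c"
    by (rule tendsto_real_sqrt)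
  also have "sqrt c = 1 / (fact k * sqrt (2 * k + 1))"
    by (simp add: c_def real_sqrt_divide real_sqrt_mult)
  also have "(\<lambda>n. sqrt (v n / real n ^ (2 * k + 1))) = (\<lambda>n. binomial_sd k n / (real n ^ k * sqrt (real n)))"
  proof
    fix n
    have "sqrt (real n ^ (2 * k + 1)) = real n ^ k * sqrt (real n)"
      by (simp add: real_sqrt_mult power_mult mult.commute[of 2] power2_eq_square[symmetric] mult.commute)
    thus "sqrt (v n / real n ^ (2 * k + 1)) = binomial_sd k n / (real n ^ k * sqrt (real n))"
      by (simp only: real_sqrt_divide binomial_sd_def v_def)
  qed
  finally show ?thesis .
qed

lemma binomial_sd_nonneg [simp]: "0 \<le> binomial_sd k n"
  by (simp add: binomial_sd_def sum_nonneg)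

text \<open>The reversal of \<open>i\<close> into \<open>N - 1 - i\<close> turns the last block into
  an initial segment, so its norm is a standard deviation of the same kind. The factor
  \<open>c\<close> will be a sign.\<close>

lemma L2_set_binomial:
  assumes "P \<le> N"
  shows "L2_set (\<lambda>i. c * real ((N - 1 - i) choose k)) {P..<N} = \<bar>c\<bar> * binomial_sd k (N - P)"
proof -
  have "(\<Sum>i\<in>{P..<N}. (c * real ((N - 1 - i) choose k))\<^sup>2) = (\<Sum>m<N - P. (c * real (m choose k))\<^sup>2)"
    by (rule sum.reindex_bij_witness[of _ "\<lambda>m. N - 1 - m" "\<lambda>i. N - 1 - i"]) (use assms in auto)
  thus ?thesis
    by (simp add: L2_set_def binomial_sd_def power_mult_distrib sum_distrib_left[symmetric] real_sqrt_mult)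
qed

text \<open>Asymptotic standard deviation times the iterated-logarithm factor. The argument is real
  because it finally becomes log n, which makes the double logarithm the triple one of the
  theorem.\<close>

definition lil_norm :: "nat \<Rightarrow> real \<Rightarrow> real" where
  "lil_norm k t = t ^ k * sqrt t * sqrt (2 * ln (ln t)) / (fact k * sqrt (2 * k + 1))"

lemma lil_norm_mono:
  assumes "3 \<le> s" "s \<le> t"
  shows "lil_norm k s \<le> lil_norm k t"
proof -
  \<comment> \<open>The threshold 3 exceeds e, so that the iterated logarithm is
    nonnegative.\<close>
  have "exp 1 < (3::real)" by (rule e_less_272[THEN less_trans]) simp
  hence "1 \<le> ln s" using assms by (subst ln_ge_iff) auto
  moreover have "ln s \<le> ln t" using assms by simp
  ultimately show ?thesis unfolding lil_norm_def using assms
    by (intro divide_right_mono mult_mono power_mono) (auto intro!: mult_nonneg_nonneg)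
qed

lemma lil_norm_pos: "3 \<le> t \<Longrightarrow> 0 < lil_norm k t"
proof -
  assume t: "3 \<le> t"
  have "exp 1 < (3::real)" by (rule e_less_272[THEN less_trans]) simp
  hence "exp 1 < t" using t by simp
  hence "ln (exp 1) < ln t" using t by (subst ln_less_cancel_iff) auto
  thus ?thesis using t unfolding lil_norm_def by simp
qed

text \<open>Taking the least index beyond \<open>m\<close> at which the grid exceeds
  \<open>n\<close> avoids any appeal to monotonicity of the grid.\<close>

lemma exists_grid_interval:
  fixes N :: "nat \<Rightarrow> nat"
  assumes "filterlim N at_top sequentially" and "N m \<le> n"
  shows "\<exists>j\<ge>m. N j \<le> n \<and> n < N (Suc j)"
proof -
  obtain j0 where j0: "\<And>j. j \<ge> j0 \<Longrightarrow> n < N j"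
    using filterlim_at_top[THEN iffD1, OF assms(1), rule_format, of "Suc n"]
    by (auto simp: eventually_sequentially Suc_le_eq)
  define j where "j = (LEAST j. m < j \<and> n < N j)"
  have j: "m < j \<and> n < N j" unfolding j_def
    by (rule LeastI[of _ "max (Suc m) j0"]) (use j0 in auto)
  have "N (j - 1) \<le> n"
  proof (cases "m < j - 1")
    case True
    hence "\<not> (m < j - 1 \<and> n < N (j - 1))"
      unfolding j_def by (intro not_less_Least) (use j in \<open>auto simp: j_def\<close>)
    thus ?thesis using True by simp
  next
    case False
    hence "j - 1 = m" using j by linarith
    thus ?thesis using assms by simp
  qed
  thus ?thesis using j by (intro exI[of _ "j - 1"]) auto
qed

text \<open>The weights are at most of order N^k while the norm is at least of order N^k sqrt N,
  which leaves sqrt (log log N / N) in the condition on the largest weight. This covers the full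
  range, its last block, and the terms before that block.\<close>

lemma moderate_weights_binomial:
  fixes N P :: "nat \<Rightarrow> nat"
  assumes N: "filterlim N at_top sequentially" and PN: "\<And>j. P j \<le> N j" and c: "c \<noteq> 0"
    and pos: "0 < r" "eventually (\<lambda>j. r * (real (N j) ^ k * sqrt (real (N j))) \<le> L2_set (\<lambda>i. c * real ((N j - 1 - i) choose k)) (I j)) sequentially"
    and I: "\<And>j. I j \<subseteq> {..<N j}"
  shows "moderate_weights I (\<lambda>j i. c * real ((N j - 1 - i) choose k)) (\<lambda>j. ln (ln (real (N j))))"
  unfolding moderate_weights_def
proof (intro conjI exI allI ballI)
  have rN: "filterlim (\<lambda>j. real (N j)) at_top sequentially"
    by (rule filterlim_compose[OF filterlim_real_sequentially N])
  show "finite (I j)" for j using I finite_subset by blast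
  have "filterlim (\<lambda>x::real. ln (ln x)) at_top at_top" by real_asymp
  thus "filterlim (\<lambda>j. ln (ln (real (N j)))) at_top sequentially"
    by (rule filterlim_compose[OF _ rN])
  have ev: "eventually (\<lambda>j. 3 \<le> N j) sequentially"
    using filterlim_at_top[THEN iffD1, OF N] by blast
  have l3: "0 \<le> ln (ln (real n))" if "3 \<le> n" for n :: nat
  proof -
    have "exp 1 < (3::real)" by (rule e_less_272[THEN less_trans]) simp
    hence "1 \<le> ln (real n)" using that by (subst ln_ge_iff) auto
    thus ?thesis by simp
  qed
  from ev pos(2)
  show "eventually (\<lambda>j. 0 < L2_set (\<lambda>i. c * real ((N j - 1 - i) choose k)) (I j)) sequentially"
  proof eventually_elim
    case (elim j)
    have "0 < r * (real (N j) ^ k * sqrt (real (N j)))" using elim pos(1) by simp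
    thus ?case using elim by linarith
  qed
  show "\<bar>c * real ((N j - 1 - i) choose k)\<bar> \<le> \<bar>c\<bar> * real (N j) ^ k" if "i \<in> I j" for i j
  proof -
    have "((N j - 1 - i) choose k) \<le> (N j - 1 - i) ^ k"
      by (metis binomial_le_pow binomial_eq_0 le0 not_le)
    also have "\<dots> \<le> N j ^ k" by (intro power_mono) auto
    finally have "real ((N j - 1 - i) choose k) \<le> real (N j) ^ k"
      by (metis of_nat_le_iff of_nat_power)
    thus ?thesis by (simp add: abs_mult mult_left_mono)
  qed
  show "(\<lambda>j. \<bar>c\<bar> * real (N j) ^ k * sqrt (ln (ln (real (N j)))) / L2_set (\<lambda>i. c * real ((N j - 1 - i) choose k)) (I j)) \<longlonglongrightarrow> 0"
  proof (rule Lim_null_comparison)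
    have "((\<lambda>x::real. \<bar>c\<bar> / r * (sqrt (ln (ln x)) / sqrt x)) \<longlongrightarrow> 0) at_top" by real_asymp
    thus "(\<lambda>j. \<bar>c\<bar> / r * (sqrt (ln (ln (real (N j)))) / sqrt (real (N j)))) \<longlonglongrightarrow> 0"
      by (rule filterlim_compose[OF _ rN])
    from ev pos(2) show "eventually (\<lambda>j. norm (\<bar>c\<bar> * real (N j) ^ k * sqrt (ln (ln (real (N j)))) / L2_set (\<lambda>i. c * real ((N j - 1 - i) choose k)) (I j))
      \<le> \<bar>c\<bar> / r * (sqrt (ln (ln (real (N j)))) / sqrt (real (N j)))) sequentially"
    proof eventually_elim
      case (elim j)
      let ?s = "L2_set (\<lambda>i. c * real ((N j - 1 - i) choose k)) (I j)"
      have p: "0 < r * (real (N j) ^ k * sqrt (real (N j)))" using elim pos(1) by simp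
      have n: "0 \<le> \<bar>c\<bar> * real (N j) ^ k * sqrt (ln (ln (real (N j))))" using l3[OF elim(1)] by simp
      have "norm (\<bar>c\<bar> * real (N j) ^ k * sqrt (ln (ln (real (N j)))) / ?s) = \<bar>c\<bar> * real (N j) ^ k * sqrt (ln (ln (real (N j)))) / ?s"
        using n p elim(2) by (simp only: real_norm_def) (rule abs_of_nonneg, auto intro!: divide_nonneg_nonneg)
      also have "\<dots> \<le> \<bar>c\<bar> * real (N j) ^ k * sqrt (ln (ln (real (N j)))) / (r * (real (N j) ^ k * sqrt (real (N j))))"
        using n p elim(2) by (intro divide_left_mono) auto
      also have "\<dots> = \<bar>c\<bar> / r * (sqrt (ln (ln (real (N j)))) / sqrt (real (N j)))"
        using elim(1) by simp
      finally show ?case .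
    qed
  qed
qed

text \<open>For \<open>b < 1\<close> consecutive grid points have ratio tending to 1, and for \<open>b\<close> close to 1 the tail
  probabilities \<open>exp (- y ln (ln N)) \<le> j powr (- b y)\<close> with \<open>y > 1\<close> are still summable.\<close>

definition stretched_grid :: "real \<Rightarrow> nat \<Rightarrow> nat" where
  "stretched_grid b j = nat \<lceil>exp (real j powr b)\<rceil>"

lemma real_stretched_grid: "real (stretched_grid b j) = real_of_int \<lceil>exp (real j powr b)\<rceil>"
proof -
  have "0 \<le> \<lceil>exp (real j powr b)\<rceil>" using exp_gt_zero[of "real j powr b"] by linarith
  thus ?thesis by (simp add: stretched_grid_def)
qed

lemma stretched_grid_at_top:
  assumes "0 < b" shows "filterlim (stretched_grid b) at_top sequentially"
proof -
  have "filterlim (\<lambda>j. real (stretched_grid b j)) at_top sequentially"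
    unfolding real_stretched_grid using assms by real_asymp
  thus ?thesis using filterlim_sequentially_iff_filterlim_real by blast
qed

lemma stretched_grid_ratio:
  assumes "0 < b" "b < 1"
  shows "(\<lambda>j. real (stretched_grid b (Suc j)) / real (stretched_grid b j)) \<longlonglongrightarrow> 1"
  unfolding real_stretched_grid using assms by real_asymp

text \<open>Regular variation: once the ratio is near 1, the iterated logarithm is squeezed between
  its values at \<open>t / 2\<close> and \<open>2 * t\<close>. It serves both for neighbouring grid
  points and for exchanging integer times with log n.\<close>

lemma lil_norm_ratio:
  fixes p t :: "'b \<Rightarrow> real"
  assumes t: "filterlim t at_top F" and ratio: "((\<lambda>x. p x / t x) \<longlongrightarrow> 1) F"
  shows "((\<lambda>x. lil_norm k (p x) / lil_norm k (t x)) \<longlongrightarrow> 1) F"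
proof -
  have bnd: "eventually (\<lambda>x. t x / 2 \<le> p x \<and> p x \<le> 2 * t x) F"
  proof -
    have "eventually (\<lambda>x. 1 / 2 < p x / t x) F" "eventually (\<lambda>x. p x / t x < 2) F"
      by (rule order_tendstoD[OF ratio]; simp)+
    moreover have "eventually (\<lambda>x. 1 \<le> t x) F" using t by (simp add: filterlim_at_top)
    ultimately show ?thesis by eventually_elim (auto simp: field_simps)
  qed
  have ll: "((\<lambda>x. ln (ln (p x)) / ln (ln (t x))) \<longlongrightarrow> 1) F"
  proof (rule tendsto_sandwich)
    have "((\<lambda>t::real. ln (ln (t / 2)) / ln (ln t)) \<longlongrightarrow> 1) at_top" by real_asymp
    thus "((\<lambda>x. ln (ln (t x / 2)) / ln (ln (t x))) \<longlongrightarrow> 1) F" by (rule filterlim_compose[OF _ t])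
    have "((\<lambda>t::real. ln (ln (2 * t)) / ln (ln t)) \<longlongrightarrow> 1) at_top" by real_asymp
    thus "((\<lambda>x. ln (ln (2 * t x)) / ln (ln (t x))) \<longlongrightarrow> 1) F" by (rule filterlim_compose[OF _ t])
    have "eventually (\<lambda>t::real. 0 < ln (ln t) \<and> 0 < ln (t / 2) \<and> 0 < t) at_top" by (intro eventually_conj; real_asymp)
    from eventually_compose_filterlim[OF this t]
    have pos: "eventually (\<lambda>x. 0 < ln (ln (t x)) \<and> 0 < ln (t x / 2) \<and> 0 < t x) F" .
    show "eventually (\<lambda>x. ln (ln (t x / 2)) / ln (ln (t x)) \<le> ln (ln (p x)) / ln (ln (t x))) F"
      using bnd pos
    proof eventually_elim
      case (elim x)
      have "ln (t x / 2) \<le> ln (p x)" using elim by (subst ln_le_cancel_iff) auto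
      hence "ln (ln (t x / 2)) \<le> ln (ln (p x))" using elim by (subst ln_le_cancel_iff) auto
      thus ?case using elim by (intro divide_right_mono) auto
    qed
    show "eventually (\<lambda>x. ln (ln (p x)) / ln (ln (t x)) \<le> ln (ln (2 * t x)) / ln (ln (t x))) F"
      using bnd pos
    proof eventually_elim
      case (elim x)
      have "ln (t x / 2) \<le> ln (p x)" using elim by (subst ln_le_cancel_iff) auto
      moreover have "ln (p x) \<le> ln (2 * t x)" using elim by (subst ln_le_cancel_iff) auto
      ultimately have "ln (ln (p x)) \<le> ln (ln (2 * t x))" using elim by (subst ln_le_cancel_iff) auto
      thus ?case using elim by (intro divide_right_mono) auto
    qed
  qed
  show "((\<lambda>x. lil_norm k (p x) / lil_norm k (t x)) \<longlongrightarrow> 1) F"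
  proof (rule Lim_transform_eventually)
    have "((\<lambda>x. (p x / t x) ^ k * sqrt (p x / t x) * sqrt (ln (ln (p x)) / ln (ln (t x)))) \<longlongrightarrow> 1 ^ k * sqrt 1 * sqrt 1) F"
      by (intro tendsto_intros ratio ll)
    thus "((\<lambda>x. (p x / t x) ^ k * sqrt (p x / t x) * sqrt (ln (ln (p x)) / ln (ln (t x)))) \<longlongrightarrow> 1) F" by simp
    show "eventually (\<lambda>x. (p x / t x) ^ k * sqrt (p x / t x) * sqrt (ln (ln (p x)) / ln (ln (t x))) = lil_norm k (p x) / lil_norm k (t x)) F"
    proof (rule always_eventually, rule allI)
      fix x
      have q: "(a * b * (r2 * d)) / D / ((a' * b' * (r2 * d')) / D) = (a / a') * (b / b') * (d / d')"
        if "D \<noteq> 0" "r2 \<noteq> 0" for a b d a' b' d' D r2 :: real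
      proof -
        have "(a * b * (r2 * d)) / D / ((a' * b' * (r2 * d')) / D) = (a * b * d) * r2 / D / ((a' * b' * d') * r2 / D)"
          by (simp only: mult_ac)
        also have "\<dots> = (a * b * d) / (a' * b' * d')" using that by simp
        finally show ?thesis by (simp only: times_divide_times_eq)
      qed
      have "lil_norm k (p x) / lil_norm k (t x) = p x ^ k / t x ^ k * (sqrt (p x) / sqrt (t x)) * (sqrt (ln (ln (p x))) / sqrt (ln (ln (t x))))"
        unfolding lil_norm_def real_sqrt_mult[of 2] by (rule q) simp_all
      thus "(p x / t x) ^ k * sqrt (p x / t x) * sqrt (ln (ln (p x)) / ln (ln (t x))) = lil_norm k (p x) / lil_norm k (t x)"
        by (simp only: real_sqrt_divide power_divide)
    qed
  qed
qed

lemma binomial_sd_lil_norm: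
  fixes N :: "nat \<Rightarrow> nat"
  assumes N: "filterlim N at_top sequentially"
  shows "(\<lambda>j. binomial_sd k (N j) * sqrt (2 * ln (ln (real (N j)))) / lil_norm k (real (N j))) \<longlonglongrightarrow> 1"
proof (rule Lim_transform_eventually)
  let ?c = "1 / (fact k * sqrt (2 * k + 1)) :: real"
  have "(\<lambda>j. binomial_sd k (N j) / (real (N j) ^ k * sqrt (real (N j))) / ?c) \<longlonglongrightarrow> ?c / ?c"
    by (intro tendsto_divide filterlim_compose[OF binomial_sd_asymp N] tendsto_const) simp
  thus "(\<lambda>j. binomial_sd k (N j) / (real (N j) ^ k * sqrt (real (N j))) / ?c) \<longlonglongrightarrow> 1" by simp
  have "eventually (\<lambda>j. 3 \<le> N j) sequentially" using filterlim_at_top[THEN iffD1, OF N] by blast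
  thus "eventually (\<lambda>j. binomial_sd k (N j) / (real (N j) ^ k * sqrt (real (N j))) / ?c =
      binomial_sd k (N j) * sqrt (2 * ln (ln (real (N j)))) / lil_norm k (real (N j))) sequentially"
  proof eventually_elim
    case (elim j)
    have "0 < lil_norm k (real (N j))" using elim by (intro lil_norm_pos) auto
    hence "sqrt (2 * ln (ln (real (N j)))) \<noteq> 0" by (auto simp: lil_norm_def)
    thus ?case by (simp add: lil_norm_def)
  qed
qed

section \<open>Maximal inequality for the plain walk\<close>

context centred_poisson_walk
begin

text \<open>Doob's inequality by induction on \<open>n\<close>: the next factor
  \<open>exp (c * X n)\<close> is independent of the past and has mean at least 1, so a further step
  does not decrease the integral over \<open>E n\<close>; on the newly reached outcomes the last
  value itself is above \<open>x\<close>. The sign of \<open>c\<close> is free, which serves both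
  tails.\<close>

lemma exponential_maximal_inequality:
  "prob {\<omega>\<in>space M. \<exists>m\<le>n. x \<le> c * (\<Sum>i<m. X i \<omega>)} \<le> exp (- x) * expectation (\<lambda>\<omega>. exp (c * (\<Sum>i<n. X i \<omega>)))"
proof -
  define S where "S n \<omega> = (\<Sum>i<n. X i \<omega>)" for n \<omega>
  define E where "E n = {\<omega>\<in>space M. \<exists>m\<le>n. x \<le> c * S m \<omega>}" for n
  have S_meas[measurable]: "S n \<in> borel_measurable M" for n unfolding S_def by measurable
  have E_meas[measurable]: "E n \<in> sets M" for n unfolding E_def by measurable
  have intS: "integrable M (\<lambda>\<omega>. exp (c * S n \<omega>))" for n
    using mgf_weighted_sum[of "{..<n}" c "\<lambda>_. 1"] by (auto simp: S_def has_bochner_integral_iff)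
  have intE: "integrable M (\<lambda>\<omega>. exp (c * S n \<omega>) * indicator (E m) \<omega>)" for m n
    using integrable_mult_indicator[OF E_meas intS, of m n] by (simp add: mult.commute)
  \<comment> \<open>replaces the optional stopping argument at the first passage above \<open>x\<close>\<close>
  have "exp x * prob (E n) \<le> expectation (\<lambda>\<omega>. exp (c * S n \<omega>) * indicator (E n) \<omega>)"
  proof (induction n)
    case 0
    have "exp x * prob (E 0) = expectation (\<lambda>\<omega>. exp x * indicator (E 0) \<omega>)" by simp
    also have "\<dots> \<le> expectation (\<lambda>\<omega>. exp (c * S 0 \<omega>) * indicator (E 0) \<omega>)"
      by (intro integral_mono intE integrable_mult_right integrable_real_indicator)
         (auto simp: E_def emeasure_eq_measure split: split_indicator)
    finally show ?case .
  next
    case (Suc n)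
    \<comment> \<open>The integrand over \<open>E n\<close> as a function of the first
      \<open>n\<close> steps alone, so that its independence of \<open>X n\<close> can be
      stated.\<close>
    define f where "f y = (exp (c * (\<Sum>i<n. y i)) * (if \<exists>m\<le>n. x \<le> c * (\<Sum>i<m. y i) then 1 else 0) :: real)" for y :: "nat \<Rightarrow> real"
    have fm[measurable]: "f \<in> borel_measurable (PiM {..<n} (\<lambda>_. borel))"
    proof -
      have "(\<lambda>y. \<Sum>i<m. y i) \<in> borel_measurable (PiM {..<n} (\<lambda>_. borel :: real measure))" if "m \<le> n" for m
        using that by (intro borel_measurable_sum measurable_component_singleton) auto
      hence [measurable]: "(\<lambda>y. c * (\<Sum>i<m. y i)) \<in> borel_measurable (PiM {..<n} (\<lambda>_. borel :: real measure))" if "m \<in> {..n}" for m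
        using that by (intro borel_measurable_times) auto
      have "Measurable.pred (PiM {..<n} (\<lambda>_. borel :: real measure)) (\<lambda>y. \<exists>m\<in>{..n}. x \<le> c * (\<Sum>i<m. y i))"
        by measurable
      moreover have "(\<lambda>y. c * (\<Sum>i<n. y i)) \<in> borel_measurable (PiM {..<n} (\<lambda>_. borel :: real measure))"
        by measurable
      ultimately show ?thesis unfolding f_def by (auto simp: Bex_def)
    qed
    have f_eq: "f (restrict (\<lambda>i. X i \<omega>) {..<n}) = exp (c * S n \<omega>) * indicator (E n) \<omega>" if "\<omega> \<in> space M" for \<omega>
    proof -
      have "(\<Sum>i<m. restrict (\<lambda>i. X i \<omega>) {..<n} i) = S m \<omega>" if "m \<le> n" for m
        unfolding S_def using that by (intro sum.cong) auto
      moreover from this have "(\<exists>m\<le>n. x \<le> c * (\<Sum>i<m. restrict (\<lambda>i. X i \<omega>) {..<n} i)) \<longleftrightarrow> \<omega> \<in> E n"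
        using that by (auto simp: E_def)
      ultimately show ?thesis by (simp add: f_def)
    qed
    have "indep_var (PiM {..<n} (\<lambda>_. borel)) (\<lambda>\<omega>. restrict (\<lambda>i. X i \<omega>) {..<n}) (PiM {n} (\<lambda>_. borel)) (\<lambda>\<omega>. restrict (\<lambda>i. X i \<omega>) {n})"
      by (rule indep_var_restrict[OF indep_X]) auto
    hence "indep_var borel (f \<circ> (\<lambda>\<omega>. restrict (\<lambda>i. X i \<omega>) {..<n})) borel ((\<lambda>y. exp (c * y n)) \<circ> (\<lambda>\<omega>. restrict (\<lambda>i. X i \<omega>) {n}))"
      by (rule indep_var_compose) measurable
    hence iv: "indep_var borel (\<lambda>\<omega>. f (restrict (\<lambda>i. X i \<omega>) {..<n})) borel (\<lambda>\<omega>. exp (c * X n \<omega>))"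
      by (simp add: o_def)
    have intf: "integrable M (\<lambda>\<omega>. f (restrict (\<lambda>i. X i \<omega>) {..<n}))"
      using intE[of n n] by (simp cong: Bochner_Integration.integrable_cong add: f_eq)
    have intX: "integrable M (\<lambda>\<omega>. exp (c * X n \<omega>))" "expectation (\<lambda>\<omega>. exp (c * X n \<omega>)) = exp (cumulant c)"
      using mgf_X[of c n] by (auto simp: has_bochner_integral_iff)
    have "exp x * prob (E n) \<le> expectation (\<lambda>\<omega>. exp (c * S n \<omega>) * indicator (E n) \<omega>)" by (rule Suc)
    also have "\<dots> = expectation (\<lambda>\<omega>. f (restrict (\<lambda>i. X i \<omega>) {..<n}))"
      by (intro Bochner_Integration.integral_cong) (simp_all add: f_eq)
    also have "\<dots> \<le> \<dots> * exp (cumulant c)"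
    proof -
      have "0 \<le> expectation (\<lambda>\<omega>. f (restrict (\<lambda>i. X i \<omega>) {..<n}))"
        by (intro integral_nonneg_AE AE_I2) (simp add: f_def)
      thus ?thesis using cumulant_nonneg[of c] by (simp add: mult_le_cancel_left1)
    qed
    also have "\<dots> = expectation (\<lambda>\<omega>. f (restrict (\<lambda>i. X i \<omega>) {..<n}) * exp (c * X n \<omega>))"
      using indep_var_lebesgue_integral[OF iv intf intX(1)] intX(2) by simp
    also have "\<dots> = expectation (\<lambda>\<omega>. exp (c * S (Suc n) \<omega>) * indicator (E n) \<omega>)"
      by (intro Bochner_Integration.integral_cong) (simp_all add: f_eq S_def distrib_left exp_add)
    finally have 1: "exp x * prob (E n) \<le> expectation (\<lambda>\<omega>. exp (c * S (Suc n) \<omega>) * indicator (E n) \<omega>)" .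
    have sub: "E n \<subseteq> E (Suc n)" unfolding E_def using le_SucI by blast
    have "exp x * prob (E (Suc n) - E n) = expectation (\<lambda>\<omega>. exp x * indicator (E (Suc n) - E n) \<omega>)" by simp
    also have "\<dots> \<le> expectation (\<lambda>\<omega>. exp (c * S (Suc n) \<omega>) * indicator (E (Suc n) - E n) \<omega>)"
    proof (intro integral_mono)
      show "integrable M (\<lambda>\<omega>. exp (c * S (Suc n) \<omega>) * indicator (E (Suc n) - E n) \<omega>)"
        using integrable_mult_indicator[OF _ intS, of "E (Suc n) - E n" "Suc n"] by (simp add: mult.commute)
      show "integrable M (\<lambda>\<omega>. exp x * indicator (E (Suc n) - E n) \<omega>)"
        by (intro integrable_mult_right integrable_real_indicator) (auto simp: emeasure_eq_measure)
      show "exp x * indicator (E (Suc n) - E n) \<omega> \<le> exp (c * S (Suc n) \<omega>) * indicator (E (Suc n) - E n) \<omega>" for \<omega>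
      proof (cases "\<omega> \<in> E (Suc n) - E n")
        case True
        hence "x \<le> c * S (Suc n) \<omega>" unfolding E_def using le_Suc_eq by auto
        thus ?thesis by (simp add: indicator_def)
      qed simp
    qed
    also have "\<dots> = expectation (\<lambda>\<omega>. exp (c * S (Suc n) \<omega>) * indicator (E (Suc n)) \<omega> - exp (c * S (Suc n) \<omega>) * indicator (E n) \<omega>)"
      using sub by (intro Bochner_Integration.integral_cong) (auto simp: indicator_def)
    also have "\<dots> = expectation (\<lambda>\<omega>. exp (c * S (Suc n) \<omega>) * indicator (E (Suc n)) \<omega>) - expectation (\<lambda>\<omega>. exp (c * S (Suc n) \<omega>) * indicator (E n) \<omega>)"
      by (intro Bochner_Integration.integral_diff intE)
    finally have "exp x * (prob (E (Suc n)) - prob (E n)) \<le> expectation (\<lambda>\<omega>. exp (c * S (Suc n) \<omega>) * indicator (E (Suc n)) \<omega>) - expectation (\<lambda>\<omega>. exp (c * S (Suc n) \<omega>) * indicator (E n) \<omega>)"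
      by (simp only: finite_measure_Diff[OF E_meas E_meas sub])
    with 1 show ?case by (simp add: algebra_simps)
  qed
  also have "\<dots> \<le> expectation (\<lambda>\<omega>. exp (c * S n \<omega>))"
    by (intro integral_mono intE intS) (simp add: indicator_def)
  finally show ?thesis
    by (simp add: E_def S_def exp_minus field_simps)
qed

end

lemma ln_ln_stretched_grid:
  assumes "0 < b" "1 \<le> j"
  shows "b * ln (real j) \<le> ln (ln (real (stretched_grid b j)))"
proof -
  have "exp (real j powr b) \<le> real (stretched_grid b j)"
    unfolding real_stretched_grid by linarith
  hence "ln (exp (real j powr b)) \<le> ln (real (stretched_grid b j))"
    using less_le_trans[OF exp_gt_zero \<open>exp (real j powr b) \<le> real (stretched_grid b j)\<close>]
    by (subst ln_le_cancel_iff) auto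
  hence *: "real j powr b \<le> ln (real (stretched_grid b j))" by simp
  moreover have "0 < real j powr b" using assms by simp
  ultimately have "ln (real j powr b) \<le> ln (ln (real (stretched_grid b j)))"
    by (subst ln_le_cancel_iff) linarith+
  thus ?thesis using assms by (simp add: ln_powr)
qed

lemma lil_norm_Suc:
  "t * lil_norm k t = (fact (Suc k) * sqrt (2 * Suc k + 1) / (fact k * sqrt (2 * k + 1))) * lil_norm (Suc k) t"
  by (simp add: lil_norm_def mult_ac)

section \<open>Upper half of the law of the iterated logarithm\<close>

context centred_poisson_walk
begin

definition walk_sum :: "nat \<Rightarrow> nat \<Rightarrow> 'a \<Rightarrow> real" where
  "walk_sum k n \<omega> = iterated_sum (\<lambda>i. X i \<omega>) k n"

lemma walk_sum_eq: "c * walk_sum k n \<omega> = (\<Sum>i<n. c * real ((n - 1 - i) choose k) * X i \<omega>)"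
  by (simp add: walk_sum_def iterated_sum_eq sum_distrib_left mult.assoc)

lemma weighted_sum_AE_upper:
  assumes mw: "moderate_weights I w L" and x: "0 < x" "y < x\<^sup>2" and "1 < p"
    and L: "eventually (\<lambda>j. p * ln (real j) \<le> y * L j) sequentially"
  shows "AE \<omega> in M. eventually (\<lambda>n. (\<Sum>i\<in>I n. w n i * X i \<omega>) < x * L2_set (w n) (I n) * sqrt (2 * L n)) sequentially"
proof -
  let ?E = "\<lambda>n. {\<omega>\<in>space M. x * L2_set (w n) (I n) * sqrt (2 * L n) \<le> (\<Sum>i\<in>I n. w n i * X i \<omega>)}"
  have "AE \<omega> in M. eventually (\<lambda>n. \<omega> \<notin> ?E n) sequentially"
  proof (rule borel_cantelli_powr[OF _ \<open>1 < p\<close>])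
    show "?E n \<in> sets M" for n by measurable
    from weighted_sum_upper_tail(2)[OF mw x] L eventually_gt_at_top[of 0]
    show "eventually (\<lambda>n. prob (?E n) \<le> 1 * real n powr (- p)) sequentially"
    proof eventually_elim
      case (elim n)
      have "exp (- y * L n) \<le> exp (- p * ln (real n))" using elim by simp
      also have "\<dots> = real n powr (- p)" using elim by (simp add: powr_def)
      finally show ?case using elim by simp
    qed
  qed
  thus ?thesis
    using AE_space by eventually_elim (auto elim!: eventually_mono simp: not_le)
qed

text \<open>With \<open>y = 1 + \<epsilon> / 2\<close> the tail at the j-th grid point is at most
  j^(-b y), and the choice of \<open>b\<close> keeps \<open>b * y > 1\<close>. For the plain walk
  the maximal inequality controls all \<open>m\<close> up to the grid point at the same
  price.\<close>

lemma walk_sum_grid_upper: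
  fixes k :: nat and \<epsilon> :: real
  assumes e: "0 < \<epsilon>" "b = 1 / (1 + \<epsilon> / 4)"
  shows "AE \<omega> in M. eventually (\<lambda>j. \<bar>walk_sum k (stretched_grid b j) \<omega>\<bar> \<le>
    (1 + \<epsilon> / 2) * (binomial_sd k (stretched_grid b j) * sqrt (2 * ln (ln (real (stretched_grid b j)))))) sequentially"
    "AE \<omega> in M. eventually (\<lambda>j. \<forall>m\<le>stretched_grid b j. \<bar>walk_sum 0 m \<omega>\<bar> \<le>
    (1 + \<epsilon> / 2) * (binomial_sd 0 (stretched_grid b j) * sqrt (2 * ln (ln (real (stretched_grid b j)))))) sequentially"
proof -
  have b: "0 < b" "b < 1" using e by (simp_all add: e(2) field_simps)
  define N where "N = stretched_grid b"
  define L where "L j = ln (ln (real (N j)))" for j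
  have N: "filterlim N at_top sequentially" unfolding N_def by (rule stretched_grid_at_top[OF b(1)])
  have ones: "\<bar>1 :: real\<bar> = 1" "\<bar>- 1 :: real\<bar> = 1" by simp_all
  \<comment> \<open>\<open>y\<close> has two roles, as multiple of the standard deviation and as
    exponent of the tail; the second is allowed because \<open>y < y\<^sup>2\<close>.\<close>
  define y where "y = 1 + \<epsilon> / 2"
  define p where "p = b * y"
  have p: "1 < p" unfolding p_def y_def e(2) using e(1) by (simp add: pos_less_divide_eq)
  have y: "0 < y" "y < y\<^sup>2" using e(1) by (auto simp: y_def power2_eq_square algebra_simps add_pos_pos)
  have pL: "eventually (\<lambda>j. p * ln (real j) \<le> y * L j) sequentially"
    using eventually_ge_at_top[of 1]
  proof eventually_elim
    case (elim j)
    have "y * (b * ln (real j)) \<le> y * L j" unfolding L_def N_def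
      using y by (intro mult_left_mono ln_ln_stretched_grid[OF b(1) elim]) auto
    thus ?case by (simp add: p_def mult_ac)
  qed
  have mw: "moderate_weights (\<lambda>j. {..<N j}) (\<lambda>j i. c * real ((N j - 1 - i) choose k)) L"
    if c: "\<bar>c\<bar> = 1" for c k unfolding L_def
  proof (rule moderate_weights_binomial[OF N, of "\<lambda>_. 0"])
    let ?r = "1 / (fact k * sqrt (2 * k + 1)) / 2 :: real"
    show "0 < ?r" by simp
    have "eventually (\<lambda>n. ?r < binomial_sd k n / (real n ^ k * sqrt (real n))) sequentially"
    proof (rule order_tendstoD(1)[OF binomial_sd_asymp])
      have half: "x / 2 < x" if "0 < x" for x :: real using that by simp
      show "?r < 1 / (fact k * sqrt (2 * k + 1))" by (rule half) simp
    qed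
    hence "eventually (\<lambda>n. ?r < binomial_sd k n / (real n ^ k * sqrt (real n)) \<and> 0 < n) sequentially"
      by (intro eventually_conj eventually_gt_at_top)
    hence "eventually (\<lambda>n. ?r * (real n ^ k * sqrt (real n)) \<le> binomial_sd k n) sequentially"
    proof eventually_elim
      case (elim n)
      hence "0 < real n ^ k * sqrt (real n)" by simp
      with elim show ?case by (simp only: pos_less_divide_eq less_imp_le)
    qed
    from eventually_compose_filterlim[OF this N]
    show "eventually (\<lambda>j. ?r * (real (N j) ^ k * sqrt (real (N j))) \<le> L2_set (\<lambda>i. c * real ((N j - 1 - i) choose k)) {..<N j}) sequentially"
      using L2_set_binomial[of 0 _ c k] c by (simp add: atLeast0LessThan)
  qed (use c in auto)
  have L2: "L2_set (\<lambda>i. c * real ((n - 1 - i) choose k)) {..<n} = binomial_sd k n" if "\<bar>c\<bar> = 1" for c k n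
    using L2_set_binomial[of 0 n c k] that by (simp add: atLeast0LessThan)
  have one: "AE \<omega> in M. eventually (\<lambda>j. c * walk_sum k (N j) \<omega> < y * binomial_sd k (N j) * sqrt (2 * L j)) sequentially"
    if c: "\<bar>c\<bar> = 1" for c
    using weighted_sum_AE_upper[OF mw[OF c] y p pL, of k] unfolding walk_sum_eq L2[OF c] .
  show "AE \<omega> in M. eventually (\<lambda>j. \<bar>walk_sum k (stretched_grid b j) \<omega>\<bar> \<le>
    (1 + \<epsilon> / 2) * (binomial_sd k (stretched_grid b j) * sqrt (2 * ln (ln (real (stretched_grid b j)))))) sequentially"
    using one[OF ones(1)] one[OF ones(2)] unfolding N_def[symmetric] L_def[symmetric] y_def[symmetric]
  proof eventually_elim
    case (elim \<omega>)
    thus ?case by eventually_elim (simp add: abs_le_iff mult.assoc)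
  qed
  have two: "AE \<omega> in M. eventually (\<lambda>j. \<forall>m\<le>N j. c * walk_sum 0 m \<omega> \<le> y * (binomial_sd 0 (N j) * sqrt (2 * L j))) sequentially"
    if c: "\<bar>c\<bar> = 1" for c
  proof -
    \<comment> \<open>The optimal tilt for the level \<open>a j\<close>; multiplying the event by it
      produces the form required by the maximal inequality.\<close>
    define h where "h j = y * sqrt (2 * L j) / binomial_sd 0 (N j)" for j
    define a where "a j = y * binomial_sd 0 (N j) * sqrt (2 * L j)" for j
    define E where "E j = {\<omega>\<in>space M. \<exists>m\<le>N j. h j * a j \<le> h j * c * (\<Sum>i<m. X i \<omega>)}" for j
    have evE: "AE \<omega> in M. eventually (\<lambda>n. \<omega> \<notin> E n) sequentially"
    proof (rule borel_cantelli_powr[OF _ p])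
      show "E n \<in> sets M" for n unfolding E_def by measurable
      from weighted_sum_upper_tail(1)[OF mw[OF c, of 0] y] pL eventually_gt_at_top[of 0]
      show "eventually (\<lambda>n. prob (E n) \<le> 1 * real n powr (- p)) sequentially"
      proof eventually_elim
        case (elim n)
        have "prob (E n) \<le> exp (- (h n * a n)) * expectation (\<lambda>\<omega>. exp (h n * c * (\<Sum>i<N n. X i \<omega>)))"
          unfolding E_def by (rule exponential_maximal_inequality)
        also have "\<dots> \<le> exp (- y * L n)"
          using elim(1) unfolding L2[OF c] h_def a_def by (simp add: sum_distrib_left mult.assoc)
        also have "\<dots> \<le> exp (- p * ln (real n))" using elim by simp
        also have "\<dots> = real n powr (- p)" using elim by (simp add: powr_def)
        finally show ?case by simp
      qed
    qed
    have evh: "eventually (\<lambda>j. 0 < h j) sequentially"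
    proof -
      have "eventually (\<lambda>j. 0 < L j) sequentially"
        using mw[of 1 0] filterlim_at_top_dense[of L sequentially] by (auto simp: moderate_weights_def)
      moreover have "eventually (\<lambda>j. 0 < binomial_sd 0 (N j)) sequentially"
        using mw[OF ones(1), of 0] unfolding moderate_weights_def L2[OF ones(1)] by blast
      ultimately show ?thesis by eventually_elim (use y in \<open>simp add: h_def\<close>)
    qed
    show ?thesis using evE AE_space
    proof eventually_elim
      case (elim \<omega>)
      from elim(1) evh show ?case
      proof eventually_elim
        case (elim j)
        show ?case
        proof (intro allI impI, rule ccontr)
          fix m assume "m \<le> N j" and n: "\<not> c * walk_sum 0 m \<omega> \<le> y * (binomial_sd 0 (N j) * sqrt (2 * L j))"
          have "h j * a j \<le> h j * (c * walk_sum 0 m \<omega>)"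
            using n elim(2) by (intro mult_left_mono) (auto simp: a_def mult.assoc)
          hence "\<omega> \<in> E j" using \<open>m \<le> N j\<close> \<open>\<omega> \<in> space M\<close> by (auto simp: E_def walk_sum_def mult.assoc)
          thus False using elim by simp
        qed
      qed
    qed
  qed
  show "AE \<omega> in M. eventually (\<lambda>j. \<forall>m\<le>stretched_grid b j. \<bar>walk_sum 0 m \<omega>\<bar> \<le>
    (1 + \<epsilon> / 2) * (binomial_sd 0 (stretched_grid b j) * sqrt (2 * ln (ln (real (stretched_grid b j)))))) sequentially"
    using two[OF ones(1)] two[OF ones(2)] unfolding N_def[symmetric] L_def[symmetric] y_def[symmetric]
  proof eventually_elim
    case (elim \<omega>)
    thus ?case by eventually_elim (simp add: abs_le_iff)
  qed
qed

lemma AE_all_pos_eps: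
  assumes "\<And>\<epsilon>::real. 0 < \<epsilon> \<Longrightarrow> AE \<omega> in M. P \<epsilon> \<omega>" and mono: "\<And>\<epsilon> \<delta> \<omega>. 0 < \<epsilon> \<Longrightarrow> \<epsilon> \<le> \<delta> \<Longrightarrow> P \<epsilon> \<omega> \<Longrightarrow> P \<delta> \<omega>"
  shows "AE \<omega> in M. \<forall>\<epsilon>>0. P \<epsilon> \<omega>"
proof -
  have "AE \<omega> in M. \<forall>m::nat. P (1 / real (Suc m)) \<omega>"
    using assms(1) by (simp add: AE_all_countable)
  thus ?thesis
  proof eventually_elim
    case (elim \<omega>)
    show ?case
    proof (intro allI impI)
      fix \<epsilon> :: real assume "0 < \<epsilon>"
      then obtain m where "1 / real (Suc m) < \<epsilon>"
        using reals_Archimedean[of \<epsilon>] by (auto simp: inverse_eq_divide)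
      thus "P \<epsilon> \<omega>" using elim mono[of "1 / real (Suc m)" \<epsilon> \<omega>] by simp
    qed
  qed
qed

lemma eventually_le_lil_norm_mono:
  assumes "\<epsilon> \<le> \<delta>" and "eventually (\<lambda>n. \<bar>x n\<bar> \<le> (1 + \<epsilon>) * lil_norm k (real n)) sequentially"
  shows "eventually (\<lambda>n. \<bar>x n\<bar> \<le> (1 + \<delta>) * lil_norm k (real n)) sequentially"
  using assms(2) eventually_ge_at_top[of 3]
proof eventually_elim
  case (elim n)
  have "(1 + \<epsilon>) * lil_norm k (real n) \<le> (1 + \<delta>) * lil_norm k (real n)"
    using assms(1) elim lil_norm_pos[of "real n" k] by (intro mult_right_mono) auto
  thus ?case using elim by linarith
qed

text \<open>Only the plain walk needs a maximal inequality to fill the gaps of the grid. For higher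
  \<open>k\<close> the change within a gap is at most the length of the gap times the bound of the
  induction hypothesis; since the ratio of neighbouring grid points tends to 1, this is of smaller
  order than \<open>lil_norm (Suc k)\<close>.\<close>

theorem lil_upper:
  "AE \<omega> in M. \<forall>\<epsilon>>0. eventually (\<lambda>n. \<bar>walk_sum k n \<omega>\<bar> \<le> (1 + \<epsilon>) * lil_norm k (real n)) sequentially"
proof (induction k)
  case 0
  show ?case
  proof (rule AE_all_pos_eps)
    fix \<epsilon> :: real assume e: "0 < \<epsilon>"
    define b where "b = 1 / (1 + \<epsilon> / 4)"
    have b: "0 < b" "b < 1" using e by (auto simp: b_def divide_simps)
    define N where "N = stretched_grid b"
    have N: "filterlim N at_top sequentially" unfolding N_def by (rule stretched_grid_at_top[OF b(1)])
    have Nr: "(\<lambda>j. real (N (Suc j)) / real (N j)) \<longlonglongrightarrow> 1" unfolding N_def by (rule stretched_grid_ratio[OF b])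
    have Nt: "filterlim (\<lambda>j. real (N j)) at_top sequentially"
      by (rule filterlim_compose[OF filterlim_real_sequentially N])
    define g where "g j = (1 + \<epsilon> / 2) * (binomial_sd 0 (N j) * sqrt (2 * ln (ln (real (N j)))))" for j
    have ev3: "eventually (\<lambda>j. 3 \<le> N j) sequentially" using filterlim_at_top[THEN iffD1, OF N] by blast
    have "(\<lambda>j. (1 + \<epsilon> / 2) * (binomial_sd 0 (N (Suc j)) * sqrt (2 * ln (ln (real (N (Suc j))))) / lil_norm 0 (real (N (Suc j))))
       * (lil_norm 0 (real (N (Suc j))) / lil_norm 0 (real (N j)))) \<longlonglongrightarrow> (1 + \<epsilon> / 2) * 1 * 1"
      by (intro tendsto_mult tendsto_const lil_norm_ratio[OF Nt Nr] LIMSEQ_Suc[OF binomial_sd_lil_norm[OF N]])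
    hence "eventually (\<lambda>j. (1 + \<epsilon> / 2) * (binomial_sd 0 (N (Suc j)) * sqrt (2 * ln (ln (real (N (Suc j))))) / lil_norm 0 (real (N (Suc j))))
       * (lil_norm 0 (real (N (Suc j))) / lil_norm 0 (real (N j))) < 1 + \<epsilon>) sequentially"
      by (rule order_tendstoD) (use e in auto)
    moreover have "eventually (\<lambda>j. 3 \<le> N (Suc j)) sequentially"
      using ev3 eventually_sequentially_Suc[of "\<lambda>j. 3 \<le> N j"] by simp
    ultimately have evg: "eventually (\<lambda>j. g (Suc j) \<le> (1 + \<epsilon>) * lil_norm 0 (real (N j))) sequentially"
      using ev3
    proof eventually_elim
      case (elim j)
      have "0 < lil_norm 0 (real (N j))" "0 < lil_norm 0 (real (N (Suc j)))"
        using elim by (auto intro!: lil_norm_pos)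
      thus ?case using elim(1) by (simp add: g_def pos_divide_less_eq)
    qed
    show "AE \<omega> in M. eventually (\<lambda>n. \<bar>walk_sum 0 n \<omega>\<bar> \<le> (1 + \<epsilon>) * lil_norm 0 (real n)) sequentially"
      using walk_sum_grid_upper(2)[OF e b_def] unfolding N_def[symmetric] g_def[symmetric]
    proof eventually_elim
      case (elim \<omega>)
      have "eventually (\<lambda>j. (\<forall>m\<le>N (Suc j). \<bar>walk_sum 0 m \<omega>\<bar> \<le> g (Suc j)) \<and> g (Suc j) \<le> (1 + \<epsilon>) * lil_norm 0 (real (N j)) \<and> 3 \<le> N j) sequentially"
        using elim eventually_sequentially_Suc[of "\<lambda>j. \<forall>m\<le>N j. \<bar>walk_sum 0 m \<omega>\<bar> \<le> g j"] evg ev3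
        by (intro eventually_conj) auto
      then obtain j0 where j0: "\<And>j. j \<ge> j0 \<Longrightarrow> (\<forall>m\<le>N (Suc j). \<bar>walk_sum 0 m \<omega>\<bar> \<le> g (Suc j)) \<and> g (Suc j) \<le> (1 + \<epsilon>) * lil_norm 0 (real (N j)) \<and> 3 \<le> N j"
        by (auto simp: eventually_sequentially)
      show ?case unfolding eventually_sequentially
      proof (intro exI allI impI)
        fix n assume "n \<ge> N j0"
        then obtain j where j: "j \<ge> j0" "N j \<le> n" "n < N (Suc j)"
          using exists_grid_interval[OF N] by blast
        have "\<bar>walk_sum 0 n \<omega>\<bar> \<le> (1 + \<epsilon>) * lil_norm 0 (real (N j))"
          using j0[OF j(1)] j(3) by (meson less_imp_le order_trans)
        also have "\<dots> \<le> (1 + \<epsilon>) * lil_norm 0 (real n)"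
          using j j0[OF j(1)] e by (intro mult_left_mono lil_norm_mono) auto
        finally show "\<bar>walk_sum 0 n \<omega>\<bar> \<le> (1 + \<epsilon>) * lil_norm 0 (real n)" .
      qed
    qed
  qed (rule eventually_le_lil_norm_mono)
next
  case (Suc k)
  show ?case
  proof (rule AE_all_pos_eps)
    fix \<epsilon> :: real assume e: "0 < \<epsilon>"
    define b where "b = 1 / (1 + \<epsilon> / 4)"
    have b: "0 < b" "b < 1" using e by (auto simp: b_def divide_simps)
    define N where "N = stretched_grid b"
    have N: "filterlim N at_top sequentially" unfolding N_def by (rule stretched_grid_at_top[OF b(1)])
    have Nr: "(\<lambda>j. real (N (Suc j)) / real (N j)) \<longlonglongrightarrow> 1" unfolding N_def by (rule stretched_grid_ratio[OF b])
    have Nt: "filterlim (\<lambda>j. real (N j)) at_top sequentially"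
      by (rule filterlim_compose[OF filterlim_real_sequentially N])
    define C where "C = (fact (Suc k) * sqrt (2 * Suc k + 1) / (fact k * sqrt (2 * k + 1)) :: real)"
    define g where "g j = (1 + \<epsilon> / 2) * (binomial_sd (Suc k) (N j) * sqrt (2 * ln (ln (real (N j)))))" for j
    \<comment> \<open>Bound for the change of \<open>walk_sum (Suc k)\<close> within one gap; the
      factor 2 is the induction hypothesis with error 1.\<close>
    define f where "f j = (real (N (Suc j)) - real (N j)) * (2 * lil_norm k (real (N (Suc j))))" for j
    have ev3: "eventually (\<lambda>j. 3 \<le> N j) sequentially" using filterlim_at_top[THEN iffD1, OF N] by blast
    hence ev3': "eventually (\<lambda>j. 3 \<le> N (Suc j)) sequentially"
      using eventually_sequentially_Suc[of "\<lambda>j. 3 \<le> N j"] by simp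
    \<comment> \<open>The second summand is \<open>f j\<close> relative to the norm, and vanishes in
      the limit through \<open>1 - inverse 1\<close>.\<close>
    have "(\<lambda>j. (1 + \<epsilon> / 2) * (binomial_sd (Suc k) (N j) * sqrt (2 * ln (ln (real (N j)))) / lil_norm (Suc k) (real (N j)))
       + (1 - inverse (real (N (Suc j)) / real (N j))) * 2 * C * (lil_norm (Suc k) (real (N (Suc j))) / lil_norm (Suc k) (real (N j))))
       \<longlonglongrightarrow> (1 + \<epsilon> / 2) * 1 + (1 - inverse 1) * 2 * C * 1"
      by (intro tendsto_mult tendsto_add tendsto_diff tendsto_inverse tendsto_const lil_norm_ratio[OF Nt Nr] binomial_sd_lil_norm[OF N] Nr) simp
    hence "eventually (\<lambda>j. (1 + \<epsilon> / 2) * (binomial_sd (Suc k) (N j) * sqrt (2 * ln (ln (real (N j)))) / lil_norm (Suc k) (real (N j)))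
       + (1 - inverse (real (N (Suc j)) / real (N j))) * 2 * C * (lil_norm (Suc k) (real (N (Suc j))) / lil_norm (Suc k) (real (N j))) < 1 + \<epsilon>) sequentially"
      by (rule order_tendstoD) (use e in auto)
    hence evg: "eventually (\<lambda>j. g j + f j \<le> (1 + \<epsilon>) * lil_norm (Suc k) (real (N j))) sequentially"
      using ev3 ev3'
    proof eventually_elim
      case (elim j)
      have p: "0 < lil_norm (Suc k) (real (N j))" "0 < real (N j)" "0 < real (N (Suc j))"
        using elim by (auto intro!: lil_norm_pos)
      have "lil_norm k (real (N (Suc j))) = C * lil_norm (Suc k) (real (N (Suc j))) / real (N (Suc j))"
        using lil_norm_Suc[of "real (N (Suc j))" k] p unfolding C_def by (simp only: eq_divide_eq mult.commute) simp
      hence fj: "f j = (1 - inverse (real (N (Suc j)) / real (N j))) * 2 * C * lil_norm (Suc k) (real (N (Suc j)))"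
        using p by (simp add: f_def field_simps)
      hence "g j + f j = ((1 + \<epsilon> / 2) * (binomial_sd (Suc k) (N j) * sqrt (2 * ln (ln (real (N j)))) / lil_norm (Suc k) (real (N j)))
       + (1 - inverse (real (N (Suc j)) / real (N j))) * 2 * C * (lil_norm (Suc k) (real (N (Suc j))) / lil_norm (Suc k) (real (N j)))) * lil_norm (Suc k) (real (N j))"
      proof -
        have "x * y + z * u = (x * (y / w) + z * (u / w)) * w" if "w \<noteq> 0" for x y z u w :: real
          using that by (simp add: distrib_right)
        thus ?thesis using p(1) fj unfolding g_def by (metis less_irrefl)
      qed
      also have "\<dots> \<le> (1 + \<epsilon>) * lil_norm (Suc k) (real (N j))"
        using elim(1) p(1) by (intro mult_right_mono) auto
      finally show ?case .
    qed
    show "AE \<omega> in M. eventually (\<lambda>n. \<bar>walk_sum (Suc k) n \<omega>\<bar> \<le> (1 + \<epsilon>) * lil_norm (Suc k) (real n)) sequentially"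
      using walk_sum_grid_upper(1)[OF e b_def, of "Suc k"] Suc.IH unfolding N_def[symmetric] g_def[symmetric]
    proof eventually_elim
      case (elim \<omega>)
      from elim(2)[rule_format, of 1] obtain m0 where m0: "\<And>m. m \<ge> m0 \<Longrightarrow> \<bar>walk_sum k m \<omega>\<bar> \<le> 2 * lil_norm k (real m)"
        by (auto simp: eventually_sequentially)
      have "eventually (\<lambda>j. \<bar>walk_sum (Suc k) (N j) \<omega>\<bar> \<le> g j \<and> g j + f j \<le> (1 + \<epsilon>) * lil_norm (Suc k) (real (N j)) \<and> 3 \<le> N j \<and> m0 \<le> N j) sequentially"
        using elim(1) evg ev3 filterlim_at_top[THEN iffD1, OF N, rule_format, of m0] by (intro eventually_conj) auto
      then obtain j0 where j0: "\<And>j. j \<ge> j0 \<Longrightarrow> \<bar>walk_sum (Suc k) (N j) \<omega>\<bar> \<le> g j \<and> g j + f j \<le> (1 + \<epsilon>) * lil_norm (Suc k) (real (N j)) \<and> 3 \<le> N j \<and> m0 \<le> N j"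
        by (auto simp: eventually_sequentially)
      show ?case unfolding eventually_sequentially
      proof (intro exI allI impI)
        fix n assume "n \<ge> N j0"
        then obtain j where j: "j \<ge> j0" "N j \<le> n" "n < N (Suc j)"
          using exists_grid_interval[OF N] by blast
        have "walk_sum (Suc k) n \<omega> = walk_sum (Suc k) (N j) \<omega> + (\<Sum>m=N j..<n. walk_sum k m \<omega>)"
          using sum.atLeastLessThan_concat[of 0 "N j" n "\<lambda>m. walk_sum k m \<omega>"] j(2)
          by (simp add: walk_sum_def atLeast0LessThan)
        hence "\<bar>walk_sum (Suc k) n \<omega>\<bar> \<le> \<bar>walk_sum (Suc k) (N j) \<omega>\<bar> + (\<Sum>m=N j..<n. \<bar>walk_sum k m \<omega>\<bar>)"
          using sum_abs[of "\<lambda>m. walk_sum k m \<omega>" "{N j..<n}"] by linarith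
        also have "(\<Sum>m=N j..<n. \<bar>walk_sum k m \<omega>\<bar>) \<le> (\<Sum>m=N j..<n. 2 * lil_norm k (real (N (Suc j))))"
        proof (rule sum_mono)
          fix m assume m: "m \<in> {N j..<n}"
          have "\<bar>walk_sum k m \<omega>\<bar> \<le> 2 * lil_norm k (real m)" using m j0[OF j(1)] by (intro m0) auto
          also have "\<dots> \<le> 2 * lil_norm k (real (N (Suc j)))"
            using m j j0[OF j(1)] by (intro mult_left_mono lil_norm_mono) auto
          finally show "\<bar>walk_sum k m \<omega>\<bar> \<le> 2 * lil_norm k (real (N (Suc j)))" .
        qed
        also have "\<dots> = (real n - real (N j)) * (2 * lil_norm k (real (N (Suc j))))"
          using j(2) by (simp add: of_nat_diff)
        also have "\<dots> \<le> f j" unfolding f_def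
          using j j0[OF j(1)] lil_norm_pos[of "real (N (Suc j))" k] by (intro mult_right_mono) auto
        finally have "\<bar>walk_sum (Suc k) n \<omega>\<bar> \<le> \<bar>walk_sum (Suc k) (N j) \<omega>\<bar> + f j" by simp
        also have "\<dots> \<le> (1 + \<epsilon>) * lil_norm (Suc k) (real (N j))" using j0[OF j(1)] by linarith
        also have "\<dots> \<le> (1 + \<epsilon>) * lil_norm (Suc k) (real n)"
          using j j0[OF j(1)] e by (intro mult_left_mono lil_norm_mono) auto
        finally show "\<bar>walk_sum (Suc k) n \<omega>\<bar> \<le> (1 + \<epsilon>) * lil_norm (Suc k) (real n)" .
      qed
    qed
  qed (rule eventually_le_lil_norm_mono)
qed

section \<open>Lower half of the law of the iterated logarithm\<close>

lemma not_summable_exp_ln_ln: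
  assumes "0 < y" "y < 1" "3 \<le> Q" and le: "eventually (\<lambda>j. exp (- y * ln (ln (real (Q ^ Suc j)))) \<le> f j) sequentially"
  shows "\<not> summable f"
proof
  assume sf: "summable f"
  have lnQ: "0 < ln (real Q)" using assms by simp
  have eq: "exp (- y * ln (ln (real (Q ^ Suc j)))) = ln (real Q) powr (- y) * real (Suc j) powr (- y)" for j
  proof -
    have "ln (real (Q ^ Suc j)) = real (Suc j) * ln (real Q)"
      using assms by (simp add: ln_realpow ln_mult algebra_simps)
    hence "ln (ln (real (Q ^ Suc j))) = ln (real (Suc j)) + ln (ln (real Q))"
      using lnQ by (simp add: ln_mult)
    thus ?thesis using lnQ by (simp add: powr_def exp_add[symmetric] algebra_simps)
  qed
  have "summable (\<lambda>j. ln (real Q) powr (- y) * real (Suc j) powr (- y))"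
    by (rule summable_comparison_test_ev[OF _ sf]) (use le in \<open>simp only: eq, simp\<close>)
  hence "summable (\<lambda>j. real (Suc j) powr (- y))"
    using lnQ by (simp add: summable_cmult_iff)
  hence "summable (\<lambda>j. real j powr (- y))" using summable_Suc_iff by blast
  thus False using assms by (simp add: summable_real_powr_iff)
qed

text \<open>The block from Q^j to Q^(j+1) takes up the proportion \<open>q\<close> of the range and
  hence asymptotically the fraction q^(2k+1) of the variance; the terms before it carry the
  rest.\<close>

lemma binomial_sd_blocks:
  assumes Q: "2 \<le> Q"
  defines "q \<equiv> 1 - 1 / real Q"
  shows "(\<lambda>j. binomial_sd k (Q ^ Suc j - Q ^ j) / (real (Q ^ Suc j) ^ k * sqrt (real (Q ^ Suc j))))
      \<longlonglongrightarrow> 1 / (fact k * sqrt (2 * k + 1)) * (q ^ k * sqrt q)"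
    "(\<lambda>j. sqrt ((binomial_sd k (Q ^ Suc j))\<^sup>2 - (binomial_sd k (Q ^ Suc j - Q ^ j))\<^sup>2) / (real (Q ^ Suc j) ^ k * sqrt (real (Q ^ Suc j))))
      \<longlonglongrightarrow> 1 / (fact k * sqrt (2 * k + 1)) * sqrt (1 - q ^ (2 * k + 1))"
proof -
  have q: "0 < q" using Q by (simp add: q_def)
  have Nt: "filterlim (\<lambda>j. Q ^ Suc j) at_top sequentially"
  proof (rule filterlim_at_top_mono[OF filterlim_Suc])
    show "eventually (\<lambda>j. Suc j \<le> Q ^ Suc j) sequentially"
      using Q by (intro always_eventually allI less_imp_le power_gt_expt) auto
  qed
  have Nd: "real (Q ^ Suc j - Q ^ j) = q * real (Q ^ Suc j)" for j
  proof -
    have "Q ^ j \<le> Q ^ Suc j" using Q by (intro power_increasing) auto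
    thus ?thesis using Q by (simp add: of_nat_diff q_def algebra_simps)
  qed
  have Dt: "filterlim (\<lambda>j. Q ^ Suc j - Q ^ j) at_top sequentially"
  proof (rule filterlim_at_top_mono[OF filterlim_ident])
    show "eventually (\<lambda>j. j \<le> Q ^ Suc j - Q ^ j) sequentially"
    proof (intro always_eventually allI)
      fix j
      have "j \<le> Q ^ j" using Q by (intro less_imp_le power_gt_expt) auto
      also have "Q ^ j = 2 * Q ^ j - Q ^ j" by simp
      also have "\<dots> \<le> Q ^ Suc j - Q ^ j" using Q by (intro diff_le_mono) simp
      finally show "j \<le> Q ^ Suc j - Q ^ j" .
    qed
  qed
  let ?c = "1 / (fact k * sqrt (2 * k + 1)) :: real"
  have "(\<lambda>j. binomial_sd k (Q ^ Suc j - Q ^ j) / (real (Q ^ Suc j - Q ^ j) ^ k * sqrt (real (Q ^ Suc j - Q ^ j))) * (q ^ k * sqrt q)) \<longlonglongrightarrow> ?c * (q ^ k * sqrt q)"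
    by (intro tendsto_mult tendsto_const filterlim_compose[OF binomial_sd_asymp Dt])
  also have "(\<lambda>j. binomial_sd k (Q ^ Suc j - Q ^ j) / (real (Q ^ Suc j - Q ^ j) ^ k * sqrt (real (Q ^ Suc j - Q ^ j))) * (q ^ k * sqrt q))
     = (\<lambda>j. binomial_sd k (Q ^ Suc j - Q ^ j) / (real (Q ^ Suc j) ^ k * sqrt (real (Q ^ Suc j))))"
    unfolding Nd using q by (simp add: real_sqrt_mult power_mult_distrib fun_eq_iff)
  finally show 1: "(\<lambda>j. binomial_sd k (Q ^ Suc j - Q ^ j) / (real (Q ^ Suc j) ^ k * sqrt (real (Q ^ Suc j))))
      \<longlonglongrightarrow> ?c * (q ^ k * sqrt q)" .
  have "(\<lambda>j. sqrt ((binomial_sd k (Q ^ Suc j) / (real (Q ^ Suc j) ^ k * sqrt (real (Q ^ Suc j))))\<^sup>2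
      - (binomial_sd k (Q ^ Suc j - Q ^ j) / (real (Q ^ Suc j) ^ k * sqrt (real (Q ^ Suc j))))\<^sup>2))
      \<longlonglongrightarrow> sqrt (?c\<^sup>2 - (?c * (q ^ k * sqrt q))\<^sup>2)"
    by (intro tendsto_real_sqrt tendsto_diff tendsto_power 1 filterlim_compose[OF binomial_sd_asymp Nt])
  also have "sqrt (?c\<^sup>2 - (?c * (q ^ k * sqrt q))\<^sup>2) = ?c * sqrt (1 - q ^ (2 * k + 1))"
  proof -
    have "?c\<^sup>2 - (?c * (q ^ k * sqrt q))\<^sup>2 = ?c\<^sup>2 * (1 - (q ^ k * sqrt q)\<^sup>2)"
      by (simp only: power_mult_distrib) (simp only: right_diff_distrib mult_1_right)
    also have "(q ^ k * sqrt q)\<^sup>2 = q ^ (2 * k + 1)"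
      using q by (simp add: power_mult_distrib power_mult[symmetric] mult.commute)
    finally show ?thesis by (simp only: real_sqrt_mult real_sqrt_abs) simp
  qed
  also have "(\<lambda>j. sqrt ((binomial_sd k (Q ^ Suc j) / (real (Q ^ Suc j) ^ k * sqrt (real (Q ^ Suc j))))\<^sup>2
      - (binomial_sd k (Q ^ Suc j - Q ^ j) / (real (Q ^ Suc j) ^ k * sqrt (real (Q ^ Suc j))))\<^sup>2)) =
      (\<lambda>j. sqrt ((binomial_sd k (Q ^ Suc j))\<^sup>2 - (binomial_sd k (Q ^ Suc j - Q ^ j))\<^sup>2) / (real (Q ^ Suc j) ^ k * sqrt (real (Q ^ Suc j))))"
  proof
    fix j
    have "sqrt ((x / z)\<^sup>2 - (y / z)\<^sup>2) = sqrt (x\<^sup>2 - y\<^sup>2) / z" if "0 < z" for x y z :: real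
      using that by (simp add: power_divide diff_divide_distrib[symmetric] real_sqrt_divide)
    moreover have "0 < real (Q ^ Suc j) ^ k * sqrt (real (Q ^ Suc j))" using Q by simp
    ultimately show "sqrt ((binomial_sd k (Q ^ Suc j) / (real (Q ^ Suc j) ^ k * sqrt (real (Q ^ Suc j))))\<^sup>2
      - (binomial_sd k (Q ^ Suc j - Q ^ j) / (real (Q ^ Suc j) ^ k * sqrt (real (Q ^ Suc j))))\<^sup>2) =
      sqrt ((binomial_sd k (Q ^ Suc j))\<^sup>2 - (binomial_sd k (Q ^ Suc j - Q ^ j))\<^sup>2) / (real (Q ^ Suc j) ^ k * sqrt (real (Q ^ Suc j)))"
      by blast
  qed
  finally show "(\<lambda>j. sqrt ((binomial_sd k (Q ^ Suc j))\<^sup>2 - (binomial_sd k (Q ^ Suc j - Q ^ j))\<^sup>2) / (real (Q ^ Suc j) ^ k * sqrt (real (Q ^ Suc j))))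
      \<longlonglongrightarrow> ?c * sqrt (1 - q ^ (2 * k + 1))" .
qed

text \<open>Along N = Q^(j+1) the contributions of the last blocks are independent, and the events
  that they exceed \<open>q\<close> times their own scale have divergent probabilities. The earlier
  terms eventually stay below twice their scale, which is small for large \<open>Q\<close>. The sign
  \<open>c\<close> yields both signs at once.\<close>

theorem lil_lower:
  assumes c: "\<bar>c\<bar> = 1"
  shows "AE \<omega> in M. \<forall>\<epsilon>>0. frequently (\<lambda>n. (1 - \<epsilon>) * lil_norm k (real n) \<le> c * walk_sum k n \<omega>) sequentially"
proof (rule AE_all_pos_eps)
  fix \<epsilon> :: real assume e: "0 < \<epsilon>"
  \<comment> \<open>The limit is 1, so a suitable \<open>Q\<close> exists. The leading factor is the
    level demanded of the block, the next one the block's share of the standard deviation, and the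
    subtracted term twice the share of the earlier terms.\<close>
  have "(\<lambda>Q::nat. (1 - 1 / real Q) * ((1 - 1 / real Q) ^ k * sqrt (1 - 1 / real Q)) - 2 * sqrt (1 - (1 - 1 / real Q) ^ (2 * k + 1)))
     \<longlonglongrightarrow> (1 - 0) * ((1 - 0) ^ k * sqrt (1 - 0)) - 2 * sqrt (1 - (1 - 0) ^ (2 * k + 1))"
    by (intro tendsto_intros lim_1_over_n)
  hence "eventually (\<lambda>Q::nat. 1 - \<epsilon> < (1 - 1 / real Q) * ((1 - 1 / real Q) ^ k * sqrt (1 - 1 / real Q)) - 2 * sqrt (1 - (1 - 1 / real Q) ^ (2 * k + 1))) sequentially"
    by (rule order_tendstoD) (use e in simp)
  from eventually_happens'[OF _ eventually_conj[OF this eventually_ge_at_top[of 3]]]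
  obtain Q :: nat where Q3: "3 \<le> Q"
    and Qe: "1 - \<epsilon> < (1 - 1 / real Q) * ((1 - 1 / real Q) ^ k * sqrt (1 - 1 / real Q)) - 2 * sqrt (1 - (1 - 1 / real Q) ^ (2 * k + 1))"
    by auto
  define q where "q = 1 - 1 / real Q"
  have q: "0 < q" "q < 1" using Q3 by (auto simp: q_def)
  define N where "N j = Q ^ Suc j" for j
  define P where "P j = Q ^ j" for j
  define L where "L j = ln (ln (real (N j)))" for j
  define w where "w j i = c * real ((N j - 1 - i) choose k)" for j i
  have PN: "P j \<le> N j" for j unfolding P_def N_def using Q3 by (intro power_increasing) auto
  have N: "filterlim N at_top sequentially"
  proof (rule filterlim_at_top_mono[OF filterlim_Suc])
    show "eventually (\<lambda>j. Suc j \<le> N j) sequentially" unfolding N_def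
      using Q3 by (intro always_eventually allI less_imp_le power_gt_expt) simp
  qed
  define ck where "ck = (1 / (fact k * sqrt (2 * k + 1)) :: real)"
  have ck: "0 < ck" by (simp add: ck_def)
  define sA where "sA j = binomial_sd k (N j - P j)" for j
  define sR where "sR j = sqrt ((binomial_sd k (N j))\<^sup>2 - (binomial_sd k (N j - P j))\<^sup>2)" for j
  have "2 \<le> Q" using Q3 by simp
  note lims = binomial_sd_blocks[OF this, of k, folded q_def, folded N_def, folded P_def, folded sA_def sR_def ck_def]
  have L2A: "L2_set (w j) {P j..<N j} = sA j" for j
    unfolding w_def sA_def L2_set_binomial[OF PN] c by simp
  have L2R: "L2_set (w j) {..<P j} = sR j" for j
  proof -
    have "(\<Sum>i<N j. (w j i)\<^sup>2) = (\<Sum>i<P j. (w j i)\<^sup>2) + (\<Sum>i\<in>{P j..<N j}. (w j i)\<^sup>2)"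
      using sum.atLeastLessThan_concat[of 0 "P j" "N j" "\<lambda>i. (w j i)\<^sup>2"] PN[of j] by (simp add: atLeast0LessThan)
    moreover have "(\<Sum>i<N j. (w j i)\<^sup>2) = (binomial_sd k (N j))\<^sup>2"
    proof -
      have "L2_set (w j) {..<N j} = binomial_sd k (N j)"
        using L2_set_binomial[of 0 "N j" c k] c unfolding w_def by (simp add: atLeast0LessThan)
      thus ?thesis by (simp add: L2_set_def flip: sum_nonneg) (metis real_sqrt_pow2 sum_nonneg zero_le_power2)
    qed
    moreover have "(\<Sum>i\<in>{P j..<N j}. (w j i)\<^sup>2) = (binomial_sd k (N j - P j))\<^sup>2"
      using L2A[of j] unfolding sA_def L2_set_def by (metis real_sqrt_pow2 sum_nonneg zero_le_power2)
    ultimately have "(\<Sum>i<P j. (w j i)\<^sup>2) = (binomial_sd k (N j))\<^sup>2 - (binomial_sd k (N j - P j))\<^sup>2" by linarith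
    thus ?thesis by (simp add: L2_set_def sR_def)
  qed
  have evl: "eventually (\<lambda>j. r / 2 * (real (N j) ^ k * sqrt (real (N j))) \<le> s j) sequentially"
    if "0 < r" "(\<lambda>j. s j / (real (N j) ^ k * sqrt (real (N j)))) \<longlonglongrightarrow> r" for r and s :: "nat \<Rightarrow> real"
  proof -
    have "eventually (\<lambda>j. r / 2 < s j / (real (N j) ^ k * sqrt (real (N j)))) sequentially"
      by (rule order_tendstoD(1)[OF that(2)]) (use that in simp)
    thus ?thesis
    proof eventually_elim
      case (elim j)
      have "0 < real (N j) ^ k * sqrt (real (N j))" using Q3 by (simp add: N_def)
      with elim show ?case by (simp only: pos_less_divide_eq less_imp_le)
    qed
  qed
  have rA: "0 < ck * (q ^ k * sqrt q)" using ck q by simp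
  have rR: "0 < ck * sqrt (1 - q ^ (2 * k + 1))"
  proof -
    have "q ^ (2 * k + 1) < 1" using q by (intro power_Suc_less_one[of q "2 * k", simplified] | simp)+
    thus ?thesis using ck by simp
  qed
  have mwA: "moderate_weights (\<lambda>j. {P j..<N j}) w L" unfolding L_def w_def
  proof (rule moderate_weights_binomial[OF N PN])
    show "0 < ck * (q ^ k * sqrt q) / 2" using rA by simp
    show "eventually (\<lambda>j. ck * (q ^ k * sqrt q) / 2 * (real (N j) ^ k * sqrt (real (N j)))
        \<le> L2_set (\<lambda>i. c * real ((N j - 1 - i) choose k)) {P j..<N j}) sequentially"
      using evl[OF rA lims(1)] unfolding L2A[unfolded w_def] .
  qed (use c in auto)
  have mwR: "moderate_weights (\<lambda>j. {..<P j}) (\<lambda>j i. - w j i) L"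
  proof (rule moderate_weights_uminus)
    show "moderate_weights (\<lambda>j. {..<P j}) w L" unfolding L_def w_def
    proof (rule moderate_weights_binomial[OF N PN])
      show "0 < ck * sqrt (1 - q ^ (2 * k + 1)) / 2" using rR by simp
      show "eventually (\<lambda>j. ck * sqrt (1 - q ^ (2 * k + 1)) / 2 * (real (N j) ^ k * sqrt (real (N j)))
          \<le> L2_set (\<lambda>i. c * real ((N j - 1 - i) choose k)) {..<P j}) sequentially"
        using evl[OF rR lims(2)] unfolding L2R[unfolded w_def] .
    qed (use c PN in \<open>auto intro: less_le_trans\<close>)
  qed
  \<comment> \<open>A number strictly between \<open>q\<^sup>2\<close> and 1: the lower tail bound
    needs the first inequality, divergence the second.\<close>
  define y where "y = (1 + q\<^sup>2) / 2"
  have y: "0 < y" "y < 1" "q\<^sup>2 < y"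
  proof -
    have "q\<^sup>2 < 1" using q by (simp add: power_less_one_iff)
    thus "0 < y" "y < 1" "q\<^sup>2 < y" by (auto simp: y_def add_pos_nonneg)
  qed
  define VA where "VA j \<omega> = (\<Sum>i\<in>{P j..<N j}. w j i * X i \<omega>)" for j \<omega>
  define E where "E j = {\<omega>\<in>space M. q * sA j * sqrt (2 * L j) \<le> VA j \<omega>}" for j
  have freqA: "AE \<omega> in M. frequently (\<lambda>j. \<omega> \<in> E j) sequentially"
  proof (rule borel_cantelli_indep)
    have "indep_vars (\<lambda>j. PiM {P j..<N j} (\<lambda>_. borel)) (\<lambda>j \<omega>. restrict (\<lambda>i. X i \<omega>) {P j..<N j}) UNIV"
    proof (rule indep_vars_restrict[OF indep_X])
      have "m = n" if "i \<in> {P m..<N m}" "i \<in> {P n..<N n}" for m n i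
      proof (rule ccontr)
        have *: False if "m < n" "i < N m" "P n \<le> i" for m n
        proof -
          have "N m \<le> P n" unfolding N_def P_def using that Q3 by (intro power_increasing) auto
          thus False using that by simp
        qed
        assume "m \<noteq> n"
        thus False using that *[of m n] *[of n m] by (auto simp: neq_iff)
      qed
      thus "disjoint_family_on (\<lambda>j. {P j..<N j}) UNIV" unfolding disjoint_family_on_def by blast
    qed simp
    hence "indep_vars (\<lambda>_. borel) (\<lambda>j. (\<lambda>x. \<Sum>i\<in>{P j..<N j}. w j i * x i) \<circ> (\<lambda>\<omega>. restrict (\<lambda>i. X i \<omega>) {P j..<N j})) UNIV"
      by (rule indep_vars_compose) measurable
    also have "(\<lambda>j. (\<lambda>x. \<Sum>i\<in>{P j..<N j}. w j i * x i) \<circ> (\<lambda>\<omega>. restrict (\<lambda>i. X i \<omega>) {P j..<N j})) = VA"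
      by (auto simp: fun_eq_iff VA_def intro!: sum.cong)
    finally have "indep_vars (\<lambda>_. borel) VA UNIV" .
    hence "indep_events (\<lambda>j. {\<omega>\<in>space M. q * sA j * sqrt (2 * L j) \<le> VA j \<omega>}) UNIV"
      by (rule indep_eventsI_indep_vars) measurable
    thus "indep_events E UNIV" by (simp add: E_def[abs_def])
    have "eventually (\<lambda>n. exp (- y * L n) \<le> prob (E n)) sequentially"
      using weighted_sum_lower_tail[OF mwA q(1) y(3)] unfolding L2A E_def VA_def by simp
    thus "\<not> summable (\<lambda>j. prob (E j))" unfolding L_def N_def
      by (rule not_summable_exp_ln_ln[OF y(1,2) Q3])
  qed
  have evR: "AE \<omega> in M. eventually (\<lambda>j. (\<Sum>i<P j. - w j i * X i \<omega>) < 2 * sR j * sqrt (2 * L j)) sequentially"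
  proof -
    have "eventually (\<lambda>j. 2 * ln (real j) \<le> 3 * L j) sequentially"
      using eventually_ge_at_top[of 1]
    proof eventually_elim
      case (elim j)
      have "exp 1 < (3::real)" by (rule e_less_272[THEN less_trans]) simp
      hence lnQ: "1 \<le> ln (real Q)" using Q3 by (subst ln_ge_iff) auto
      have "ln (real (N j)) = real (Suc j) * ln (real Q)"
        using Q3 unfolding N_def by (simp add: ln_realpow ln_mult algebra_simps)
      hence "real j \<le> ln (real (N j))" using lnQ mult_mono[of "real j" "real (Suc j)" 1 "ln (real Q)"] by simp
      hence "ln (real j) \<le> L j" unfolding L_def using elim by (subst ln_le_cancel_iff) auto
      moreover have "0 \<le> ln (real j)" using elim by simp
      ultimately show ?case by linarith
    qed
    \<comment> \<open>Instantiated at x = 2, y = 3 and p = 2: the tail bound applies because 3 < 4,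
      and the probabilities are at most j^(-2).\<close>
    from weighted_sum_AE_upper[OF mwR _ _ _ this, of 2]
    show ?thesis by (simp only: L2_set_def power2_minus) (simp only: L2_set_def[symmetric] L2R, simp)
  qed
  have evc: "eventually (\<lambda>j. (1 - \<epsilon>) * lil_norm k (real (N j)) \<le> (q * sA j - 2 * sR j) * sqrt (2 * L j)) sequentially"
  proof -
    have "(\<lambda>j. (q * (sA j / (real (N j) ^ k * sqrt (real (N j)))) - 2 * (sR j / (real (N j) ^ k * sqrt (real (N j))))) / ck)
       \<longlonglongrightarrow> (q * (ck * (q ^ k * sqrt q)) - 2 * (ck * sqrt (1 - q ^ (2 * k + 1)))) / ck"
      using ck by (intro tendsto_divide tendsto_diff tendsto_mult tendsto_const lims) auto
    also have "(q * (ck * (q ^ k * sqrt q)) - 2 * (ck * sqrt (1 - q ^ (2 * k + 1)))) / ck = q * (q ^ k * sqrt q) - 2 * sqrt (1 - q ^ (2 * k + 1))"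
      using ck by (simp add: field_simps)
    finally have "eventually (\<lambda>j. 1 - \<epsilon> < (q * (sA j / (real (N j) ^ k * sqrt (real (N j)))) - 2 * (sR j / (real (N j) ^ k * sqrt (real (N j))))) / ck) sequentially"
      by (rule order_tendstoD(1)) (use Qe in \<open>simp only: q_def\<close>)
    moreover have "eventually (\<lambda>j. 3 \<le> N j) sequentially" using filterlim_at_top[THEN iffD1, OF N] by blast
    ultimately show ?thesis
    proof eventually_elim
      case (elim j)
      have pos: "0 < real (N j) ^ k * sqrt (real (N j))" using elim by simp
      have ln: "lil_norm k (real (N j)) = ck * (real (N j) ^ k * sqrt (real (N j))) * sqrt (2 * L j)"
        by (simp add: lil_norm_def ck_def L_def)
      have "0 < lil_norm k (real (N j))" using elim by (intro lil_norm_pos) auto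
      hence sq: "0 \<le> sqrt (2 * L j)" unfolding ln
        using zero_less_mult_pos[OF _ mult_pos_pos[OF ck pos]] less_imp_le by blast
      have "(1 - \<epsilon>) * (ck * (real (N j) ^ k * sqrt (real (N j)))) \<le> q * sA j - 2 * sR j"
      proof -
        have "(q * (x / p) - 2 * (z / p)) / ck = (q * x - 2 * z) / (ck * p)" if "0 < p" for x z p
          using that by (simp add: diff_divide_distrib mult.commute)
        from elim(1)[unfolded this[OF pos]] show ?thesis
          using pos ck by (simp add: pos_less_divide_eq less_imp_le)
      qed
      from mult_right_mono[OF this sq] show ?case by (simp only: ln mult.assoc)
    qed
  qed
  show "AE \<omega> in M. frequently (\<lambda>n. (1 - \<epsilon>) * lil_norm k (real n) \<le> c * walk_sum k n \<omega>) sequentially"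
    using freqA evR AE_space
  proof eventually_elim
    case (elim \<omega>)
    have "frequently (\<lambda>j. \<omega> \<in> E j \<and> (\<Sum>i<P j. - w j i * X i \<omega>) < 2 * sR j * sqrt (2 * L j) \<and>
        (1 - \<epsilon>) * lil_norm k (real (N j)) \<le> (q * sA j - 2 * sR j) * sqrt (2 * L j)) sequentially"
      using elim(1) eventually_conj[OF elim(2) evc] by (rule frequently_eventually_frequently)
    hence "frequently (\<lambda>j. (1 - \<epsilon>) * lil_norm k (real (N j)) \<le> c * walk_sum k (N j) \<omega>) sequentially"
    proof (rule frequently_elim1)
      fix j assume *: "\<omega> \<in> E j \<and> (\<Sum>i<P j. - w j i * X i \<omega>) < 2 * sR j * sqrt (2 * L j) \<and>
        (1 - \<epsilon>) * lil_norm k (real (N j)) \<le> (q * sA j - 2 * sR j) * sqrt (2 * L j)"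
      have "c * walk_sum k (N j) \<omega> = (\<Sum>i<P j. w j i * X i \<omega>) + VA j \<omega>"
        using sum.atLeastLessThan_concat[of 0 "P j" "N j" "\<lambda>i. w j i * X i \<omega>"] PN[of j]
        unfolding walk_sum_eq VA_def w_def by (simp add: atLeast0LessThan)
      moreover have "(\<Sum>i<P j. - w j i * X i \<omega>) = - (\<Sum>i<P j. w j i * X i \<omega>)"
        by (simp add: sum_negf)
      ultimately show "(1 - \<epsilon>) * lil_norm k (real (N j)) \<le> c * walk_sum k (N j) \<omega>"
        using * by (simp add: E_def left_diff_distrib)
    qed
    thus ?case unfolding frequently_def
      using eventually_compose_filterlim[OF _ N, of "\<lambda>n. \<not> (1 - \<epsilon>) * lil_norm k (real n) \<le> c * walk_sum k n \<omega>"]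
      by blast
  qed
next
  fix \<epsilon> \<delta> :: real and \<omega>
  assume "\<epsilon> \<le> \<delta>" and fr: "frequently (\<lambda>n. (1 - \<epsilon>) * lil_norm k (real n) \<le> c * walk_sum k n \<omega>) sequentially"
  from frequently_eventually_frequently[OF fr eventually_ge_at_top[of 3]]
  show "frequently (\<lambda>n. (1 - \<delta>) * lil_norm k (real n) \<le> c * walk_sum k n \<omega>) sequentially"
  proof (rule frequently_elim1)
    fix n assume n: "(1 - \<epsilon>) * lil_norm k (real n) \<le> c * walk_sum k n \<omega> \<and> 3 \<le> n"
    hence "(1 - \<delta>) * lil_norm k (real n) \<le> (1 - \<epsilon>) * lil_norm k (real n)"
      using \<open>\<epsilon> \<le> \<delta>\<close> lil_norm_pos[of "real n" k] by (intro mult_right_mono) auto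
    thus "(1 - \<delta>) * lil_norm k (real n) \<le> c * walk_sum k n \<omega>" using n by linarith
  qed
qed

end

section \<open>Moments of the counting processes\<close>

lemma has_bochner_integral_poisson:
  assumes t: "0 < t" and f: "\<And>k. 0 \<le> f k" and s: "(\<lambda>k. f k * (t ^ k / fact k * exp (- t))) sums S"
  shows "has_bochner_integral (measure_pmf (poisson_pmf t)) f S"
proof -
  have sum: "summable (\<lambda>k. norm ((t ^ k / fact k * exp (- t)) *\<^sub>R f k))"
    using sums_summable[OF s] t f by (simp add: mult.commute abs_mult)
  have int: "integrable (count_space UNIV) (\<lambda>k. (t ^ k / fact k * exp (- t)) *\<^sub>R f k)"
    using sum by (simp add: integrable_count_space_nat_iff)
  have "integral\<^sup>L (count_space UNIV) (\<lambda>k. (t ^ k / fact k * exp (- t)) *\<^sub>R f k) = S"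
    unfolding integral_count_space_nat[OF int] using sums_unique[OF s] by (simp add: mult.commute)
  moreover have "measure_pmf (poisson_pmf t) = density (count_space UNIV) (\<lambda>k. ennreal (t ^ k / fact k * exp (- t)))"
    using t by (simp add: measure_pmf_eq_density)
  ultimately show ?thesis using int t
    by (simp add: has_bochner_integral_iff integrable_density integral_density)
qed

text \<open>The Stein-Chen identity E (N g(N - 1)) = t E g(N); iterating it gives the factorial
  moments.\<close>

lemma poisson_sums_shift:
  fixes t :: real
  assumes "(\<lambda>k. g k * (t ^ k / fact k * exp (- t))) sums S"
  shows "(\<lambda>k. (real k * g (k - 1)) * (t ^ k / fact k * exp (- t))) sums (t * S)"
proof -
  have "(\<lambda>k. t * (g k * (t ^ k / fact k * exp (- t)))) sums (t * S)"
    using assms by (rule sums_mult)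
  also have "(\<lambda>k. t * (g k * (t ^ k / fact k * exp (- t)))) =
      (\<lambda>k. (real (Suc k) * g (Suc k - 1)) * (t ^ Suc k / fact (Suc k) * exp (- t)))"
    by (simp add: fun_eq_iff fact_Suc del: of_nat_Suc)
  finally show ?thesis by (subst (asm) sums_Suc_iff) simp
qed

lemma poisson_moments:
  assumes t: "0 < t"
  shows "has_bochner_integral (measure_pmf (poisson_pmf t)) real t"
    and "has_bochner_integral (measure_pmf (poisson_pmf t)) (\<lambda>k. (real k - t)\<^sup>2) t"
    and "has_bochner_integral (measure_pmf (poisson_pmf t)) (\<lambda>k. exp (c * real k)) (exp (t * (exp c - 1)))"
proof -
  have exps: "(\<lambda>k. x ^ k / fact k * exp (- t)) sums (exp x * exp (- t))" for x :: real
    using sums_mult2[OF exp_converges[of x], of "exp (- t)"] by (simp add: divide_inverse mult_ac)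
  have s0: "(\<lambda>k. 1 * (t ^ k / fact k * exp (- t))) sums 1"
    using exps[of t] by (simp add: exp_minus)
  have s1: "(\<lambda>k. real k * (t ^ k / fact k * exp (- t))) sums t"
    using poisson_sums_shift[OF s0] by simp
  have s2: "(\<lambda>k. (real k * real (k - 1)) * (t ^ k / fact k * exp (- t))) sums (t * t)"
    using poisson_sums_shift[OF s1] by simp
  have "(\<lambda>k. (real k * real (k - 1)) * (t ^ k / fact k * exp (- t)) + (1 - 2 * t) * (real k * (t ^ k / fact k * exp (- t)))
     + t\<^sup>2 * (1 * (t ^ k / fact k * exp (- t)))) sums (t * t + (1 - 2 * t) * t + t\<^sup>2 * 1)"
    by (intro sums_add sums_mult s0 s1 s2)
  also have "t * t + (1 - 2 * t) * t + t\<^sup>2 * 1 = t" by (simp add: power2_eq_square algebra_simps)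
  also have "(\<lambda>k. (real k * real (k - 1)) * (t ^ k / fact k * exp (- t)) + (1 - 2 * t) * (real k * (t ^ k / fact k * exp (- t)))
     + t\<^sup>2 * (1 * (t ^ k / fact k * exp (- t)))) = (\<lambda>k. (real k - t)\<^sup>2 * (t ^ k / fact k * exp (- t)))"
  proof
    fix k
    have "real k * real (k - 1) = real k * real k - real k" by (cases k) (auto simp: algebra_simps)
    hence "(real k - t)\<^sup>2 = real k * real (k - 1) + (1 - 2 * t) * real k + t\<^sup>2"
      by (simp add: power2_eq_square algebra_simps)
    thus "(real k * real (k - 1)) * (t ^ k / fact k * exp (- t)) + (1 - 2 * t) * (real k * (t ^ k / fact k * exp (- t)))
     + t\<^sup>2 * (1 * (t ^ k / fact k * exp (- t))) = (real k - t)\<^sup>2 * (t ^ k / fact k * exp (- t))"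
      by (simp only: distrib_right mult.assoc mult_1_left)
  qed
  finally show "has_bochner_integral (measure_pmf (poisson_pmf t)) (\<lambda>k. (real k - t)\<^sup>2) t"
    by (intro has_bochner_integral_poisson t) auto
  show "has_bochner_integral (measure_pmf (poisson_pmf t)) real t"
    using s1 by (intro has_bochner_integral_poisson t) auto
  have "(\<lambda>k. exp (c * real k) * (t ^ k / fact k * exp (- t))) = (\<lambda>k. (exp c * t) ^ k / fact k * exp (- t))"
    by (simp add: power_mult_distrib exp_of_nat2_mult mult_ac fun_eq_iff)
  moreover have "exp (exp c * t) * exp (- t) = exp (t * (exp c - 1))"
    by (simp add: exp_add[symmetric] algebra_simps)
  ultimately have "(\<lambda>k. exp (c * real k) * (t ^ k / fact k * exp (- t))) sums exp (t * (exp c - 1))"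
    using exps[of "exp c * t"] by simp
  thus "has_bochner_integral (measure_pmf (poisson_pmf t)) (\<lambda>k. exp (c * real k)) (exp (t * (exp c - 1)))"
    by (intro has_bochner_integral_poisson t) auto
qed

section \<open>Counting along a path, and freezing of independent variables\<close>

definition arrivals_upto :: "(nat \<Rightarrow> real) \<Rightarrow> real \<Rightarrow> nat" where
  "arrivals_upto a s = card {i. 0 < a i \<and> a i \<le> s}"

lemma arrivals_between_0: "arrivals_between S 0 s \<omega> = arrivals_upto (\<lambda>i. S i \<omega>) s"
  by (simp add: arrivals_between_def arrivals_upto_def)

lemma arrivals_upto_nonpos [simp]: "s \<le> 0 \<Longrightarrow> arrivals_upto a s = 0"
proof -
  assume "s \<le> 0"
  hence "{i. 0 < a i \<and> a i \<le> s} = {}" by fastforce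
  thus ?thesis by (simp only: arrivals_upto_def card.empty)
qed

text \<open>For an infinite set both sides are 0, as \<open>enn2real\<close> sends infinity to 0;
  hence the identity is unconditional, and counts are measurable as series.\<close>

lemma real_card_eq_enn2real:
  "real (card {i::nat. P i}) = enn2real (\<Sum>i. of_bool (P i) :: ennreal)"
proof -
  have "(\<Sum>i. of_bool (P i) :: ennreal) = (\<integral>\<^sup>+i. indicator {i. P i} i \<partial>count_space UNIV)"
    by (subst nn_integral_count_space_nat) (auto simp: indicator_def of_bool_def intro!: arg_cong[where f = suminf])
  also have "\<dots> = emeasure (count_space UNIV) {i. P i}" by simp
  finally have "(\<Sum>i. of_bool (P i) :: ennreal) = emeasure (count_space UNIV) {i. P i}" .
  thus ?thesis by (cases "finite {i. P i}") (simp_all add: emeasure_count_space)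
qed

abbreviation path_space :: "(nat \<Rightarrow> real) measure" where
  "path_space \<equiv> Pi\<^sub>M UNIV (\<lambda>_. borel)"

lemma measurable_arrivals_upto [measurable]:
  assumes [measurable]: "f \<in> measurable N path_space" "g \<in> borel_measurable N"
  shows "(\<lambda>x. real (arrivals_upto (f x) (g x))) \<in> borel_measurable N"
  unfolding arrivals_upto_def real_card_eq_enn2real of_bool_def by measurable

text \<open>Both integrals are over \<open>M\<close> instead of image measures: the inner one is
  then a moment of a single Poisson process, with everything else frozen at
  \<open>\<omega>'\<close>.\<close>

lemma (in prob_space) indep_var_nn_integral:
  assumes ind: "indep_var S X N Y" and f[measurable]: "f \<in> borel_measurable (S \<Otimes>\<^sub>M N)"
  shows "(\<integral>\<^sup>+\<omega>. f (X \<omega>, Y \<omega>) \<partial>M) = (\<integral>\<^sup>+\<omega>'. (\<integral>\<^sup>+\<omega>. f (X \<omega>, Y \<omega>') \<partial>M) \<partial>M)"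
proof -
  have [measurable]: "X \<in> measurable M S" "Y \<in> measurable M N"
    using indep_var_rv1[OF ind] indep_var_rv2[OF ind] by auto
  interpret X: prob_space "distr M S X" by (rule prob_space_distr) simp
  interpret Y: prob_space "distr M N Y" by (rule prob_space_distr) simp
  interpret P: pair_sigma_finite "distr M S X" "distr M N Y" ..
  have "(\<integral>\<^sup>+\<omega>. f (X \<omega>, Y \<omega>) \<partial>M) = (\<integral>\<^sup>+z. f z \<partial>distr M (S \<Otimes>\<^sub>M N) (\<lambda>\<omega>. (X \<omega>, Y \<omega>)))"
    by (subst nn_integral_distr) auto
  also have "\<dots> = (\<integral>\<^sup>+z. f z \<partial>(distr M S X \<Otimes>\<^sub>M distr M N Y))"
    using ind unfolding indep_var_distribution_eq by simp
  also have "\<dots> = (\<integral>\<^sup>+y. (\<integral>\<^sup>+x. f (x, y) \<partial>distr M S X) \<partial>distr M N Y)"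
    by (subst P.nn_integral_snd) auto
  also have "\<dots> = (\<integral>\<^sup>+\<omega>'. (\<integral>\<^sup>+x. f (x, Y \<omega>') \<partial>distr M S X) \<partial>M)"
    by (subst nn_integral_distr) auto
  also have "\<dots> = (\<integral>\<^sup>+\<omega>'. (\<integral>\<^sup>+\<omega>. f (X \<omega>, Y \<omega>') \<partial>M) \<partial>M)"
    by (intro nn_integral_cong, subst nn_integral_distr)
       (auto intro!: measurable_compose[OF measurable_Pair2'[of _ N] f, unfolded o_def] measurable_space[of Y M N])
  finally show ?thesis .
qed

lemma (in prob_space) indep_var_integral:
  fixes f :: "_ \<Rightarrow> real"
  assumes ind: "indep_var S X N Y" and f[measurable]: "f \<in> borel_measurable (S \<Otimes>\<^sub>M N)"
    and int: "integrable M (\<lambda>\<omega>. f (X \<omega>, Y \<omega>))"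
  shows "(\<integral>\<omega>. f (X \<omega>, Y \<omega>) \<partial>M) = (\<integral>\<omega>'. (\<integral>\<omega>. f (X \<omega>, Y \<omega>') \<partial>M) \<partial>M)"
proof -
  have [measurable]: "X \<in> measurable M S" "Y \<in> measurable M N"
    using indep_var_rv1[OF ind] indep_var_rv2[OF ind] by auto
  interpret X: prob_space "distr M S X" by (rule prob_space_distr) simp
  interpret Y: prob_space "distr M N Y" by (rule prob_space_distr) simp
  interpret P: pair_sigma_finite "distr M S X" "distr M N Y" ..
  have eq: "distr M (S \<Otimes>\<^sub>M N) (\<lambda>\<omega>. (X \<omega>, Y \<omega>)) = distr M S X \<Otimes>\<^sub>M distr M N Y"
    using ind unfolding indep_var_distribution_eq by simp
  have "integrable (distr M (S \<Otimes>\<^sub>M N) (\<lambda>\<omega>. (X \<omega>, Y \<omega>))) f"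
    using int by (subst integrable_distr_eq) auto
  hence int': "integrable (distr M S X \<Otimes>\<^sub>M distr M N Y) (case_prod (\<lambda>x y. f (x, y)))"
    unfolding eq by simp
  have "(\<integral>\<omega>. f (X \<omega>, Y \<omega>) \<partial>M) = (\<integral>z. f z \<partial>distr M (S \<Otimes>\<^sub>M N) (\<lambda>\<omega>. (X \<omega>, Y \<omega>)))"
    by (subst integral_distr) auto
  also have "\<dots> = (\<integral>z. case_prod (\<lambda>x y. f (x, y)) z \<partial>(distr M S X \<Otimes>\<^sub>M distr M N Y))"
    unfolding eq by simp
  also have "\<dots> = (\<integral>y. (\<integral>x. f (x, y) \<partial>distr M S X) \<partial>distr M N Y)"
    by (rule P.integral_snd[OF int', symmetric])
  also have "\<dots> = (\<integral>\<omega>'. (\<integral>x. f (x, Y \<omega>') \<partial>distr M S X) \<partial>M)"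
  proof (rule integral_distr)
    show "(\<lambda>y. \<integral>x. f (x, y) \<partial>distr M S X) \<in> borel_measurable N"
      by (rule X.borel_measurable_lebesgue_integral) measurable
  qed simp
  also have "\<dots> = (\<integral>\<omega>'. (\<integral>\<omega>. f (X \<omega>, Y \<omega>') \<partial>M) \<partial>M)"
    by (intro Bochner_Integration.integral_cong refl, subst integral_distr)
       (auto intro!: measurable_compose[OF measurable_Pair2'[of _ N] f, unfolded o_def] measurable_space[of Y M N])
  finally show ?thesis .
qed

context random_recursive_tree
begin

lemma measurable_A [measurable]: "A v i \<in> borel_measurable M"
  using offspring_poisson[of v] by (simp add: unit_poisson_arrivals_def)

lemma measurable_path [measurable]: "(\<lambda>\<omega> i. A v i \<omega>) \<in> measurable M path_space"
  by (rule measurable_PiM_single') auto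

lemma measurable_birth [measurable]: "birth A v \<in> borel_measurable M"
proof (induction v)
  case Nil
  have "birth A [] = (\<lambda>_. 0)" by auto
  thus ?case by simp
next
  case (Cons i v)
  have "birth A (i # v) = (\<lambda>\<omega>. birth A v \<omega> + A v i \<omega>)" by auto
  thus ?case using Cons by simp
qed

lemma AE_arrivals:
  "AE \<omega> in M. \<forall>v. (\<forall>i. 0 < A v i \<omega>) \<and> strict_mono (\<lambda>i. A v i \<omega>) \<and> filterlim (\<lambda>i. A v i \<omega>) at_top sequentially"
proof -
  have "AE \<omega> in M. 0 < A v 0 \<omega> \<and> strict_mono (\<lambda>i. A v i \<omega>) \<and> filterlim (\<lambda>i. A v i \<omega>) at_top sequentially" for v
    using offspring_poisson[of v] by (simp add: unit_poisson_arrivals_def)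
  hence "AE \<omega> in M. \<forall>v. 0 < A v 0 \<omega> \<and> strict_mono (\<lambda>i. A v i \<omega>) \<and> filterlim (\<lambda>i. A v i \<omega>) at_top sequentially"
    by (simp add: AE_all_countable)
  thus ?thesis
    by eventually_elim (metis le0 order_less_le_trans strict_mono_less_eq)
qed

lemma arrivals_upto_distr:
  assumes "0 < s"
  shows "distr M (count_space UNIV) (\<lambda>\<omega>. arrivals_upto (\<lambda>i. A v i \<omega>) s) = measure_pmf (poisson_pmf s)"
proof -
  have "distr M (count_space UNIV) (arrivals_between (A v) 0 s) = measure_pmf (poisson_pmf (s - 0))"
    using offspring_poisson[of v] assms unfolding unit_poisson_arrivals_def by blast
  thus ?thesis by (simp add: arrivals_between_0[abs_def])
qed

lemma measurable_arrivals_upto_nat [measurable]: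
  "(\<lambda>\<omega>. arrivals_upto (\<lambda>i. A v i \<omega>) s) \<in> measurable M (count_space UNIV)"
proof -
  have "(\<lambda>\<omega>. real (arrivals_upto (\<lambda>i. A v i \<omega>) s)) \<in> borel_measurable M" by measurable
  hence "(\<lambda>\<omega>. nat \<lfloor>real (arrivals_upto (\<lambda>i. A v i \<omega>) s)\<rfloor>) \<in> measurable M (count_space UNIV)" by measurable
  thus ?thesis by simp
qed

lemma arrivals_upto_moments:
  assumes "0 \<le> s"
  shows "has_bochner_integral M (\<lambda>\<omega>. real (arrivals_upto (\<lambda>i. A v i \<omega>) s)) s"
    and "has_bochner_integral M (\<lambda>\<omega>. (real (arrivals_upto (\<lambda>i. A v i \<omega>) s) - s)\<^sup>2) s"
proof -
  have "has_bochner_integral M (\<lambda>\<omega>. f (arrivals_upto (\<lambda>i. A v i \<omega>) s)) r"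
    if "0 < s" "has_bochner_integral (measure_pmf (poisson_pmf s)) f r" for f :: "nat \<Rightarrow> real" and r
    using that(2) unfolding arrivals_upto_distr[OF that(1), of v, symmetric]
    by (simp add: has_bochner_integral_iff integrable_distr_eq integral_distr)
  from this[OF _ poisson_moments(1)] this[OF _ poisson_moments(2)]
  show "has_bochner_integral M (\<lambda>\<omega>. real (arrivals_upto (\<lambda>i. A v i \<omega>) s)) s"
     "has_bochner_integral M (\<lambda>\<omega>. (real (arrivals_upto (\<lambda>i. A v i \<omega>) s) - s)\<^sup>2) s"
    using assms by (cases "s = 0"; simp add: has_bochner_integral_zero)+
qed

end

text \<open>Birth times as a function of the family of offspring paths rather than of the outcome,
  so that a family restricted to other vertices or shifted to a subtree can be inserted.\<close>

primrec path_sum :: "(nat list \<Rightarrow> nat \<Rightarrow> real) \<Rightarrow> nat list \<Rightarrow> real" where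
  "path_sum a [] = 0"
| "path_sum a (i # v) = path_sum a v + a v i"

lemma birth_eq_path_sum: "birth A v \<omega> = path_sum (\<lambda>w i. A w i \<omega>) v"
  by (induction v) auto

text \<open>A family restricted to \<open>- {v}\<close> is \<open>undefined\<close> at \<open>v\<close>, but a birth time only depends on the strict
  ancestors of a vertex, and these are shorter.\<close>

lemma path_sum_restrict:
  "length u \<le> length v \<Longrightarrow> path_sum (restrict a (- {v})) u = path_sum a u"
  by (induction u) auto

lemma measurable_path_sum:
  "length u \<le> length v \<Longrightarrow> (\<lambda>x. path_sum x u) \<in> borel_measurable (PiM (- {v}) (\<lambda>_. path_space))"
proof (induction u)
  case (Cons i u)
  have "(\<lambda>x. x u) \<in> measurable (PiM (- {v}) (\<lambda>_. path_space)) path_space"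
    using Cons.prems by (intro measurable_component_singleton) auto
  hence "(\<lambda>x. x u i) \<in> borel_measurable (PiM (- {v}) (\<lambda>_. path_space))"
    by measurable
  thus ?case using Cons by simp
qed simp

section \<open>Orthogonality of the offspring fluctuations\<close>

context random_recursive_tree
begin

lemma indep_var_others:
  "indep_var (PiM {v} (\<lambda>_. path_space)) (\<lambda>\<omega>. restrict (\<lambda>w i. A w i \<omega>) {v})
     (PiM (- {v}) (\<lambda>_. path_space)) (\<lambda>\<omega>. restrict (\<lambda>w i. A w i \<omega>) (- {v}))"
  by (rule indep_var_restrict[OF offspring_indep]) auto

lemma measurable_singleton_path: "(\<lambda>a. a v) \<in> measurable (PiM {v} (\<lambda>_. path_space)) path_space"
  by (rule measurable_component_singleton) simp

text \<open>The maximum makes the compensator vanish before the birth of \<open>v\<close>, where the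
  count is 0 as well.\<close>

definition fluctuation :: "nat list \<Rightarrow> real \<Rightarrow> 'a \<Rightarrow> real" where
  "fluctuation v t \<omega> = real (arrivals_upto (\<lambda>i. A v i \<omega>) (t - birth A v \<omega>)) - max 0 (t - birth A v \<omega>)"

lemma measurable_fluctuation [measurable]: "fluctuation v t \<in> borel_measurable M"
  unfolding fluctuation_def by measurable

lemma AE_birth_nonneg: "AE \<omega> in M. \<forall>v. 0 \<le> birth A v \<omega>"
  using AE_arrivals
proof eventually_elim
  case (elim \<omega>)
  show ?case
  proof
    fix v show "0 \<le> birth A v \<omega>"
      using elim by (induction v) (auto intro: add_nonneg_nonneg less_imp_le)
  qed
qed

lemma nn_integral_arrivals_upto:
  "(\<integral>\<^sup>+\<omega>. ennreal (real (arrivals_upto (\<lambda>i. A v i \<omega>) s)) \<partial>M) = ennreal (max 0 s)"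
  "(\<integral>\<^sup>+\<omega>. ennreal ((real (arrivals_upto (\<lambda>i. A v i \<omega>) s) - max 0 s)\<^sup>2) \<partial>M) = ennreal (max 0 s)"
proof -
  have "(\<integral>\<^sup>+\<omega>. ennreal (real (arrivals_upto (\<lambda>i. A v i \<omega>) s)) \<partial>M) = ennreal (max 0 s)
     \<and> (\<integral>\<^sup>+\<omega>. ennreal ((real (arrivals_upto (\<lambda>i. A v i \<omega>) s) - max 0 s)\<^sup>2) \<partial>M) = ennreal (max 0 s)"
  proof (cases "0 \<le> s")
    case True
    thus ?thesis
      using arrivals_upto_moments[OF True, of v]
      by (auto simp: has_bochner_integral_iff nn_integral_eq_integral max_def)
  qed (simp add: max_def)
  thus "(\<integral>\<^sup>+\<omega>. ennreal (real (arrivals_upto (\<lambda>i. A v i \<omega>) s)) \<partial>M) = ennreal (max 0 s)"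
    "(\<integral>\<^sup>+\<omega>. ennreal ((real (arrivals_upto (\<lambda>i. A v i \<omega>) s) - max 0 s)\<^sup>2) \<partial>M) = ennreal (max 0 s)"
    by auto
qed

lemma integral_arrivals_upto:
  "integrable M (\<lambda>\<omega>. real (arrivals_upto (\<lambda>i. A v i \<omega>) s))"
  "(\<integral>\<omega>. real (arrivals_upto (\<lambda>i. A v i \<omega>) s) - max 0 s \<partial>M) = 0"
proof -
  have "integrable M (\<lambda>\<omega>. real (arrivals_upto (\<lambda>i. A v i \<omega>) s)) \<and> (\<integral>\<omega>. real (arrivals_upto (\<lambda>i. A v i \<omega>) s) - max 0 s \<partial>M) = 0"
  proof (cases "0 \<le> s")
    case True
    thus ?thesis
      using arrivals_upto_moments(1)[OF True, of v] by (auto simp: has_bochner_integral_iff prob_space)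
  qed (simp add: max_def)
  thus "integrable M (\<lambda>\<omega>. real (arrivals_upto (\<lambda>i. A v i \<omega>) s))"
    "(\<integral>\<omega>. real (arrivals_upto (\<lambda>i. A v i \<omega>) s) - max 0 s \<partial>M) = 0" by auto
qed

text \<open>The birth time of \<open>v\<close> involves only paths of strictly shorter words and is
  therefore independent of the path of \<open>v\<close>. Freezing it leaves Poisson moments at a
  fixed time.\<close>

lemma nn_integral_offspring:
  "(\<integral>\<^sup>+\<omega>. ennreal (real (arrivals_upto (\<lambda>i. A v i \<omega>) (t - birth A v \<omega>))) \<partial>M) = (\<integral>\<^sup>+\<omega>. ennreal (max 0 (t - birth A v \<omega>)) \<partial>M)"
  "(\<integral>\<^sup>+\<omega>. ennreal ((fluctuation v t \<omega>)\<^sup>2) \<partial>M) = (\<integral>\<^sup>+\<omega>. ennreal (max 0 (t - birth A v \<omega>)) \<partial>M)"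
proof -
  let ?N = "PiM (- {v}) (\<lambda>_. path_space)" and ?R = "\<lambda>\<omega>. restrict (\<lambda>w i. A w i \<omega>) (- {v})"
  have [measurable]: "(\<lambda>x. path_sum x v) \<in> borel_measurable ?N" by (rule measurable_path_sum) simp
  note [measurable] = measurable_singleton_path[of v]
  have R: "path_sum (?R \<omega>) v = birth A v \<omega>" "restrict (\<lambda>w i. A w i \<omega>) {v} v = (\<lambda>i. A v i \<omega>)" for \<omega>
    by (simp_all add: path_sum_restrict birth_eq_path_sum)
  show "(\<integral>\<^sup>+\<omega>. ennreal (real (arrivals_upto (\<lambda>i. A v i \<omega>) (t - birth A v \<omega>))) \<partial>M) = (\<integral>\<^sup>+\<omega>. ennreal (max 0 (t - birth A v \<omega>)) \<partial>M)"
    using indep_var_nn_integral[OF indep_var_others, of "\<lambda>(a, x). ennreal (real (arrivals_upto (a v) (t - path_sum x v)))" v]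
    by (simp only: prod.case R nn_integral_arrivals_upto) measurable
  show "(\<integral>\<^sup>+\<omega>. ennreal ((fluctuation v t \<omega>)\<^sup>2) \<partial>M) = (\<integral>\<^sup>+\<omega>. ennreal (max 0 (t - birth A v \<omega>)) \<partial>M)"
    using indep_var_nn_integral[OF indep_var_others, of "\<lambda>(a, x). ennreal ((real (arrivals_upto (a v) (t - path_sum x v)) - max 0 (t - path_sum x v))\<^sup>2)" v]
    unfolding fluctuation_def
    by (simp only: prod.case R nn_integral_arrivals_upto) measurable
qed

lemma residual_life_le: "(\<integral>\<^sup>+\<omega>. ennreal (max 0 (t - birth A v \<omega>)) \<partial>M) \<le> ennreal \<bar>t\<bar>"
proof -
  have "(\<integral>\<^sup>+\<omega>. ennreal (max 0 (t - birth A v \<omega>)) \<partial>M) \<le> (\<integral>\<^sup>+\<omega>. ennreal \<bar>t\<bar> \<partial>M)"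
  proof (rule nn_integral_mono_AE)
    show "AE \<omega> in M. ennreal (max 0 (t - birth A v \<omega>)) \<le> ennreal \<bar>t\<bar>"
      using AE_birth_nonneg
    proof eventually_elim
      case (elim \<omega>)
      hence "0 \<le> birth A v \<omega>" by blast
      hence "max 0 (t - birth A v \<omega>) \<le> \<bar>t\<bar>" by linarith
      thus ?case by (rule ennreal_leI)
    qed
  qed
  thus ?thesis by (simp add: emeasure_space_1)
qed

lemma integrable_fluctuation_sq: "integrable M (\<lambda>\<omega>. (fluctuation v t \<omega>)\<^sup>2)"
proof (rule integrableI_nonneg)
  show "(\<integral>\<^sup>+\<omega>. ennreal ((fluctuation v t \<omega>)\<^sup>2) \<partial>M) < \<infinity>"
    unfolding nn_integral_offspring using residual_life_le[of t v] by (simp add: le_less_trans)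
qed auto

lemma integrable_fluctuation_mult: "integrable M (\<lambda>\<omega>. fluctuation v t \<omega> * fluctuation w t \<omega>)"
proof (rule Bochner_Integration.integrable_bound)
  show "integrable M (\<lambda>\<omega>. (fluctuation v t \<omega>)\<^sup>2 + (fluctuation w t \<omega>)\<^sup>2)"
    by (intro Bochner_Integration.integrable_add integrable_fluctuation_sq)
  have "\<bar>x * y\<bar> \<le> x\<^sup>2 + y\<^sup>2" for x y :: real
  proof -
    have "0 \<le> \<bar>x\<bar> * \<bar>y\<bar>" by simp
    thus ?thesis using sum_squares_bound[of "\<bar>x\<bar>" "\<bar>y\<bar>"] unfolding abs_mult power2_abs by linarith
  qed
  thus "AE \<omega> in M. norm (fluctuation v t \<omega> * fluctuation w t \<omega>) \<le> norm ((fluctuation v t \<omega>)\<^sup>2 + (fluctuation w t \<omega>)\<^sup>2)"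
    by simp
qed measurable

text \<open>Freeze all paths except that of the longer vertex (either one if the lengths agree).
  Both birth times and the fluctuation of the other vertex are then constants, and the remaining
  factor has mean 0.\<close>

lemma fluctuation_orthogonal:
  assumes "v \<noteq> w"
  shows "(\<integral>\<omega>. fluctuation v t \<omega> * fluctuation w t \<omega> \<partial>M) = 0"
proof -
  have main: "(\<integral>\<omega>. fluctuation v t \<omega> * fluctuation w t \<omega> \<partial>M) = 0"
    if "v \<noteq> w" "length w \<le> length v" for v w
  proof -
    let ?N = "PiM (- {v}) (\<lambda>_. path_space)" and ?R = "\<lambda>\<omega>. restrict (\<lambda>w i. A w i \<omega>) (- {v})"
    have [measurable]: "(\<lambda>x. path_sum x v) \<in> borel_measurable ?N" "(\<lambda>x. path_sum x w) \<in> borel_measurable ?N"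
      using that by (auto intro!: measurable_path_sum)
    have [measurable]: "(\<lambda>x. x w) \<in> measurable ?N path_space"
      using that by (intro measurable_component_singleton) auto
    have R: "path_sum (?R \<omega>) v = birth A v \<omega>" "path_sum (?R \<omega>) w = birth A w \<omega>"
        "?R \<omega> w = (\<lambda>i. A w i \<omega>)" "restrict (\<lambda>w i. A w i \<omega>) {v} v = (\<lambda>i. A v i \<omega>)" for \<omega>
      using that by (simp_all add: path_sum_restrict birth_eq_path_sum)
    note [measurable] = measurable_singleton_path[of v]
    define f :: "(nat list \<Rightarrow> nat \<Rightarrow> real) \<times> (nat list \<Rightarrow> nat \<Rightarrow> real) \<Rightarrow> real" where
      "f = (\<lambda>(a, x). (real (arrivals_upto (a v) (t - path_sum x v)) - max 0 (t - path_sum x v))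
        * (real (arrivals_upto (x w) (t - path_sum x w)) - max 0 (t - path_sum x w)))"
    have fm: "f \<in> borel_measurable (PiM {v} (\<lambda>_. path_space) \<Otimes>\<^sub>M ?N)" unfolding f_def by measurable
    have feq: "f (restrict (\<lambda>w i. A w i \<omega>) {v}, ?R \<omega>) = fluctuation v t \<omega> * fluctuation w t \<omega>" for \<omega>
      unfolding f_def prod.case R fluctuation_def ..
    have "(\<integral>\<omega>. fluctuation v t \<omega> * fluctuation w t \<omega> \<partial>M) = (\<integral>\<omega>'. (\<integral>\<omega>. f (restrict (\<lambda>w i. A w i \<omega>) {v}, ?R \<omega>') \<partial>M) \<partial>M)"
      using indep_var_integral[OF indep_var_others fm] integrable_fluctuation_mult[of v t w] unfolding feq by blast
    also have "\<dots> = (\<integral>\<omega>'. 0 \<partial>M)"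
      unfolding f_def prod.case by (simp add: integral_arrivals_upto)
    finally show ?thesis by simp
  qed
  show ?thesis
  proof (cases "length w \<le> length v")
    case False
    thus ?thesis using main[of w v] assms by (simp add: mult.commute)
  qed (use main assms in blast)
qed

lemma fluctuation_sum_sq:
  assumes "finite F"
  shows "(\<integral>\<^sup>+\<omega>. ennreal ((\<Sum>v\<in>F. fluctuation v t \<omega>)\<^sup>2) \<partial>M) = (\<Sum>v\<in>F. \<integral>\<^sup>+\<omega>. ennreal (max 0 (t - birth A v \<omega>)) \<partial>M)"
proof -
  have eq: "(\<Sum>v\<in>F. fluctuation v t \<omega>)\<^sup>2 = (\<Sum>v\<in>F. \<Sum>w\<in>F. fluctuation v t \<omega> * fluctuation w t \<omega>)" for \<omega>
    by (simp add: power2_eq_square sum_product)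
  have int: "integrable M (\<lambda>\<omega>. (\<Sum>v\<in>F. fluctuation v t \<omega>)\<^sup>2)"
    unfolding eq by (intro Bochner_Integration.integrable_sum integrable_fluctuation_mult)
  have "(\<integral>\<omega>. (\<Sum>v\<in>F. fluctuation v t \<omega>)\<^sup>2 \<partial>M) = (\<Sum>v\<in>F. \<Sum>w\<in>F. \<integral>\<omega>. fluctuation v t \<omega> * fluctuation w t \<omega> \<partial>M)"
    unfolding eq by (simp add: Bochner_Integration.integral_sum Bochner_Integration.integrable_sum integrable_fluctuation_mult)
  also have "\<dots> = (\<Sum>v\<in>F. \<Sum>w\<in>F. if w = v then \<integral>\<omega>. (fluctuation v t \<omega>)\<^sup>2 \<partial>M else 0)"
    by (intro sum.cong refl) (auto simp: fluctuation_orthogonal power2_eq_square)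
  also have "\<dots> = (\<Sum>v\<in>F. \<integral>\<omega>. (fluctuation v t \<omega>)\<^sup>2 \<partial>M)"
    using assms by (simp add: sum.delta')
  finally have "(\<integral>\<^sup>+\<omega>. ennreal ((\<Sum>v\<in>F. fluctuation v t \<omega>)\<^sup>2) \<partial>M) = ennreal (\<Sum>v\<in>F. \<integral>\<omega>. (fluctuation v t \<omega>)\<^sup>2 \<partial>M)"
    using int by (simp add: nn_integral_eq_integral)
  also have "\<dots> = (\<Sum>v\<in>F. ennreal (\<integral>\<omega>. (fluctuation v t \<omega>)\<^sup>2 \<partial>M))"
    by (rule sum_ennreal[symmetric]) (auto intro!: integral_nonneg_AE)
  also have "\<dots> = (\<Sum>v\<in>F. \<integral>\<^sup>+\<omega>. ennreal ((fluctuation v t \<omega>)\<^sup>2) \<partial>M)"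
    by (intro sum.cong refl nn_integral_eq_integral[symmetric] integrable_fluctuation_sq) auto
  finally show ?thesis unfolding nn_integral_offspring .
qed

text \<open>A series over the codes of lists is measurable; almost surely only finitely many of its
  terms differ from 0, since finitely many vertices are born by time \<open>t\<close>.\<close>

definition total_fluctuation :: "nat list set \<Rightarrow> real \<Rightarrow> 'a \<Rightarrow> real" where
  "total_fluctuation V t \<omega> = (\<Sum>n. if list_decode n \<in> V then fluctuation (list_decode n) t \<omega> else 0)"

lemma measurable_total_fluctuation [measurable]: "total_fluctuation V t \<in> borel_measurable M"
  unfolding total_fluctuation_def by measurable

lemma total_fluctuation_eq:
  assumes fin: "finite {v. birth A v \<omega> \<le> t}"
  shows "total_fluctuation V t \<omega> = (\<Sum>v | v \<in> V \<and> birth A v \<omega> \<le> t. fluctuation v t \<omega>)"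
    and "eventually (\<lambda>N. (\<Sum>n<N. if list_decode n \<in> V then fluctuation (list_decode n) t \<omega> else 0) = total_fluctuation V t \<omega>) sequentially"
proof -
  let ?g = "\<lambda>n. if list_decode n \<in> V then fluctuation (list_decode n) t \<omega> else 0"
  let ?S = "list_encode ` {v \<in> V. birth A v \<omega> \<le> t}"
  have finS: "finite ?S" using fin by (intro finite_imageI) (auto elim: rev_finite_subset)
  have zero: "?g n = 0" if "n \<notin> ?S" for n
  proof (cases "list_decode n \<in> V")
    case True
    hence "\<not> birth A (list_decode n) \<omega> \<le> t"
      using that by (metis (mono_tags, lifting) image_eqI mem_Collect_eq list_decode_inverse)
    thus ?thesis using True by (simp add: fluctuation_def)
  qed simp
  have "total_fluctuation V t \<omega> = sum ?g ?S"
    unfolding total_fluctuation_def by (rule suminf_finite[OF finS zero])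
  also have "\<dots> = (\<Sum>v | v \<in> V \<and> birth A v \<omega> \<le> t. fluctuation v t \<omega>)"
    by (subst sum.reindex) (auto intro: inj_list_encode)
  finally show "total_fluctuation V t \<omega> = (\<Sum>v | v \<in> V \<and> birth A v \<omega> \<le> t. fluctuation v t \<omega>)" .
  obtain N0 where N0: "?S \<subseteq> {..<N0}" using finS finite_nat_iff_bounded by blast
  show "eventually (\<lambda>N. (\<Sum>n<N. ?g n) = total_fluctuation V t \<omega>) sequentially"
    unfolding \<open>total_fluctuation V t \<omega> = sum ?g ?S\<close>
    using eventually_ge_at_top[of N0]
  proof eventually_elim
    case (elim N)
    show ?case by (rule sum.mono_neutral_right) (use N0 elim zero in auto)
  qed
qed

text \<open>Fatou's lemma along the finite partial sums, whose second moments are additive by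
  orthogonality. An upper bound is all that is needed later, so convergence in mean square is
  avoided.\<close>

lemma total_fluctuation_sq_le:
  assumes fin: "AE \<omega> in M. finite {v. birth A v \<omega> \<le> t}"
  shows "(\<integral>\<^sup>+\<omega>. ennreal ((total_fluctuation V t \<omega>)\<^sup>2) \<partial>M) \<le> (\<integral>\<^sup>+v. (\<integral>\<^sup>+\<omega>. ennreal (max 0 (t - birth A v \<omega>)) \<partial>M) \<partial>count_space V)"
proof -
  define g where "g n \<omega> = (if list_decode n \<in> V then fluctuation (list_decode n) t \<omega> else 0)" for n \<omega>
  have [measurable]: "g n \<in> borel_measurable M" for n unfolding g_def by measurable
  let ?B = "\<integral>\<^sup>+v. (\<integral>\<^sup>+\<omega>. ennreal (max 0 (t - birth A v \<omega>)) \<partial>M) \<partial>count_space V"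
  have "(\<integral>\<^sup>+\<omega>. ennreal ((total_fluctuation V t \<omega>)\<^sup>2) \<partial>M) = (\<integral>\<^sup>+\<omega>. liminf (\<lambda>N. ennreal ((\<Sum>n<N. g n \<omega>)\<^sup>2)) \<partial>M)"
  proof (rule nn_integral_cong_AE)
    from fin show "AE \<omega> in M. ennreal ((total_fluctuation V t \<omega>)\<^sup>2) = liminf (\<lambda>N. ennreal ((\<Sum>n<N. g n \<omega>)\<^sup>2))"
    proof eventually_elim
      case (elim \<omega>)
      have "(\<lambda>N. ennreal ((\<Sum>n<N. g n \<omega>)\<^sup>2)) \<longlonglongrightarrow> ennreal ((total_fluctuation V t \<omega>)\<^sup>2)"
        using total_fluctuation_eq(2)[OF elim, of V] unfolding g_def[symmetric]
        by (intro tendsto_eventually) (auto elim: eventually_mono)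
      thus ?case by (intro lim_imp_Liminf[symmetric]) auto
    qed
  qed
  also have "\<dots> \<le> liminf (\<lambda>N. \<integral>\<^sup>+\<omega>. ennreal ((\<Sum>n<N. g n \<omega>)\<^sup>2) \<partial>M)"
    by (rule nn_integral_liminf) measurable
  also have "\<dots> \<le> ?B"
  proof (rule order_trans[OF Liminf_le_Limsup Limsup_bounded])
    show "eventually (\<lambda>N. (\<integral>\<^sup>+\<omega>. ennreal ((\<Sum>n<N. g n \<omega>)\<^sup>2) \<partial>M) \<le> ?B) sequentially"
    proof (intro always_eventually allI)
      fix N
      let ?F = "list_decode ` {..<N} \<inter> V"
      let ?I = "{n\<in>{..<N}. list_decode n \<in> V}"
      have "(\<Sum>n<N. g n \<omega>) = (\<Sum>v\<in>?F. fluctuation v t \<omega>)" for \<omega>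
      proof -
        have "(\<Sum>n<N. g n \<omega>) = (\<Sum>n\<in>?I. fluctuation (list_decode n) t \<omega>)"
          unfolding g_def by (rule sum.inter_filter[symmetric]) simp
        also have "\<dots> = (\<Sum>v\<in>list_decode ` ?I. fluctuation v t \<omega>)"
          by (subst sum.reindex) (auto intro: inj_list_decode)
        also have "list_decode ` ?I = ?F" by auto
        finally show ?thesis .
      qed
      hence "(\<integral>\<^sup>+\<omega>. ennreal ((\<Sum>n<N. g n \<omega>)\<^sup>2) \<partial>M) = (\<Sum>v\<in>?F. \<integral>\<^sup>+\<omega>. ennreal (max 0 (t - birth A v \<omega>)) \<partial>M)"
        by (simp add: fluctuation_sum_sq)
      also have "\<dots> = (\<integral>\<^sup>+v. (\<integral>\<^sup>+\<omega>. ennreal (max 0 (t - birth A v \<omega>)) \<partial>M) \<partial>count_space ?F)"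
        by (simp add: nn_integral_count_space_finite)
      also have "\<dots> \<le> ?B"
        by (subst (1 2) nn_integral_count_space_indicator)
           (auto intro!: nn_integral_mono simp: indicator_def)
      finally show "(\<integral>\<^sup>+\<omega>. ennreal ((\<Sum>n<N. g n \<omega>)\<^sup>2) \<partial>M) \<le> ?B" .
    qed
  qed simp_all
  finally show ?thesis .
qed

end

section \<open>First moments of the level sizes\<close>

lemma bij_betw_children:
  "bij_betw (\<lambda>(v, i). i # v) ({v. length v = k} \<times> UNIV) {v. length v = Suc k}"
  by (rule bij_betwI[where g = "\<lambda>u. (tl u, hd u)"]) (auto simp: length_Suc_conv)

lemma nn_integral_level_Suc:
  fixes g :: "nat list \<Rightarrow> ennreal"
  shows "(\<integral>\<^sup>+u. g u \<partial>count_space {v. length v = Suc k}) = (\<integral>\<^sup>+v. (\<integral>\<^sup>+i. g (i # v) \<partial>count_space UNIV) \<partial>count_space {v. length v = k})"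
proof -
  let ?L = "{v :: nat list. length v = k}"
  have "(\<integral>\<^sup>+u. g u \<partial>count_space {v. length v = Suc k}) = (\<integral>\<^sup>+p. g ((\<lambda>(v, i). i # v) p) \<partial>count_space (?L \<times> UNIV))"
    by (rule nn_integral_bij_count_space[OF bij_betw_children, symmetric])
  also have "\<dots> = (\<integral>\<^sup>+p. g (snd p # fst p) * indicator ?L (fst p) \<partial>count_space UNIV)"
    by (subst nn_integral_count_space_indicator)
       (auto simp: case_prod_unfold indicator_def mem_Times_iff intro!: nn_integral_cong)
  also have "\<dots> = (\<integral>\<^sup>+v. (\<integral>\<^sup>+i. g (i # v) * indicator ?L v \<partial>count_space UNIV) \<partial>count_space UNIV)"
    by (subst nn_integral_fst_count_space[symmetric]) simp
  also have "\<dots> = (\<integral>\<^sup>+v. (\<integral>\<^sup>+i. g (i # v) \<partial>count_space UNIV) * indicator ?L v \<partial>count_space UNIV)"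
    by (intro nn_integral_cong nn_integral_multc) auto
  also have "\<dots> = (\<integral>\<^sup>+v. (\<integral>\<^sup>+i. g (i # v) \<partial>count_space UNIV) \<partial>count_space ?L)"
    by (subst (2) nn_integral_count_space_indicator) auto
  finally show ?thesis .
qed

lemma nn_integral_levels:
  fixes g :: "nat list \<Rightarrow> ennreal"
  shows "(\<integral>\<^sup>+v. g v \<partial>count_space UNIV) = (\<Sum>k. \<integral>\<^sup>+v. g v \<partial>count_space {v. length v = k})"
proof -
  have "(\<Sum>k. g v * indicator {v. length v = k} v) = g v" for v
    by (subst suminf_finite[of "{length v}"]) (auto simp: indicator_def)
  hence "(\<integral>\<^sup>+v. g v \<partial>count_space UNIV) = (\<integral>\<^sup>+v. (\<Sum>k. g v * indicator {v. length v = k} v) \<partial>count_space UNIV)"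
    by simp
  also have "\<dots> = (\<Sum>k. \<integral>\<^sup>+v. g v * indicator {v. length v = k} v \<partial>count_space UNIV)"
    by (rule nn_integral_suminf) auto
  also have "\<dots> = (\<Sum>k. \<integral>\<^sup>+v. g v \<partial>count_space {v. length v = k})"
    by (subst nn_integral_count_space_indicator) auto
  finally show ?thesis .
qed

lemma measurable_nn_integral_lists:
  fixes f :: "nat list \<Rightarrow> 'b \<Rightarrow> ennreal"
  assumes [measurable]: "\<And>v. f v \<in> borel_measurable N"
  shows "(\<lambda>x. \<integral>\<^sup>+v. f v x \<partial>count_space UNIV) \<in> borel_measurable N"
proof -
  have "(\<integral>\<^sup>+v. f v x \<partial>count_space UNIV) = (\<Sum>n. f (list_decode n) x)" for x
    by (subst nn_integral_bij_count_space[OF bij_list_decode, symmetric]) (simp add: nn_integral_count_space_nat)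
  thus ?thesis by simp
qed

context random_recursive_tree
begin

lemma AE_finite_arrivals: "AE \<omega> in M. \<forall>v s. finite {i. A v i \<omega> \<le> s}"
  using AE_arrivals
proof eventually_elim
  case (elim \<omega>)
  show ?case
  proof (intro allI)
    fix v s
    have "eventually (\<lambda>n. s < A v n \<omega>) sequentially"
      using elim filterlim_at_top_dense[of "\<lambda>i. A v i \<omega>" sequentially] by blast
    then obtain n0 where "\<And>n. n \<ge> n0 \<Longrightarrow> s < A v n \<omega>"
      by (auto simp: eventually_sequentially)
    hence "{i. A v i \<omega> \<le> s} \<subseteq> {..<n0}" by (force simp: not_less[symmetric])
    thus "finite {i. A v i \<omega> \<le> s}" by (rule finite_subset) simp
  qed
qed

lemma residual_eq_integral:
  assumes "0 \<le> t"
  shows "(\<integral>\<^sup>+\<omega>. ennreal (max 0 (t - birth A v \<omega>)) \<partial>M)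
    = (\<integral>\<^sup>+s. (\<integral>\<^sup>+\<omega>. indicator {..s} (birth A v \<omega>) \<partial>M) * indicator {0..t} s \<partial>lborel)"
proof -
  interpret pair_sigma_finite M lborel ..
  have "(\<integral>\<^sup>+\<omega>. ennreal (max 0 (t - birth A v \<omega>)) \<partial>M)
    = (\<integral>\<^sup>+\<omega>. (\<integral>\<^sup>+s. indicator {..s} (birth A v \<omega>) * indicator {0..t} s \<partial>lborel) \<partial>M)"
  proof (rule nn_integral_cong_AE)
    show "AE \<omega> in M. ennreal (max 0 (t - birth A v \<omega>)) = (\<integral>\<^sup>+s. indicator {..s} (birth A v \<omega>) * indicator {0..t} s \<partial>lborel)"
      using AE_birth_nonneg
    proof eventually_elim
      case (elim \<omega>)
      have "(\<integral>\<^sup>+s. indicator {..s} (birth A v \<omega>) * indicator {0..t} s \<partial>lborel) = (\<integral>\<^sup>+s. indicator {birth A v \<omega>..t} s \<partial>lborel)"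
        using elim by (intro nn_integral_cong) (auto simp: indicator_def dest: spec[of _ v])
      also have "\<dots> = ennreal (max 0 (t - birth A v \<omega>))"
        by (auto simp: max_def ennreal_neg)
      finally show ?case by simp
    qed
  qed
  also have "\<dots> = (\<integral>\<^sup>+s. (\<integral>\<^sup>+\<omega>. indicator {..s} (birth A v \<omega>) * indicator {0..t} s \<partial>M) \<partial>lborel)"
  proof (rule Fubini'[symmetric])
    have "Measurable.pred (M \<Otimes>\<^sub>M lborel) (\<lambda>x. birth A v (fst x) \<le> snd x \<and> 0 \<le> snd x \<and> snd x \<le> t)" by measurable
    hence "(\<lambda>x. of_bool (birth A v (fst x) \<le> snd x \<and> 0 \<le> snd x \<and> snd x \<le> t) :: ennreal) \<in> borel_measurable (M \<Otimes>\<^sub>M lborel)"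
      unfolding of_bool_def by measurable
    also have "(\<lambda>x. of_bool (birth A v (fst x) \<le> snd x \<and> 0 \<le> snd x \<and> snd x \<le> t) :: ennreal) =
       (\<lambda>(\<omega>, s). indicator {..s} (birth A v \<omega>) * indicator {0..t} s)"
      by (auto simp: indicator_def fun_eq_iff)
    finally show "(\<lambda>(\<omega>, s). indicator {..s} (birth A v \<omega>) * indicator {0..t} s :: ennreal) \<in> borel_measurable (M \<Otimes>\<^sub>M lborel)" .
  qed
  also have "\<dots> = (\<integral>\<^sup>+s. (\<integral>\<^sup>+\<omega>. indicator {..s} (birth A v \<omega>) \<partial>M) * indicator {0..t} s \<partial>lborel)"
    by (intro nn_integral_cong nn_integral_multc) measurable
  finally show ?thesis .
qed

text \<open>The two claims feed each other: summed over children, the mean size of level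
  \<open>Suc k\<close> is the mean residual time of level \<open>k\<close>, and the latter is the
  time integral of the mean size of level \<open>k\<close>.\<close>

lemma expected_level_size:
  assumes "0 \<le> t"
  shows "(\<integral>\<^sup>+v. (\<integral>\<^sup>+\<omega>. indicator {..t} (birth A v \<omega>) \<partial>M) \<partial>count_space {v. length v = k}) = ennreal (t ^ k / fact k)"
    and "(\<integral>\<^sup>+v. (\<integral>\<^sup>+\<omega>. ennreal (max 0 (t - birth A v \<omega>)) \<partial>M) \<partial>count_space {v. length v = k}) = ennreal (t ^ Suc k / fact (Suc k))"
proof -
  have step1: "(\<integral>\<^sup>+v. (\<integral>\<^sup>+\<omega>. ennreal (max 0 (t - birth A v \<omega>)) \<partial>M) \<partial>count_space {v. length v = k}) = ennreal (t ^ Suc k / fact (Suc k))"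
    if 0: "0 \<le> t"
      and IH: "\<And>s. 0 \<le> s \<Longrightarrow> (\<integral>\<^sup>+v. (\<integral>\<^sup>+\<omega>. indicator {..s} (birth A v \<omega>) \<partial>M) \<partial>count_space {v. length v = k}) = ennreal (s ^ k / fact k)"
    for t k
  proof -
    interpret P: pair_sigma_finite lborel M ..
    have meas: "(\<lambda>s. (\<integral>\<^sup>+\<omega>. indicator {..s} (birth A v \<omega>) \<partial>M) * indicator {0..t} s) \<in> borel_measurable lborel" for v
    proof -
      have "Measurable.pred (lborel \<Otimes>\<^sub>M M) (\<lambda>x. birth A v (snd x) \<le> fst x)" by measurable
      hence "(\<lambda>x. of_bool (birth A v (snd x) \<le> fst x) :: ennreal) \<in> borel_measurable (lborel \<Otimes>\<^sub>M M)"
        unfolding of_bool_def by measurable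
      also have "(\<lambda>x. of_bool (birth A v (snd x) \<le> fst x) :: ennreal) = (\<lambda>(s, \<omega>). indicator {..s} (birth A v \<omega>))"
        by (auto simp: indicator_def fun_eq_iff)
      finally have "(\<lambda>s. \<integral>\<^sup>+\<omega>. indicator {..s} (birth A v \<omega>) \<partial>M :: ennreal) \<in> borel_measurable lborel"
        by (rule borel_measurable_nn_integral)
      thus ?thesis by measurable
    qed
    have "(\<integral>\<^sup>+v. (\<integral>\<^sup>+\<omega>. ennreal (max 0 (t - birth A v \<omega>)) \<partial>M) \<partial>count_space {v. length v = k})
      = (\<integral>\<^sup>+s. (\<integral>\<^sup>+v. (\<integral>\<^sup>+\<omega>. indicator {..s} (birth A v \<omega>) \<partial>M) * indicator {0..t} s \<partial>count_space {v. length v = k}) \<partial>lborel)"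
      unfolding residual_eq_integral[OF 0]
      by (rule nn_integral_count_space_nn_integral[symmetric]) (use meas in auto)
    also have "\<dots> = (\<integral>\<^sup>+s. ennreal (s ^ k / fact k) * indicator {0..t} s \<partial>lborel)"
    proof (rule nn_integral_cong)
      fix s
      have "(\<integral>\<^sup>+v. (\<integral>\<^sup>+\<omega>. indicator {..s} (birth A v \<omega>) \<partial>M) * indicator {0..t} s \<partial>count_space {v. length v = k})
        = (\<integral>\<^sup>+v. (\<integral>\<^sup>+\<omega>. indicator {..s} (birth A v \<omega>) \<partial>M) \<partial>count_space {v. length v = k}) * indicator {0..t} s"
        by (rule nn_integral_multc) auto
      also have "\<dots> = ennreal (s ^ k / fact k) * indicator {0..t} s"
        using IH[of s] by (cases "s \<in> {0..t}") auto
      finally show "(\<integral>\<^sup>+v. (\<integral>\<^sup>+\<omega>. indicator {..s} (birth A v \<omega>) \<partial>M) * indicator {0..t} s \<partial>count_space {v. length v = k})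
        = ennreal (s ^ k / fact k) * indicator {0..t} s" .
    qed
    also have "\<dots> = ennreal (t ^ Suc k / fact (Suc k) - 0 ^ Suc k / fact (Suc k))"
    proof (rule nn_integral_FTC_Icc[where F = "\<lambda>s. s ^ Suc k / fact (Suc k)" and f = "\<lambda>s. s ^ k / fact k"])
      fix s :: real
      have "((\<lambda>s. s ^ Suc k / fact (Suc k)) has_real_derivative (real (Suc k) * s ^ k / fact (Suc k))) (at s)"
        using DERIV_cdivide[OF DERIV_pow[of "Suc k" s], of "fact (Suc k)"] by (simp del: fact_Suc of_nat_Suc)
      moreover have "real (Suc k) * s ^ k / fact (Suc k) = s ^ k / fact k"
        by (simp add: fact_Suc del: of_nat_Suc)
      ultimately show "((\<lambda>s. s ^ Suc k / fact (Suc k)) has_real_derivative s ^ k / fact k) (at s)"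
        by metis
    qed (use 0 in auto)
    finally show ?thesis by simp
  qed
  have main: "(\<integral>\<^sup>+v. (\<integral>\<^sup>+\<omega>. indicator {..t} (birth A v \<omega>) \<partial>M) \<partial>count_space {v. length v = k}) = ennreal (t ^ k / fact k)"
    if "0 \<le> t" for t k using that
  proof (induction k arbitrary: t)
    case 0
    have "{v :: nat list. length v = 0} = {[]}" by auto
    thus ?case using 0 by (simp add: nn_integral_count_space_finite emeasure_space_1 indicator_def)
  next
    case (Suc k)
    have one: "(\<integral>\<^sup>+i. (\<integral>\<^sup>+\<omega>. indicator {..t} (birth A (i # v) \<omega>) \<partial>M) \<partial>count_space UNIV) = (\<integral>\<^sup>+\<omega>. ennreal (max 0 (t - birth A v \<omega>)) \<partial>M)" for v
    proof -
      have "(\<integral>\<^sup>+i. (\<integral>\<^sup>+\<omega>. indicator {..t} (birth A (i # v) \<omega>) \<partial>M) \<partial>count_space UNIV) =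
        (\<integral>\<^sup>+\<omega>. (\<integral>\<^sup>+i. indicator {..t} (birth A (i # v) \<omega>) \<partial>count_space UNIV) \<partial>M)"
        by (rule nn_integral_count_space_nn_integral[symmetric]) (auto simp del: birth.simps)
      also have "\<dots> = (\<integral>\<^sup>+\<omega>. ennreal (real (arrivals_upto (\<lambda>i. A v i \<omega>) (t - birth A v \<omega>))) \<partial>M)"
      proof (rule nn_integral_cong_AE)
        from AE_arrivals AE_finite_arrivals
        show "AE \<omega> in M. (\<integral>\<^sup>+i. indicator {..t} (birth A (i # v) \<omega>) \<partial>count_space UNIV) = ennreal (real (arrivals_upto (\<lambda>i. A v i \<omega>) (t - birth A v \<omega>)))"
        proof eventually_elim
          case (elim \<omega>)
          let ?S = "{i. A v i \<omega> \<le> t - birth A v \<omega>}"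
          have "(\<integral>\<^sup>+i. indicator {..t} (birth A (i # v) \<omega>) \<partial>count_space UNIV) = (\<integral>\<^sup>+i. indicator ?S i \<partial>count_space UNIV)"
            by (intro nn_integral_cong) (auto simp: indicator_def)
          also have "\<dots> = ennreal (real (card ?S))"
            using elim(2) by (simp add: ennreal_of_nat_eq_real_of_nat)
          also have "?S = {i. 0 < A v i \<omega> \<and> A v i \<omega> \<le> t - birth A v \<omega>}" using elim(1) by auto
          finally show ?case by (simp add: arrivals_upto_def)
        qed
      qed
      finally show ?thesis by (simp add: nn_integral_offspring)
    qed
    show ?case unfolding nn_integral_level_Suc one using step1[OF Suc.prems Suc.IH] .
  qed
  show "(\<integral>\<^sup>+v. (\<integral>\<^sup>+\<omega>. indicator {..t} (birth A v \<omega>) \<partial>M) \<partial>count_space {v. length v = k}) = ennreal (t ^ k / fact k)"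
    by (rule main[OF assms])
  show "(\<integral>\<^sup>+v. (\<integral>\<^sup>+\<omega>. ennreal (max 0 (t - birth A v \<omega>)) \<partial>M) \<partial>count_space {v. length v = k}) = ennreal (t ^ Suc k / fact (Suc k))"
    by (rule step1[OF assms main])
qed

lemma expected_size:
  assumes "0 \<le> t"
  shows "(\<integral>\<^sup>+v. (\<integral>\<^sup>+\<omega>. indicator {..t} (birth A v \<omega>) \<partial>M) \<partial>count_space UNIV) = ennreal (exp t)"
    and "(\<integral>\<^sup>+v. (\<integral>\<^sup>+\<omega>. ennreal (max 0 (t - birth A v \<omega>)) \<partial>M) \<partial>count_space UNIV) = ennreal (exp t - 1)"
proof -
  have s: "(\<lambda>k. t ^ k / fact k) sums exp t"
    using exp_converges[of t] by (simp add: divide_inverse mult.commute)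
  show "(\<integral>\<^sup>+v. (\<integral>\<^sup>+\<omega>. indicator {..t} (birth A v \<omega>) \<partial>M) \<partial>count_space UNIV) = ennreal (exp t)"
    unfolding nn_integral_levels expected_level_size[OF assms]
    by (rule suminf_ennreal_eq[OF _ s]) (use assms in simp)
  have "(\<lambda>k. t ^ Suc k / fact (Suc k)) sums (exp t - 1)"
    using s by (subst sums_Suc_iff) simp
  thus "(\<integral>\<^sup>+v. (\<integral>\<^sup>+\<omega>. ennreal (max 0 (t - birth A v \<omega>)) \<partial>M) \<partial>count_space UNIV) = ennreal (exp t - 1)"
    unfolding nn_integral_levels expected_level_size[OF assms]
    by (intro suminf_ennreal_eq) (use assms in simp)
qed

text \<open>Finite mean population at integer times excludes explosion at all times outside a single
  null set.\<close>

lemma AE_locally_finite: "AE \<omega> in M. \<forall>t. finite {v. birth A v \<omega> \<le> t}"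
proof -
  have "AE \<omega> in M. finite {v. birth A v \<omega> \<le> real n}" for n :: nat
  proof -
    have "(\<integral>\<^sup>+\<omega>. (\<integral>\<^sup>+v. indicator {..real n} (birth A v \<omega>) \<partial>count_space UNIV) \<partial>M) = ennreal (exp (real n))"
      unfolding expected_size(1)[of "real n", simplified, symmetric]
      by (rule nn_integral_count_space_nn_integral) auto
    hence "AE \<omega> in M. (\<integral>\<^sup>+v. indicator {..real n} (birth A v \<omega>) \<partial>count_space UNIV) \<noteq> \<infinity>"
      by (intro nn_integral_noteq_infinite) (auto intro!: measurable_nn_integral_lists)
    thus ?thesis
    proof eventually_elim
      case (elim \<omega>)
      have "(\<integral>\<^sup>+v. indicator {..real n} (birth A v \<omega>) \<partial>count_space UNIV)
          = (\<integral>\<^sup>+v. indicator {v. birth A v \<omega> \<le> real n} v \<partial>count_space UNIV)"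
        by (intro nn_integral_cong) (simp add: indicator_def)
      also have "\<dots> = emeasure (count_space UNIV) {v. birth A v \<omega> \<le> real n}"
        by (rule nn_integral_indicator) simp
      finally have "(\<integral>\<^sup>+v. indicator {..real n} (birth A v \<omega>) \<partial>count_space UNIV) = emeasure (count_space UNIV) {v. birth A v \<omega> \<le> real n}" .
      thus ?case using elim by (auto simp: emeasure_count_space split: if_splits)
    qed
  qed
  hence "AE \<omega> in M. \<forall>n::nat. finite {v. birth A v \<omega> \<le> real n}" by (simp add: AE_all_countable)
  thus ?thesis
  proof eventually_elim
    case (elim \<omega>)
    show ?case
    proof
      fix t :: real
      obtain n :: nat where "t \<le> real n" using real_arch_simple by blast
      hence "{v. birth A v \<omega> \<le> t} \<subseteq> {v. birth A v \<omega> \<le> real n}" by auto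
      thus "finite {v. birth A v \<omega> \<le> t}" using elim finite_subset by blast
    qed
  qed
qed

section \<open>Decomposition of a fixed outcome into drift and fluctuation\<close>

definition regular :: "'a \<Rightarrow> bool" where
  "regular \<omega> \<longleftrightarrow> (\<forall>v. (\<forall>i. 0 < A v i \<omega>) \<and> strict_mono (\<lambda>i. A v i \<omega>) \<and> filterlim (\<lambda>i. A v i \<omega>) at_top sequentially)
     \<and> (\<forall>t. finite {v. birth A v \<omega> \<le> t})"

lemma AE_regular: "AE \<omega> in M. regular \<omega>"
  using AE_arrivals AE_locally_finite by eventually_elim (simp add: regular_def)

lemma regular_birth_nonneg: "regular \<omega> \<Longrightarrow> 0 \<le> birth A v \<omega>"
  by (induction v) (auto simp: regular_def intro: add_nonneg_nonneg less_imp_le)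

text \<open>Total time lived up to \<open>t\<close> by the members of \<open>V\<close>, equivalently
  the integral of their number: the compensator of the number of their children.\<close>

definition residual :: "nat list set \<Rightarrow> real \<Rightarrow> 'a \<Rightarrow> real" where
  "residual V t \<omega> = (\<Sum>v | v \<in> V \<and> birth A v \<omega> \<le> t. t - birth A v \<omega>)"

lemma card_children:
  assumes "regular \<omega>"
  shows "real (card {u. \<exists>v i. v \<in> V \<and> u = i # v \<and> birth A u \<omega> \<le> t}) = residual V t \<omega> + total_fluctuation V t \<omega>"
proof -
  let ?S = "{v. v \<in> V \<and> birth A v \<omega> \<le> t}"
  let ?C = "\<lambda>v. {i. 0 < A v i \<omega> \<and> A v i \<omega> \<le> t - birth A v \<omega>}"
  have fin: "finite {v. birth A v \<omega> \<le> t}" using assms by (simp add: regular_def)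
  have pos: "0 < A v i \<omega>" for v i using assms by (simp add: regular_def)
  have finC: "finite (?C v)" for v
  proof -
    have "?C v \<subseteq> (\<lambda>u. hd u) ` {u. birth A u \<omega> \<le> t}"
    proof
      fix i assume "i \<in> ?C v"
      hence "i # v \<in> {u. birth A u \<omega> \<le> t}" by auto
      thus "i \<in> hd ` {u. birth A u \<omega> \<le> t}" by (metis image_eqI list.sel(1))
    qed
    thus ?thesis using fin finite_surj by blast
  qed
  have "{u. \<exists>v i. v \<in> V \<and> u = i # v \<and> birth A u \<omega> \<le> t} = (\<lambda>(v, i). i # v) ` Sigma ?S ?C"
  proof (intro equalityI subsetI)
    fix u assume "u \<in> {u. \<exists>v i. v \<in> V \<and> u = i # v \<and> birth A u \<omega> \<le> t}"
    then obtain v i where u: "v \<in> V" "u = i # v" "birth A v \<omega> + A v i \<omega> \<le> t" by auto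
    hence "(v, i) \<in> Sigma ?S ?C" using pos[of v i] by auto
    thus "u \<in> (\<lambda>(v, i). i # v) ` Sigma ?S ?C" using u(2) by force
  qed auto
  moreover have "inj_on (\<lambda>(v, i). i # v) (Sigma ?S ?C)" by (auto simp: inj_on_def)
  ultimately have "card {u. \<exists>v i. v \<in> V \<and> u = i # v \<and> birth A u \<omega> \<le> t} = card (Sigma ?S ?C)"
    by (simp add: card_image)
  also have "\<dots> = (\<Sum>v\<in>?S. card (?C v))"
    using fin finC by (intro card_SigmaI) (auto elim: rev_finite_subset)
  also have "real \<dots> = (\<Sum>v\<in>?S. real (arrivals_upto (\<lambda>i. A v i \<omega>) (t - birth A v \<omega>)))"
    by (simp add: arrivals_upto_def)
  also have "\<dots> = (\<Sum>v\<in>?S. (t - birth A v \<omega>) + fluctuation v t \<omega>)"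
    by (intro sum.cong) (auto simp: fluctuation_def)
  finally show ?thesis
    using total_fluctuation_eq(1)[OF fin, of V] by (simp add: residual_def sum.distrib)
qed

definition level_count :: "nat \<Rightarrow> real \<Rightarrow> 'a \<Rightarrow> nat" where
  "level_count k t \<omega> = card {v. length v = k \<and> birth A v \<omega> \<le> t}"

definition total_count :: "real \<Rightarrow> 'a \<Rightarrow> nat" where
  "total_count t \<omega> = card {v. birth A v \<omega> \<le> t}"

lemma level_count_Suc:
  assumes "regular \<omega>"
  shows "real (level_count (Suc k) t \<omega>) = residual {v. length v = k} t \<omega> + total_fluctuation {v. length v = k} t \<omega>"
proof -
  have "{v. length v = Suc k \<and> birth A v \<omega> \<le> t} = {u. \<exists>v i. v \<in> {v. length v = k} \<and> u = i # v \<and> birth A u \<omega> \<le> t}"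
    by (auto simp: length_Suc_conv)
  thus ?thesis using card_children[OF assms, of "{v. length v = k}" t] by (simp add: level_count_def)
qed

lemma total_count_eq:
  assumes "regular \<omega>" "0 \<le> t"
  shows "real (total_count t \<omega>) = 1 + residual UNIV t \<omega> + total_fluctuation UNIV t \<omega>"
proof -
  let ?S = "{u. \<exists>v i. v \<in> UNIV \<and> u = i # v \<and> birth A u \<omega> \<le> t}"
  have eq: "{v. birth A v \<omega> \<le> t} = insert [] ?S"
  proof (intro equalityI subsetI)
    fix v assume "v \<in> {v. birth A v \<omega> \<le> t}"
    thus "v \<in> insert [] ?S" by (cases v) auto
  qed (use assms in auto)
  have "finite {v. birth A v \<omega> \<le> t}" using assms by (simp add: regular_def)
  hence "finite ?S" unfolding eq by simp
  hence "card {v. birth A v \<omega> \<le> t} = Suc (card ?S)" unfolding eq by (subst card_insert_disjoint) auto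
  thus ?thesis using card_children[OF assms(1), of UNIV t] by (simp add: total_count_def)
qed

lemma total_fluctuation_level_sq:
  assumes "0 \<le> t"
  shows "(\<integral>\<^sup>+\<omega>. ennreal ((total_fluctuation {v. length v = k} t \<omega>)\<^sup>2) \<partial>M) \<le> ennreal (t ^ Suc k / fact (Suc k))"
proof -
  have "AE \<omega> in M. finite {v. birth A v \<omega> \<le> t}" using AE_locally_finite by eventually_elim blast
  from total_fluctuation_sq_le[OF this] show ?thesis
    unfolding expected_level_size(2)[OF assms, of k, symmetric] .
qed

lemma total_fluctuation_UNIV_sq:
  assumes "0 \<le> t"
  shows "(\<integral>\<^sup>+\<omega>. ennreal ((total_fluctuation UNIV t \<omega>)\<^sup>2) \<partial>M) \<le> ennreal (exp t - 1)"
proof -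
  have "AE \<omega> in M. finite {v. birth A v \<omega> \<le> t}" using AE_locally_finite by eventually_elim blast
  from total_fluctuation_sq_le[OF this] show ?thesis
    unfolding expected_size(2)[OF assms, symmetric] .
qed

text \<open>At time j^2 the mean square is at most j^(2k+2), so comparison with j^(2e) is summable
  once \<open>e \<ge> k + 2\<close>. The precision wanted later, \<open>e = 2 * k + 1\<close>, is
  admissible only for \<open>k \<ge> 1\<close>; the weaker \<open>e = 2 * k + 2\<close> is
  admissible for every level and gives orders of magnitude.\<close>

lemma AE_total_fluctuation_squares:
  assumes "k + 2 \<le> e"
  shows "AE \<omega> in M. eventually (\<lambda>j. \<bar>total_fluctuation {v. length v = k} (real j ^ 2) \<omega>\<bar> \<le> real j ^ e) sequentially"
proof -
  let ?m = "\<lambda>j. total_fluctuation {v. length v = k} (real j ^ 2)"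
  have "AE \<omega> in M. eventually (\<lambda>j. (?m j \<omega>)\<^sup>2 < real j ^ (2 * e)) sequentially"
  proof (rule borel_cantelli_mean)
    show "(\<integral>\<^sup>+\<omega>. ennreal ((?m j \<omega>)\<^sup>2) \<partial>M) \<le> ennreal ((real j ^ 2) ^ Suc k / fact (Suc k))" for j
      by (rule total_fluctuation_level_sq) simp
    show "eventually (\<lambda>j. 0 < real j ^ (2 * e) \<and> (real j ^ 2) ^ Suc k / fact (Suc k) / real j ^ (2 * e) \<le> 1 / real j ^ 2) sequentially"
      using eventually_gt_at_top[of 0]
    proof eventually_elim
      case (elim j)
      have "(real j ^ 2) ^ Suc k / fact (Suc k) \<le> (real j ^ 2) ^ Suc k"
        using divide_left_mono[OF fact_ge_1[of "Suc k"], of "(real j ^ 2) ^ Suc k"] by (simp del: fact_Suc power_Suc)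
      hence "(real j ^ 2) ^ Suc k / fact (Suc k) / real j ^ (2 * e) \<le> (real j ^ 2) ^ Suc k / real j ^ (2 * e)"
        by (intro divide_right_mono) auto
      also have "\<dots> = real j ^ (2 * Suc k) / real j ^ (2 * e)" by (simp only: power_mult)
      also have "\<dots> \<le> real j ^ (2 * Suc k) / real j ^ (2 * Suc k + 2)"
        using elim assms by (intro divide_left_mono power_increasing) auto
      also have "\<dots> = 1 / real j ^ 2"
        unfolding power_add[of _ "2 * Suc k" 2] using elim by (simp del: mult_Suc_right)
      finally show ?case using elim by simp
    qed
  qed measurable
  thus ?thesis
  proof eventually_elim
    case (elim \<omega>)
    thus ?case
    proof eventually_elim
      case (elim j)
      hence "(?m j \<omega>)\<^sup>2 \<le> (real j ^ e)\<^sup>2" by (simp add: power_mult[symmetric] mult.commute)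
      thus ?case using power2_le_iff_abs_le[of "real j ^ e" "?m j \<omega>"] by simp
    qed
  qed
qed

end

section \<open>Level sizes at integer times\<close>

lemma eventually_bound_all:
  fixes f g :: "nat \<Rightarrow> real"
  assumes ev: "eventually (\<lambda>n. f n \<le> C * g n) sequentially" and g: "\<And>n. 1 \<le> n \<Longrightarrow> 0 < g n"
  shows "\<exists>C'\<ge>0. \<forall>n\<ge>1. f n \<le> C' * g n"
proof -
  obtain n0 where n0: "\<And>n. n \<ge> n0 \<Longrightarrow> f n \<le> C * g n" using ev by (auto simp: eventually_sequentially)
  define C' where "C' = \<bar>C\<bar> + (\<Sum>n<n0. \<bar>f n / g n\<bar>)"
  have "f n \<le> C' * g n" if "1 \<le> n" for n
  proof (cases "n < n0")
    case True
    have "\<bar>f n / g n\<bar> \<le> (\<Sum>n<n0. \<bar>f n / g n\<bar>)" using True by (intro member_le_sum) auto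
    hence "f n / g n \<le> C'" unfolding C'_def using abs_ge_self[of "f n / g n"] abs_ge_zero[of C] by linarith
    thus ?thesis using g[OF that] by (simp add: pos_divide_le_eq)
  next
    case False
    have "f n \<le> C * g n" using n0 False by simp
    also have "\<dots> \<le> C' * g n" unfolding C'_def using g[OF that]
      by (intro mult_right_mono) (auto intro!: add_increasing2 sum_nonneg)
    finally show ?thesis .
  qed
  moreover have "0 \<le> C'" unfolding C'_def by (intro add_nonneg_nonneg sum_nonneg) auto
  ultimately show ?thesis by blast
qed

text \<open>The squares around \<open>n\<close> are O(sqrt n) apart, so moving to them changes the
  integral of a count of order n^k by O(n^(k+1/2)), which is tolerable.\<close>

lemma square_bracket:
  assumes "1 \<le> (n :: nat)"
  obtains j :: nat where "real j ^ 2 \<le> real n" "real n \<le> real (Suc j) ^ 2" "real (Suc j) \<le> 2 * sqrt (real n)" "floor_sqrt n = j"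
proof
  let ?j = "floor_sqrt n"
  have "?j ^ 2 \<le> n" by simp
  thus 1: "real ?j ^ 2 \<le> real n" by (metis of_nat_le_iff of_nat_power)
  have "n < (Suc ?j) ^ 2" using Suc_floor_sqrt_power2_gt by blast
  thus "real n \<le> real (Suc ?j) ^ 2" by (metis less_imp_le of_nat_le_iff of_nat_power)
  have "real ?j \<le> sqrt (real n)" using 1 by (simp add: real_le_rsqrt)
  moreover have "1 \<le> sqrt (real n)" using assms by simp
  ultimately show "real (Suc ?j) \<le> 2 * sqrt (real n)" unfolding of_nat_Suc by linarith
qed simp

lemma floor_sqrt_at_top: "filterlim floor_sqrt at_top sequentially"
  unfolding filterlim_at_top
proof
  fix Z :: nat
  show "eventually (\<lambda>n. Z \<le> floor_sqrt n) sequentially"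
    using eventually_ge_at_top[of "Z ^ 2"] by eventually_elim (simp add: le_floor_sqrt_iff)
qed

context random_recursive_tree
begin

lemma level_count_mono:
  assumes "regular \<omega>" "s \<le> t"
  shows "level_count k s \<omega> \<le> level_count k t \<omega>"
proof -
  have "finite {v. birth A v \<omega> \<le> t}" using assms by (simp add: regular_def)
  thus ?thesis unfolding level_count_def using assms(2)
    by (intro card_mono) (auto elim: rev_finite_subset)
qed

lemma residual_diff:
  assumes "regular \<omega>" "s \<le> t"
  shows "residual V t \<omega> - residual V s \<omega> \<le> (t - s) * real (card {v\<in>V. birth A v \<omega> \<le> t})"
    and "(t - s) * real (card {v\<in>V. birth A v \<omega> \<le> s}) \<le> residual V t \<omega> - residual V s \<omega>"
proof -
  let ?T = "{v\<in>V. birth A v \<omega> \<le> t}" and ?S = "{v\<in>V. birth A v \<omega> \<le> s}"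
  have "finite {v. birth A v \<omega> \<le> t}" using assms by (simp add: regular_def)
  hence fin: "finite ?T" by (auto elim: rev_finite_subset)
  have sub: "?S \<subseteq> ?T" using assms(2) by auto
  have rs: "residual V s \<omega> = (\<Sum>v\<in>?T. max 0 (s - birth A v \<omega>))"
    unfolding residual_def using fin sub by (intro sum.mono_neutral_cong_left) auto
  have rt: "residual V t \<omega> = (\<Sum>v\<in>?T. t - birth A v \<omega>)" unfolding residual_def by simp
  have "residual V t \<omega> - residual V s \<omega> = (\<Sum>v\<in>?T. (t - birth A v \<omega>) - max 0 (s - birth A v \<omega>))"
    unfolding rs rt by (simp add: sum_subtractf)
  also have "\<dots> \<le> (\<Sum>v\<in>?T. t - s)" by (intro sum_mono) auto
  finally show "residual V t \<omega> - residual V s \<omega> \<le> (t - s) * real (card ?T)" by (simp add: mult.commute)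
  have "(t - s) * real (card ?S) = (\<Sum>v\<in>?S. t - s)" by (simp add: mult.commute)
  also have "\<dots> = (\<Sum>v\<in>?T. if v \<in> ?S then t - s else 0)"
    using fin sub by (intro sum.mono_neutral_cong_left) auto
  also have "\<dots> \<le> (\<Sum>v\<in>?T. (t - birth A v \<omega>) - max 0 (s - birth A v \<omega>))"
    by (intro sum_mono) auto
  also have "\<dots> = residual V t \<omega> - residual V s \<omega>" unfolding rs rt by (simp add: sum_subtractf)
  finally show "(t - s) * real (card ?S) \<le> residual V t \<omega> - residual V s \<omega>" .
qed

lemma residual_0:
  assumes "regular \<omega>" shows "residual V 0 \<omega> = 0"
  unfolding residual_def
  by (rule sum.neutral) (use regular_birth_nonneg[OF assms] in \<open>auto intro: antisym\<close>)

abbreviation level_fluct :: "nat \<Rightarrow> real \<Rightarrow> 'a \<Rightarrow> real" where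
  "level_fluct k \<equiv> total_fluctuation {v. length v = k}"

abbreviation level_resid :: "nat \<Rightarrow> real \<Rightarrow> 'a \<Rightarrow> real" where
  "level_resid k \<equiv> residual {v. length v = k}"

lemma level_resid_diff:
  assumes "regular \<omega>" "s \<le> t"
  shows "level_resid k t \<omega> - level_resid k s \<omega> \<le> (t - s) * real (level_count k t \<omega>)"
    and "(t - s) * real (level_count k s \<omega>) \<le> level_resid k t \<omega> - level_resid k s \<omega>"
  using residual_diff[OF assms, of "{v. length v = k}"] by (simp_all add: level_count_def)

text \<open>Induction over the level from the fluctuation bound with exponent
  \<open>2 * k + 2\<close>. Monotonicity moves \<open>n\<close> up to the next square, which is at
  most 4 n; hence the powers of 4.\<close>

lemma level_count_bigo:
  assumes reg: "regular \<omega>"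
    and fl: "\<And>k. eventually (\<lambda>j. \<bar>level_fluct k (real j ^ 2) \<omega>\<bar> \<le> real j ^ (2 * k + 2)) sequentially"
  shows "\<exists>C\<ge>0. \<forall>n\<ge>1. real (level_count k (real n) \<omega>) \<le> C * real n ^ k"
proof (induction k)
  case 0
  have "level_count 0 (real n) \<omega> = 1" for n
  proof -
    have *: "{v. length v = 0 \<and> birth A v \<omega> \<le> real n} = {[]}" by auto
    show ?thesis unfolding level_count_def * by simp
  qed
  thus ?case by (intro exI[of _ 1]) simp
next
  case (Suc k)
  then obtain C where C: "0 \<le> C" "\<And>n. 1 \<le> n \<Longrightarrow> real (level_count k (real n) \<omega>) \<le> C * real n ^ k" by blast
  have ev1: "eventually (\<lambda>j. \<bar>level_fluct k (real (Suc j) ^ 2) \<omega>\<bar> \<le> real (Suc j) ^ (2 * k + 2)) sequentially"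
    using eventually_sequentially_Suc[of "\<lambda>j. \<bar>level_fluct k (real j ^ 2) \<omega>\<bar> \<le> real j ^ (2 * k + 2)"] fl by blast
  have "eventually (\<lambda>n. real (level_count (Suc k) (real n) \<omega>) \<le> ((C + 1) * 4 ^ Suc k) * real n ^ Suc k) sequentially"
    using eventually_compose_filterlim[OF ev1 floor_sqrt_at_top] eventually_ge_at_top[of 1]
  proof eventually_elim
    case (elim n)
    obtain j where j: "real n \<le> real (Suc j) ^ 2" "real (Suc j) \<le> 2 * sqrt (real n)" "floor_sqrt n = j"
      using square_bracket[OF elim(2)] by metis
    let ?m = "(Suc j) ^ 2"
    have m: "real ?m = real (Suc j) ^ 2" by simp
    have m4: "real ?m \<le> 4 * real n"
      using power_mono[OF j(2), of 2] by (simp add: power_mult_distrib)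
    have "real (level_count (Suc k) (real n) \<omega>) \<le> real (level_count (Suc k) (real ?m) \<omega>)"
      using level_count_mono[OF reg, of "real n" "real ?m"] j(1) m by simp
    also have "\<dots> = level_resid k (real ?m) \<omega> + level_fluct k (real ?m) \<omega>"
      by (rule level_count_Suc[OF reg])
    also have "level_resid k (real ?m) \<omega> \<le> real ?m * real (level_count k (real ?m) \<omega>)"
      using level_resid_diff(1)[OF reg, of 0 "real ?m" k] residual_0[OF reg] by simp
    also have "\<dots> \<le> real ?m * (C * real ?m ^ k)"
      by (intro mult_left_mono C) auto
    also have "level_fluct k (real ?m) \<omega> \<le> real ?m ^ Suc k"
    proof -
      have "level_fluct k (real ?m) \<omega> \<le> real (Suc j) ^ (2 * k + 2)" using elim(1) j(3) unfolding m by simp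
      also have "\<dots> = real ?m ^ Suc k" unfolding m power_mult[symmetric] by simp
      finally show ?thesis .
    qed
    finally have "real (level_count (Suc k) (real n) \<omega>) \<le> (C + 1) * real ?m ^ Suc k"
      by (simp add: algebra_simps)
    also have "\<dots> \<le> (C + 1) * (4 * real n) ^ Suc k"
      using m4 C(1) by (intro mult_left_mono power_mono) auto
    finally show ?case by (simp only: power_mult_distrib mult.assoc)
  qed
  thus ?case by (rule eventually_bound_all) simp
qed

text \<open>Fluctuations are controlled at squares only. As the count and the residual time are both
  monotone, their difference inside a gap exceeds the fluctuations at its ends by at most the
  increase of the residual time across the gap.\<close>

lemma level_count_minus_resid:
  assumes reg: "regular \<omega>" and k: "1 \<le> k"
    and fl: "\<And>k. eventually (\<lambda>j. \<bar>level_fluct k (real j ^ 2) \<omega>\<bar> \<le> real j ^ (2 * k + 2)) sequentially"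
    and fl': "eventually (\<lambda>j. \<bar>level_fluct k (real j ^ 2) \<omega>\<bar> \<le> real j ^ (2 * k + 1)) sequentially"
  shows "\<exists>C\<ge>0. \<forall>n\<ge>1. \<bar>real (level_count (Suc k) (real n) \<omega>) - level_resid k (real n) \<omega>\<bar> \<le> C * (real n ^ k * sqrt (real n))"
proof -
  obtain C where C: "0 \<le> C" "\<And>n. 1 \<le> n \<Longrightarrow> real (level_count k (real n) \<omega>) \<le> C * real n ^ k"
    using level_count_bigo[OF reg fl, of k] by blast
  have ev1: "eventually (\<lambda>j. \<bar>level_fluct k (real (Suc j) ^ 2) \<omega>\<bar> \<le> real (Suc j) ^ (2 * k + 1)) sequentially"
    using eventually_sequentially_Suc[of "\<lambda>j. \<bar>level_fluct k (real j ^ 2) \<omega>\<bar> \<le> real j ^ (2 * k + 1)"] fl' by blast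
  have "eventually (\<lambda>n. \<bar>real (level_count (Suc k) (real n) \<omega>) - level_resid k (real n) \<omega>\<bar>
      \<le> ((1 + 2 * C) * 2 ^ (2 * k + 1)) * (real n ^ k * sqrt (real n))) sequentially"
    using eventually_compose_filterlim[OF ev1 floor_sqrt_at_top] eventually_compose_filterlim[OF fl' floor_sqrt_at_top]
      eventually_ge_at_top[of 1]
  proof eventually_elim
    case (elim n)
    obtain j where j: "real j ^ 2 \<le> real n" "real n \<le> real (Suc j) ^ 2" "real (Suc j) \<le> 2 * sqrt (real n)" "floor_sqrt n = j"
      using square_bracket[OF elim(3)] by metis
    let ?u = "real (Suc j) ^ 2" and ?l = "real j ^ 2"
    have lu: "?l \<le> ?u" using j by linarith
    have fu: "\<bar>level_fluct k ?u \<omega>\<bar> \<le> real (Suc j) ^ (2 * k + 1)" using elim(1) j(4) by simp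
    have "\<bar>level_fluct k ?l \<omega>\<bar> \<le> real j ^ (2 * k + 1)" using elim(2) j(4) by simp
    also have "\<dots> \<le> real (Suc j) ^ (2 * k + 1)" by (intro power_mono) auto
    finally have fl: "\<bar>level_fluct k ?l \<omega>\<bar> \<le> real (Suc j) ^ (2 * k + 1)" .
    \<comment> \<open>The length of the gap is at most 2 (j + 1), and the crude bound is applied to
      the count at its right end.\<close>
    have rd: "level_resid k ?u \<omega> - level_resid k ?l \<omega> \<le> 2 * C * real (Suc j) ^ (2 * k + 1)"
    proof -
      have "level_resid k ?u \<omega> - level_resid k ?l \<omega> \<le> (?u - ?l) * real (level_count k (real ((Suc j)\<^sup>2)) \<omega>)"
        using level_resid_diff(1)[OF reg lu, of k] by simp
      also have "\<dots> \<le> (?u - ?l) * (C * real ((Suc j)\<^sup>2) ^ k)"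
        using lu by (intro mult_left_mono C) auto
      also have "\<dots> = (?u - ?l) * (C * real (Suc j) ^ (2 * k))"
        by (simp only: of_nat_power power_mult)
      also have "\<dots> \<le> (2 * real (Suc j)) * (C * real (Suc j) ^ (2 * k))"
        using C(1) by (intro mult_right_mono mult_nonneg_nonneg) (auto simp: power2_eq_square algebra_simps)
      also have "\<dots> = 2 * C * real (Suc j) ^ (2 * k + 1)" by simp
      finally show ?thesis .
    qed
    have mono_r: "level_resid k ?l \<omega> \<le> level_resid k (real n) \<omega>" "level_resid k (real n) \<omega> \<le> level_resid k ?u \<omega>"
    proof -
      have "0 \<le> (real n - ?l) * real (level_count k ?l \<omega>)" "0 \<le> (?u - real n) * real (level_count k (real n) \<omega>)"
        using j by (auto intro!: mult_nonneg_nonneg)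
      thus "level_resid k ?l \<omega> \<le> level_resid k (real n) \<omega>" "level_resid k (real n) \<omega> \<le> level_resid k ?u \<omega>"
        using level_resid_diff(2)[OF reg j(1), of k] level_resid_diff(2)[OF reg j(2), of k] by linarith+
    qed
    have mono_c: "real (level_count (Suc k) ?l \<omega>) \<le> real (level_count (Suc k) (real n) \<omega>)"
        "real (level_count (Suc k) (real n) \<omega>) \<le> real (level_count (Suc k) ?u \<omega>)"
      using level_count_mono[OF reg j(1)] level_count_mono[OF reg j(2)] by simp_all
    have "\<bar>real (level_count (Suc k) (real n) \<omega>) - level_resid k (real n) \<omega>\<bar> \<le> (1 + 2 * C) * real (Suc j) ^ (2 * k + 1)"
      using mono_c mono_r rd fu fl level_count_Suc[OF reg, of k ?u] level_count_Suc[OF reg, of k ?l]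
      unfolding distrib_right mult_1_left by linarith
    also have "\<dots> \<le> (1 + 2 * C) * (2 * sqrt (real n)) ^ (2 * k + 1)"
      using j(3) C(1) by (intro mult_left_mono power_mono) auto
    also have "(2 * sqrt (real n)) ^ (2 * k + 1) = 2 ^ (2 * k + 1) * (real n ^ k * sqrt (real n))"
      by (simp add: power_mult_distrib power_mult)
    finally show ?case by (simp only: mult.assoc)
  qed
  thus ?thesis by (rule eventually_bound_all) simp
qed

definition root_increment :: "nat \<Rightarrow> 'a \<Rightarrow> real" where
  "root_increment i \<omega> = real (arrivals_between (A []) (real i) (real (Suc i)) \<omega>) - 1"

lemma level_count_1:
  assumes reg: "regular \<omega>"
  shows "real (level_count (Suc 0) (real n) \<omega>) = real n + (\<Sum>i<n. root_increment i \<omega>)"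
proof (induction n)
  case 0
  have *: "{v. length v = Suc 0 \<and> birth A v \<omega> \<le> 0} = {}"
    using reg by (auto simp: regular_def length_Suc_conv not_le)
  have "level_count (Suc 0) 0 \<omega> = 0" unfolding level_count_def * by simp
  thus ?case by simp
next
  case (Suc n)
  have pos: "0 < A [] i \<omega>" for i using reg by (simp add: regular_def)
  have img: "{v. length v = Suc 0 \<and> birth A v \<omega> \<le> t} = (\<lambda>i. [i]) ` {i. A [] i \<omega> \<le> t}" for t
    by (auto simp: length_Suc_conv)
  have lc: "level_count (Suc 0) t \<omega> = card {i. A [] i \<omega> \<le> t}" for t
    unfolding level_count_def img by (rule card_image) (auto simp: inj_on_def)
  have "finite ((\<lambda>i. [i]) ` {i. A [] i \<omega> \<le> t})" for t
    unfolding img[symmetric] using reg by (auto simp: regular_def elim: rev_finite_subset)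
  hence fin: "finite {i. A [] i \<omega> \<le> t}" for t
    by (rule finite_imageD) (auto simp: inj_on_def)
  have "{i. A [] i \<omega> \<le> real (Suc n)} = {i. A [] i \<omega> \<le> real n} \<union> {i. real n < A [] i \<omega> \<and> A [] i \<omega> \<le> real (Suc n)}"
    by auto
  hence "card {i. A [] i \<omega> \<le> real (Suc n)} = card {i. A [] i \<omega> \<le> real n} + card {i. real n < A [] i \<omega> \<and> A [] i \<omega> \<le> real (Suc n)}"
    using fin[of "real (Suc n)"] fin[of "real n"] by (subst card_Un_disjoint[symmetric]) (auto elim: rev_finite_subset)
  hence "real (level_count (Suc 0) (real (Suc n)) \<omega>) = real (level_count (Suc 0) (real n) \<omega>) + real (arrivals_between (A []) (real n) (real (Suc n)) \<omega>)"
    unfolding lc arrivals_between_def by (simp only: of_nat_add)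
  thus ?case using Suc by (simp add: root_increment_def)
qed

text \<open>The error is smaller than \<open>lil_norm k\<close> by a factor sqrt (log log n), so the
  iterated sum carries the entire law. Level 1 is exact; up to such errors each further level is the
  left Riemann sum of the level before.\<close>

lemma level_count_expansion:
  assumes reg: "regular \<omega>"
    and fl: "\<And>k. eventually (\<lambda>j. \<bar>level_fluct k (real j ^ 2) \<omega>\<bar> \<le> real j ^ (2 * k + 2)) sequentially"
    and fl': "\<And>k. 1 \<le> k \<Longrightarrow> eventually (\<lambda>j. \<bar>level_fluct k (real j ^ 2) \<omega>\<bar> \<le> real j ^ (2 * k + 1)) sequentially"
  shows "\<exists>C\<ge>0. \<forall>n\<ge>1. \<bar>real (level_count (Suc k) (real n) \<omega>) - real n ^ Suc k / fact (Suc k)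
      - iterated_sum (\<lambda>i. root_increment i \<omega>) k n\<bar> \<le> C * (real n ^ k * sqrt (real n))"
proof (induction k)
  case 0
  show ?case using level_count_1[OF reg] by (intro exI[of _ 0]) simp
next
  case (Suc k)
  let ?T = "iterated_sum (\<lambda>i. root_increment i \<omega>)"
  let ?Z = "\<lambda>k n. real (level_count k (real n) \<omega>)"
  obtain C1 where C1: "0 \<le> C1" "\<And>n. 1 \<le> n \<Longrightarrow> \<bar>?Z (Suc k) n - real n ^ Suc k / fact (Suc k) - ?T k n\<bar> \<le> C1 * (real n ^ k * sqrt (real n))"
    using Suc by blast
  obtain C2 where C2: "0 \<le> C2" "\<And>n. 1 \<le> n \<Longrightarrow> \<bar>?Z (Suc (Suc k)) n - level_resid (Suc k) (real n) \<omega>\<bar> \<le> C2 * (real n ^ Suc k * sqrt (real n))"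
    using level_count_minus_resid[OF reg _ fl fl', of "Suc k"] by auto
  obtain C3 where C3: "0 \<le> C3" "\<And>n. 1 \<le> n \<Longrightarrow> ?Z (Suc k) n \<le> C3 * real n ^ Suc k"
    using level_count_bigo[OF reg fl, of "Suc k"] by blast
  have Z0: "?Z (Suc k) 0 = 0"
  proof -
    have "\<not> birth A v \<omega> \<le> 0" if "length v = Suc k" for v
    proof -
      obtain i u where "v = i # u" using \<open>length v = Suc k\<close> by (auto simp: length_Suc_conv)
      moreover have "0 < A u i \<omega>" using reg by (simp add: regular_def)
      ultimately show ?thesis using regular_birth_nonneg[OF reg, of u] by simp
    qed
    hence *: "{v. length v = Suc k \<and> birth A v \<omega> \<le> real 0} = {}" by auto
    show ?thesis unfolding level_count_def * by simp
  qed
  have T0: "?T k 0 = 0" by (cases k) auto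
  show ?case
  proof (intro exI conjI allI impI)
    \<comment> \<open>In this order: the fluctuation of level \<open>Suc k\<close>, the passage from
      the residual time to a Riemann sum, the summed induction error, and the passage from the power
      sum to a power.\<close>
    show "0 \<le> C2 + C3 + C1 + 1" using C1 C2 C3 by simp
    fix n :: nat assume n: "1 \<le> n"
    have sq: "1 \<le> sqrt (real n)" using n by simp
    define G where "G = real n ^ Suc k * sqrt (real n)"
    have pG: "real n ^ Suc k \<le> G" unfolding G_def using mult_left_mono[OF sq, of "real n ^ Suc k"] by simp
    have a: "\<bar>?Z (Suc (Suc k)) n - level_resid (Suc k) (real n) \<omega>\<bar> \<le> C2 * G"
      unfolding G_def by (rule C2(2)[OF n])
    have rd: "?Z (Suc k) i \<le> level_resid (Suc k) (real (Suc i)) \<omega> - level_resid (Suc k) (real i) \<omega>"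
       "level_resid (Suc k) (real (Suc i)) \<omega> - level_resid (Suc k) (real i) \<omega> \<le> ?Z (Suc k) (Suc i)" for i
      using level_resid_diff[OF reg, of "real i" "real (Suc i)" "Suc k"] by auto
    have R: "level_resid (Suc k) (real n) \<omega> = (\<Sum>i<n. level_resid (Suc k) (real (Suc i)) \<omega> - level_resid (Suc k) (real i) \<omega>)"
      using sum_lessThan_telescope[of "\<lambda>i. level_resid (Suc k) (real i) \<omega>" n] residual_0[OF reg] by simp
    have "(\<Sum>i<n. ?Z (Suc k) i) \<le> level_resid (Suc k) (real n) \<omega>"
      unfolding R using rd(1) by (intro sum_mono) auto
    moreover have "level_resid (Suc k) (real n) \<omega> \<le> (\<Sum>i<n. ?Z (Suc k) (Suc i))"
      unfolding R using rd(2) by (intro sum_mono) auto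
    moreover have "(\<Sum>i<n. ?Z (Suc k) (Suc i)) = (\<Sum>i<n. ?Z (Suc k) i) + ?Z (Suc k) n"
      using sum_lessThan_telescope[of "\<lambda>i. ?Z (Suc k) i" n] Z0 by (simp add: sum_subtractf)
    moreover have "?Z (Suc k) n \<le> C3 * G"
      using C3(2)[OF n] mult_left_mono[OF pG C3(1)] by linarith
    ultimately have b: "\<bar>level_resid (Suc k) (real n) \<omega> - (\<Sum>i<n. ?Z (Suc k) i)\<bar> \<le> C3 * G" by linarith
    have "\<bar>\<Sum>i<n. ?Z (Suc k) i - real i ^ Suc k / fact (Suc k) - ?T k i\<bar> \<le> (\<Sum>i<n. \<bar>?Z (Suc k) i - real i ^ Suc k / fact (Suc k) - ?T k i\<bar>)"
      by (rule sum_abs)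
    also have "\<dots> \<le> (\<Sum>i<n. C1 * (real n ^ k * sqrt (real n)))"
    proof (rule sum_mono)
      fix i assume i: "i \<in> {..<n}"
      show "\<bar>?Z (Suc k) i - real i ^ Suc k / fact (Suc k) - ?T k i\<bar> \<le> C1 * (real n ^ k * sqrt (real n))"
      proof (cases "i = 0")
        case True
        thus ?thesis using Z0 T0 C1(1) by simp
      next
        case False
        hence "\<bar>?Z (Suc k) i - real i ^ Suc k / fact (Suc k) - ?T k i\<bar> \<le> C1 * (real i ^ k * sqrt (real i))"
          by (intro C1) auto
        also have "\<dots> \<le> C1 * (real n ^ k * sqrt (real n))"
          using i C1(1) by (intro mult_left_mono mult_mono power_mono) auto
        finally show ?thesis .
      qed
    qed
    also have "\<dots> = C1 * G" by (simp add: G_def)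
    finally have c: "\<bar>(\<Sum>i<n. ?Z (Suc k) i) - (\<Sum>i<n. real i ^ Suc k / fact (Suc k)) - ?T (Suc k) n\<bar> \<le> C1 * G"
      by (simp only: sum_subtractf iterated_sum.simps)
    have d: "\<bar>(\<Sum>i<n. real i ^ Suc k / fact (Suc k)) - real n ^ Suc (Suc k) / fact (Suc (Suc k))\<bar> \<le> G"
    proof -
      have f1: "(1::real) \<le> fact (Suc k)" by (rule fact_ge_1)
      have "(\<Sum>i<n. real i ^ Suc k / fact (Suc k)) = (\<Sum>i<n. real i ^ Suc k) / fact (Suc k)"
        by (rule sum_divide_distrib[symmetric])
      moreover have "real n ^ Suc (Suc k) / fact (Suc (Suc k)) = (real n ^ Suc (Suc k) / real (Suc (Suc k))) / fact (Suc k)"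
        by (simp only: fact_Suc[of "Suc k"] divide_divide_eq_left of_nat_id)
      ultimately have "\<bar>(\<Sum>i<n. real i ^ Suc k / fact (Suc k)) - real n ^ Suc (Suc k) / fact (Suc (Suc k))\<bar>
          = \<bar>(\<Sum>i<n. real i ^ Suc k) - real n ^ Suc (Suc k) / real (Suc (Suc k))\<bar> / fact (Suc k)"
        using f1 by (simp only: diff_divide_distrib[symmetric] abs_divide)
      also have "\<dots> \<le> \<bar>(\<Sum>i<n. real i ^ Suc k) - real n ^ Suc (Suc k) / real (Suc (Suc k))\<bar> / 1"
        using f1 by (intro divide_left_mono) auto
      also have "\<dots> \<le> real n ^ Suc k"
      proof -
        have "0 \<le> real n ^ Suc k" by simp
        thus ?thesis using sum_power_bounds(1)[where n = n and p = "Suc k"] sum_power_bounds(2)[where n = n and p = "Suc k"]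
          unfolding div_by_1 abs_le_iff by linarith
      qed
      finally show ?thesis using pG by linarith
    qed
    show "\<bar>?Z (Suc (Suc k)) n - real n ^ Suc (Suc k) / fact (Suc (Suc k)) - ?T (Suc k) n\<bar>
       \<le> (C2 + C3 + C1 + 1) * (real n ^ Suc k * sqrt (real n))"
      unfolding G_def[symmetric] distrib_right mult_1_left using a b c d by linarith
  qed
qed

lemma AE_level_count_expansion:
  "AE \<omega> in M. \<forall>k. \<exists>C\<ge>0. \<forall>n\<ge>1. \<bar>real (level_count (Suc k) (real n) \<omega>) - real n ^ Suc k / fact (Suc k)
      - iterated_sum (\<lambda>i. root_increment i \<omega>) k n\<bar> \<le> C * (real n ^ k * sqrt (real n))"
proof -
  have "AE \<omega> in M. \<forall>k. eventually (\<lambda>j. \<bar>level_fluct k (real j ^ 2) \<omega>\<bar> \<le> real j ^ (2 * k + 2)) sequentially"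
    unfolding AE_all_countable by (intro allI AE_total_fluctuation_squares) simp
  moreover have "AE \<omega> in M. \<forall>k. 1 \<le> k \<longrightarrow> eventually (\<lambda>j. \<bar>level_fluct k (real j ^ 2) \<omega>\<bar> \<le> real j ^ (2 * k + 1)) sequentially"
    unfolding AE_all_countable
  proof
    fix k
    show "AE \<omega> in M. 1 \<le> k \<longrightarrow> eventually (\<lambda>j. \<bar>level_fluct k (real j ^ 2) \<omega>\<bar> \<le> real j ^ (2 * k + 1)) sequentially"
    proof (cases "1 \<le> k")
      case True
      hence "k + 2 \<le> 2 * k + 1" by simp
      from AE_total_fluctuation_squares[OF this] show ?thesis by eventually_elim simp
    qed simp
  qed
  ultimately show ?thesis using AE_regular
  proof eventually_elim
    case (elim \<omega>)
    show ?case
      by (intro allI level_count_expansion) (use elim in auto)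
  qed
qed

end

section \<open>Exponential growth of the tree\<close>

lemma measurable_card_lists:
  assumes [measurable]: "\<And>v. Measurable.pred N (\<lambda>x. P v x)"
  shows "(\<lambda>x. real (card {v :: nat list. P v x})) \<in> borel_measurable N"
proof -
  have "card {v. P v x} = card {n. P (list_decode n) x}" for x
  proof -
    have "{v. P v x} = list_decode ` {n. P (list_decode n) x}"
      by (auto intro!: image_eqI[of _ list_decode "list_encode _"])
    thus ?thesis by (simp add: card_image inj_list_decode)
  qed
  thus ?thesis unfolding real_card_eq_enn2real of_bool_def by (simp only: real_card_eq_enn2real of_bool_def) measurable
qed

text \<open>Stated with countable quantifiers and as a function of the whole family of paths, so that it yields
  independent events for disjoint subtrees.\<close>

definition tree_growth :: "(nat list \<Rightarrow> nat \<Rightarrow> real) \<Rightarrow> bool" where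
  "tree_growth a \<longleftrightarrow> (\<exists>m::nat. \<exists>n0::nat. \<forall>n\<ge>n0. exp (real n) \<le> real m * (real n * real (card {v. path_sum a v \<le> real n})))"

lemma nn_integral_exp_half:
  assumes "0 \<le> a"
  shows "(\<integral>\<^sup>+s. ennreal (exp (- s / 2)) * indicator {a..} s \<partial>lborel) = ennreal (2 * exp (- a / 2))"
proof -
  have "(\<integral>\<^sup>+s. ennreal (exp (- s / 2)) * indicator {a..} s \<partial>lborel) = ennreal (0 - (- 2 * exp (- a / 2)))"
  proof (rule nn_integral_FTC_atLeast[where F = "\<lambda>s. - 2 * exp (- s / 2)"])
    show "((\<lambda>s. - 2 * exp (- s / 2)) has_real_derivative exp (- s / 2)) (at s)" for s :: real
      by (auto intro!: derivative_eq_intros)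
    show "((\<lambda>s::real. - 2 * exp (- s / 2)) \<longlongrightarrow> 0) at_top" by real_asymp
  qed auto
  thus ?thesis by simp
qed

section \<open>Second moment bounds for the growth\<close>

context random_recursive_tree
begin

text \<open>The derivative of \<open>exp (- t) * residual UNIV t\<close>, where \<open>residual UNIV\<close> is the integral of the
  total population size.\<close>

definition growth_density :: "real \<Rightarrow> 'a \<Rightarrow> real" where
  "growth_density s \<omega> = exp (- s) * (1 + total_fluctuation UNIV s \<omega>)"

lemma measurable_growth_density [measurable]:
  "(\<lambda>x. growth_density (fst x) (snd x)) \<in> borel_measurable (lborel \<Otimes>\<^sub>M M)"
proof -
  have [measurable]: "(\<lambda>x i. A v i (snd x)) \<in> measurable (lborel \<Otimes>\<^sub>M M) path_space" for v
    by (rule measurable_PiM_single') auto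
  have "(\<lambda>x. fluctuation v (fst x) (snd x)) \<in> borel_measurable (lborel \<Otimes>\<^sub>M M)" for v
    unfolding fluctuation_def by measurable
  thus ?thesis unfolding growth_density_def total_fluctuation_def by measurable
qed

lemma measurable_growth_density_swap [measurable]:
  "(\<lambda>x. growth_density (snd x) (fst x)) \<in> borel_measurable (M \<Otimes>\<^sub>M lborel)"
  using measurable_compose[OF measurable_pair_swap' measurable_growth_density]
  by (simp add: case_prod_unfold)

lemma measurable_growth_density2 [measurable]:
  "\<omega> \<in> space M \<Longrightarrow> (\<lambda>s. growth_density s \<omega>) \<in> borel_measurable lborel"
  "(\<lambda>\<omega>. growth_density s \<omega>) \<in> borel_measurable M"
  using measurable_compose[OF measurable_Pair2'[of \<omega> M lborel] measurable_growth_density]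
  unfolding growth_density_def by (simp_all add: o_def)

text \<open>Holds vertex by vertex: for a vertex born at \<open>b\<close>,
  \<open>exp (- s) * (s - b)\<close> is an antiderivative on \<open>{b..T}\<close>, and only
  finitely many vertices contribute.\<close>

lemma growth_density_integral:
  assumes reg: "regular \<omega>" and T: "0 \<le> T"
  shows "has_bochner_integral lborel (\<lambda>s. indicator {0..T} s * growth_density s \<omega>) (exp (- T) * residual UNIV T \<omega>)"
proof -
  let ?S = "{v. birth A v \<omega> \<le> T}"
  have fin: "finite ?S" using reg by (simp add: regular_def)
  have b0: "0 \<le> birth A v \<omega>" for v by (rule regular_birth_nonneg[OF reg])
  have one: "has_bochner_integral lborel (\<lambda>s. indicator {b..T} s *\<^sub>R (exp (- s) * (1 - (s - b)))) (exp (- T) * (T - b) - exp (- b) * (b - b))"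
    if "b \<le> T" for b :: real
  proof (rule has_bochner_integral_FTC_Icc[OF that])
    fix s :: real
    have "((\<lambda>s. exp (- s) * (s - b)) has_real_derivative (exp (- s) * (1 - (s - b)))) (at s within {b..T})"
      by (auto intro!: derivative_eq_intros simp: algebra_simps)
    thus "((\<lambda>s. exp (- s) * (s - b)) has_vector_derivative (exp (- s) * (1 - (s - b)))) (at s within {b..T})"
      by (simp add: has_real_derivative_iff_has_vector_derivative)
  qed (auto intro!: continuous_intros)
  have "has_bochner_integral lborel (\<lambda>s. \<Sum>v\<in>?S. indicator {birth A v \<omega>..T} s *\<^sub>R (exp (- s) * (1 - (s - birth A v \<omega>))))
      (\<Sum>v\<in>?S. exp (- T) * (T - birth A v \<omega>))"
    using one by (intro has_bochner_integral_sum) auto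
  also have "(\<Sum>v\<in>?S. exp (- T) * (T - birth A v \<omega>)) = exp (- T) * residual UNIV T \<omega>"
    by (simp add: residual_def sum_distrib_left)
  also have "(\<lambda>s. \<Sum>v\<in>?S. indicator {birth A v \<omega>..T} s *\<^sub>R (exp (- s) * (1 - (s - birth A v \<omega>)))) = (\<lambda>s. indicator {0..T} s * growth_density s \<omega>)"
  proof
    fix s
    show "(\<Sum>v\<in>?S. indicator {birth A v \<omega>..T} s *\<^sub>R (exp (- s) * (1 - (s - birth A v \<omega>)))) = indicator {0..T} s * growth_density s \<omega>"
    proof (cases "0 \<le> s \<and> s \<le> T")
      case True
      have "1 + total_fluctuation UNIV s \<omega> = real (total_count s \<omega>) - residual UNIV s \<omega>"
        using total_count_eq[OF reg, of s] True by simp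
      also have "real (total_count s \<omega>) = (\<Sum>v | birth A v \<omega> \<le> s. 1)" by (simp add: total_count_def)
      also have "\<dots> - residual UNIV s \<omega> = (\<Sum>v | birth A v \<omega> \<le> s. 1 - (s - birth A v \<omega>))"
        by (simp add: residual_def sum_subtractf)
      finally have "growth_density s \<omega> = (\<Sum>v | birth A v \<omega> \<le> s. exp (- s) * (1 - (s - birth A v \<omega>)))"
        by (simp add: growth_density_def sum_distrib_left)
      also have "\<dots> = (\<Sum>v\<in>?S. indicator {birth A v \<omega>..T} s *\<^sub>R (exp (- s) * (1 - (s - birth A v \<omega>))))"
        using fin True by (intro sum.mono_neutral_cong_left) auto
      finally show ?thesis using True by simp
    next
      case False
      have z: "indicator {birth A v \<omega>..T} s = (0::real)" for v using False b0[of v] by (auto simp: indicator_def)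
      show ?thesis unfolding z using False by (simp add: indicator_def)
    qed
  qed
  finally show ?thesis .
qed

lemma growth_density_moments:
  assumes "0 \<le> s"
  shows "(\<integral>\<^sup>+\<omega>. ennreal ((growth_density s \<omega>)\<^sup>2) \<partial>M) \<le> ennreal (2 * exp (- s))"
    and "(\<integral>\<^sup>+\<omega>. ennreal \<bar>growth_density s \<omega>\<bar> \<partial>M) \<le> ennreal (2 * exp (- s / 2))"
proof -
  let ?m = "total_fluctuation UNIV s"
  have "(\<integral>\<^sup>+\<omega>. ennreal ((growth_density s \<omega>)\<^sup>2) \<partial>M) \<le> (\<integral>\<^sup>+\<omega>. ennreal (2 * exp (- 2 * s)) + ennreal (2 * exp (- 2 * s)) * ennreal ((?m \<omega>)\<^sup>2) \<partial>M)"
  proof (rule nn_integral_mono)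
    fix \<omega>
    have "(1 + ?m \<omega>)\<^sup>2 \<le> 2 + 2 * (?m \<omega>)\<^sup>2"
      using zero_le_power2[of "1 - ?m \<omega>"] unfolding power2_eq_square by (simp add: algebra_simps)
    hence "exp (- 2 * s) * (1 + ?m \<omega>)\<^sup>2 \<le> exp (- 2 * s) * (2 + 2 * (?m \<omega>)\<^sup>2)" by (intro mult_left_mono) auto
    moreover have "(growth_density s \<omega>)\<^sup>2 = exp (- 2 * s) * (1 + ?m \<omega>)\<^sup>2"
      by (simp add: growth_density_def power_mult_distrib power2_eq_square[of "exp _"] exp_add[symmetric])
    ultimately have "ennreal ((growth_density s \<omega>)\<^sup>2) \<le> ennreal (2 * exp (- 2 * s) + 2 * exp (- 2 * s) * (?m \<omega>)\<^sup>2)"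
      by (intro ennreal_leI) (simp add: algebra_simps)
    thus "ennreal ((growth_density s \<omega>)\<^sup>2) \<le> ennreal (2 * exp (- 2 * s)) + ennreal (2 * exp (- 2 * s)) * ennreal ((?m \<omega>)\<^sup>2)"
      by (simp add: ennreal_plus ennreal_mult)
  qed
  also have "\<dots> = ennreal (2 * exp (- 2 * s)) + ennreal (2 * exp (- 2 * s)) * (\<integral>\<^sup>+\<omega>. ennreal ((?m \<omega>)\<^sup>2) \<partial>M)"
    by (simp add: nn_integral_add nn_integral_cmult emeasure_space_1)
  also have "\<dots> \<le> ennreal (2 * exp (- 2 * s)) + ennreal (2 * exp (- 2 * s)) * ennreal (exp s - 1)"
    by (intro add_left_mono mult_left_mono total_fluctuation_UNIV_sq assms) auto
  also have "\<dots> = ennreal (2 * exp (- 2 * s) + 2 * exp (- 2 * s) * (exp s - 1))"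
    using assms by (subst ennreal_plus) (auto simp: ennreal_mult)
  also have "2 * exp (- 2 * s) + 2 * exp (- 2 * s) * (exp s - 1) = 2 * exp (- s)"
    by (simp add: algebra_simps exp_add[symmetric])
  finally show 1: "(\<integral>\<^sup>+\<omega>. ennreal ((growth_density s \<omega>)\<^sup>2) \<partial>M) \<le> ennreal (2 * exp (- s))" .
  have "(\<integral>\<^sup>+\<omega>. ennreal \<bar>growth_density s \<omega>\<bar> \<partial>M) \<le> (\<integral>\<^sup>+\<omega>. ennreal (exp (- s / 2)) + ennreal (exp (s / 2) / 2) * ennreal ((growth_density s \<omega>)\<^sup>2) \<partial>M)"
  proof (rule nn_integral_mono)
    fix \<omega>
    let ?x = "\<bar>growth_density s \<omega>\<bar>" and ?c = "exp (s / 2)"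
    \<comment> \<open>The weight \<open>exp (s / 2)\<close> balances the two sides of the
      arithmetic-geometric inequality, which stands in for Cauchy-Schwarz.\<close>
    have "0 \<le> (?c * ?x - 1)\<^sup>2" by simp
    hence "2 * ?c * ?x \<le> 1 + ?c * ?c * ?x\<^sup>2" by (simp add: power2_eq_square algebra_simps)
    hence "2 * ?x \<le> (1 + ?c * ?c * ?x\<^sup>2) / ?c" by (simp add: pos_le_divide_eq mult_ac)
    also have "\<dots> = exp (- s / 2) + ?c * (growth_density s \<omega>)\<^sup>2"
      by (simp add: add_divide_distrib exp_minus inverse_eq_divide)
    finally have "2 * ?x \<le> exp (- s / 2) + ?c * (growth_density s \<omega>)\<^sup>2" .
    hence "?x \<le> exp (- s / 2) / 2 + ?c / 2 * (growth_density s \<omega>)\<^sup>2" by simp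
    also have "\<dots> \<le> exp (- s / 2) + ?c / 2 * (growth_density s \<omega>)\<^sup>2" by simp
    finally have le: "ennreal ?x \<le> ennreal (exp (- s / 2) + ?c / 2 * (growth_density s \<omega>)\<^sup>2)" by (rule ennreal_leI)
    show "ennreal ?x \<le> ennreal (exp (- s / 2)) + ennreal (exp (s / 2) / 2) * ennreal ((growth_density s \<omega>)\<^sup>2)"
    proof -
      note le
      also have "\<dots> = ennreal (exp (- s / 2)) + ennreal (?c / 2 * (growth_density s \<omega>)\<^sup>2)" by (rule ennreal_plus) auto
      also have "ennreal (?c / 2 * (growth_density s \<omega>)\<^sup>2) = ennreal (?c / 2) * ennreal ((growth_density s \<omega>)\<^sup>2)" by (rule ennreal_mult) auto
      finally show ?thesis .
    qed
  qed
  also have "\<dots> = ennreal (exp (- s / 2)) + ennreal (exp (s / 2) / 2) * (\<integral>\<^sup>+\<omega>. ennreal ((growth_density s \<omega>)\<^sup>2) \<partial>M)"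
    by (simp add: nn_integral_add nn_integral_cmult emeasure_space_1)
  also have "\<dots> \<le> ennreal (exp (- s / 2)) + ennreal (exp (s / 2) / 2) * ennreal (2 * exp (- s))"
    by (intro add_left_mono mult_left_mono 1) auto
  also have "\<dots> = ennreal (exp (- s / 2) + exp (s / 2) / 2 * (2 * exp (- s)))"
    by (subst ennreal_mult[symmetric], simp, simp, subst ennreal_plus[symmetric]) simp_all
  also have "exp (- s / 2) + exp (s / 2) / 2 * (2 * exp (- s)) = 2 * exp (- s / 2)"
    by (simp add: exp_add[symmetric])
  finally show "(\<integral>\<^sup>+\<omega>. ennreal \<bar>growth_density s \<omega>\<bar> \<partial>M) \<le> ennreal (2 * exp (- s / 2))" .
qed

text \<open>At \<open>a = 0\<close> this is integrability of the density over all times; for large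
  \<open>a\<close> it bounds what the integral up to \<open>a\<close> still misses.\<close>

lemma growth_density_tail:
  assumes "0 \<le> a"
  shows "(\<integral>\<^sup>+\<omega>. (\<integral>\<^sup>+s. ennreal \<bar>growth_density s \<omega>\<bar> * indicator {a..} s \<partial>lborel) \<partial>M) \<le> ennreal (4 * exp (- a / 2))"
proof -
  interpret pair_sigma_finite lborel M ..
  have "(\<integral>\<^sup>+\<omega>. (\<integral>\<^sup>+s. ennreal \<bar>growth_density s \<omega>\<bar> * indicator {a..} s \<partial>lborel) \<partial>M)
    = (\<integral>\<^sup>+s. (\<integral>\<^sup>+\<omega>. ennreal \<bar>growth_density s \<omega>\<bar> * indicator {a..} s \<partial>M) \<partial>lborel)"
    by (rule Fubini') (simp add: case_prod_unfold)
  also have "\<dots> \<le> (\<integral>\<^sup>+s. ennreal 2 * (ennreal (exp (- s / 2)) * indicator {a..} s) \<partial>lborel)"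
  proof (rule nn_integral_mono)
    fix s
    show "(\<integral>\<^sup>+\<omega>. ennreal \<bar>growth_density s \<omega>\<bar> * indicator {a..} s \<partial>M) \<le> ennreal 2 * (ennreal (exp (- s / 2)) * indicator {a..} s)"
    proof (cases "s \<in> {a..}")
      case True
      hence "0 \<le> s" using assms by simp
      from growth_density_moments(2)[OF this] show ?thesis using True by (simp add: ennreal_mult)
    qed simp
  qed
  also have "\<dots> = ennreal 2 * ennreal (2 * exp (- a / 2))"
    by (subst nn_integral_cmult) (simp_all only: nn_integral_exp_half[OF assms], measurable)
  also have "\<dots> = ennreal (2 * (2 * exp (- a / 2)))" by (rule ennreal_mult[symmetric]) auto
  also have "2 * (2 * exp (- a / 2)) = 4 * exp (- a / 2)" by simp
  finally show ?thesis .
qed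

lemma growth_density_weighted_sq:
  "(\<integral>\<^sup>+\<omega>. (\<integral>\<^sup>+s. ennreal (exp (s / 2) / 16 * (growth_density s \<omega>)\<^sup>2) * indicator {0..} s \<partial>lborel) \<partial>M) \<le> ennreal (1 / 4)"
proof -
  interpret pair_sigma_finite lborel M ..
  have "(\<integral>\<^sup>+\<omega>. (\<integral>\<^sup>+s. ennreal (exp (s / 2) / 16 * (growth_density s \<omega>)\<^sup>2) * indicator {0..} s \<partial>lborel) \<partial>M)
    = (\<integral>\<^sup>+s. (\<integral>\<^sup>+\<omega>. ennreal (exp (s / 2) / 16 * (growth_density s \<omega>)\<^sup>2) * indicator {0..} s \<partial>M) \<partial>lborel)"
    by (rule Fubini') (simp add: case_prod_unfold)
  also have "\<dots> \<le> (\<integral>\<^sup>+s. ennreal (1 / 8) * (ennreal (exp (- s / 2)) * indicator {0..} s) \<partial>lborel)"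
  proof (rule nn_integral_mono)
    fix s :: real
    show "(\<integral>\<^sup>+\<omega>. ennreal (exp (s / 2) / 16 * (growth_density s \<omega>)\<^sup>2) * indicator {0..} s \<partial>M) \<le> ennreal (1 / 8) * (ennreal (exp (- s / 2)) * indicator {0..} s)"
    proof (cases "s \<in> {0..}")
      case True
      have "(\<integral>\<^sup>+\<omega>. ennreal (exp (s / 2) / 16 * (growth_density s \<omega>)\<^sup>2) \<partial>M) = ennreal (exp (s / 2) / 16) * (\<integral>\<^sup>+\<omega>. ennreal ((growth_density s \<omega>)\<^sup>2) \<partial>M)"
      proof -
        have e: "ennreal (exp (s / 2) / 16 * (growth_density s \<omega>)\<^sup>2) = ennreal (exp (s / 2) / 16) * ennreal ((growth_density s \<omega>)\<^sup>2)" for \<omega>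
          by (rule ennreal_mult) auto
        show ?thesis unfolding e by (rule nn_integral_cmult) measurable
      qed
      also have "\<dots> \<le> ennreal (exp (s / 2) / 16) * ennreal (2 * exp (- s))"
        using True by (intro mult_left_mono growth_density_moments) auto
      also have "\<dots> = ennreal (exp (s / 2) / 16 * (2 * exp (- s)))" by (rule ennreal_mult[symmetric]) auto
      also have "exp (s / 2) / 16 * (2 * exp (- s)) = 1 / 8 * exp (- s / 2)" by (simp add: exp_add[symmetric])
      also have "ennreal (1 / 8 * exp (- s / 2)) = ennreal (1 / 8) * ennreal (exp (- s / 2))" by (rule ennreal_mult) auto
      finally show ?thesis using True by simp
    qed simp
  qed
  also have "\<dots> = ennreal (1 / 8) * ennreal (2 * exp (- 0 / 2))"
    by (subst nn_integral_cmult) (simp_all only: nn_integral_exp_half[OF order_refl], measurable)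
  also have "\<dots> = ennreal (1 / 8 * (2 * exp (- 0 / 2)))" by (rule ennreal_mult[symmetric]) auto
  finally show ?thesis by simp
qed

text \<open>Let \<open>W\<close> be the integral of the density \<open>h\<close> over \<open>{0..}\<close>, and let \<open>D\<close> be the growth event, which
  contains \<open>{W > 0}\<close>.  Since \<open>\<bar>h s\<bar> \<le> 4 exp (- s / 2) + exp (s / 2) / 16 * (h s)\<^sup>2\<close>, the mean of \<open>W\<close>, which
  is 1, is at most \<open>8 P(D) + 1 / 4\<close>.\<close>

lemma prob_tree_growth:
  assumes [measurable]: "{\<omega>\<in>space M. tree_growth (\<lambda>v i. A v i \<omega>)} \<in> sets M"
  shows "1 / 16 \<le> prob {\<omega>\<in>space M. tree_growth (\<lambda>v i. A v i \<omega>)}"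
proof -
  define D where "D = {\<omega>\<in>space M. tree_growth (\<lambda>v i. A v i \<omega>)}"
  have [measurable]: "D \<in> sets M" unfolding D_def by measurable
  define Q where "Q \<omega> = (\<integral>\<^sup>+s. ennreal (exp (s / 2) / 16 * (growth_density s \<omega>)\<^sup>2) * indicator {0..} s \<partial>lborel)" for \<omega>
  define R where "R n \<omega> = (\<integral>\<^sup>+s. ennreal \<bar>growth_density s \<omega>\<bar> * indicator {real n..} s \<partial>lborel)" for n :: nat and \<omega>
  have Rm: "R n \<in> borel_measurable M" for n
  proof -
    have "(\<lambda>x. ennreal \<bar>growth_density (snd x) (fst x)\<bar> * indicator {real n..} (snd x)) \<in> borel_measurable (M \<Otimes>\<^sub>M lborel)"
      by (intro borel_measurable_times_ennreal measurable_compose[OF measurable_snd borel_measurable_indicator]) measurable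
    thus ?thesis unfolding R_def by (intro lborel.borel_measurable_nn_integral) (simp only: case_prod_unfold)
  qed
  have Qm: "Q \<in> borel_measurable M"
  proof -
    have "(\<lambda>x. ennreal (exp (snd x / 2) / 16 * (growth_density (snd x) (fst x))\<^sup>2) * indicator {0..} (snd x)) \<in> borel_measurable (M \<Otimes>\<^sub>M lborel)"
      by (intro borel_measurable_times_ennreal measurable_compose[OF measurable_snd borel_measurable_indicator]) measurable
    thus ?thesis unfolding Q_def by (intro lborel.borel_measurable_nn_integral) (simp only: case_prod_unfold)
  qed
  have "(\<integral>\<^sup>+\<omega>. R 0 \<omega> \<partial>M) \<le> ennreal (4 * exp (- real 0 / 2))" unfolding R_def by (rule growth_density_tail) simp
  hence "(\<integral>\<^sup>+\<omega>. R 0 \<omega> \<partial>M) \<noteq> \<infinity>" by (auto simp: top_unique)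
  from nn_integral_PInf_AE[OF Rm this] have finR: "AE \<omega> in M. R 0 \<omega> \<noteq> \<infinity>" .
  \<comment> \<open>The mean estimate in pointwise form at a finite time \<open>n\<close>: for
    \<open>W > 0\<close> the outcome lies in \<open>D\<close>; for \<open>W = 0\<close> the value at
    \<open>n\<close> is minus the tail of the integral, hence at most \<open>R n\<close>.\<close>
  have key: "ennreal (exp (- real n) * residual UNIV (real n) \<omega>) \<le> 8 * indicator D \<omega> + Q \<omega> + R n \<omega>"
    if reg: "regular \<omega>" and fin: "R 0 \<omega> \<noteq> \<infinity>" and sp: "\<omega> \<in> space M" for n \<omega>
  proof -
    let ?h = "\<lambda>s. growth_density s \<omega>"
    have hm[measurable]: "?h \<in> borel_measurable lborel" by (rule measurable_growth_density2(1)[OF sp])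
    define G where "G n = exp (- real n) * residual UNIV (real n) \<omega>" for n :: nat
    have Gint: "has_bochner_integral lborel (\<lambda>s. indicator {0..real n} s * ?h s) (G n)" for n
      unfolding G_def by (rule growth_density_integral[OF reg]) simp
    have int0: "integrable lborel (\<lambda>s. indicator {0..} s * ?h s)"
    proof (rule integrableI_bounded)
      have "(\<integral>\<^sup>+s. ennreal (norm (indicator {0..} s * ?h s)) \<partial>lborel) = R 0 \<omega>"
        unfolding R_def by (intro nn_integral_cong) (auto simp: indicator_def)
      thus "(\<integral>\<^sup>+s. ennreal (norm (indicator {0..} s * ?h s)) \<partial>lborel) < \<infinity>" using fin by (simp add: less_top)
    qed measurable
    define W where "W = (\<integral>s. indicator {0..} s * ?h s \<partial>lborel)"
    have lim: "G \<longlonglongrightarrow> W"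
    proof -
      have "(\<lambda>n. \<integral>s. indicator {0..real n} s * ?h s \<partial>lborel) \<longlonglongrightarrow> W" unfolding W_def
      proof (rule integral_dominated_convergence[where w = "\<lambda>s. norm (indicator {0..} s * ?h s)"])
        show "integrable lborel (\<lambda>s. norm (indicator {0..} s * ?h s))" using int0 by (rule integrable_norm)
        show "AE s in lborel. (\<lambda>n. indicator {0..real n} s * ?h s) \<longlonglongrightarrow> indicator {0..} s * ?h s"
        proof (rule AE_I2)
          fix s :: real
          obtain n0 :: nat where "s \<le> real n0" using real_arch_simple by blast
          have "eventually (\<lambda>n. indicator {0..real n} s * ?h s = indicator {0..} s * ?h s) sequentially"
            using eventually_ge_at_top[of n0]
          proof eventually_elim
            case (elim n)
            hence "s \<le> real n" using \<open>s \<le> real n0\<close> by linarith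
            thus ?case by (simp add: indicator_def)
          qed
          thus "(\<lambda>n. indicator {0..real n} s * ?h s) \<longlonglongrightarrow> indicator {0..} s * ?h s" by (rule tendsto_eventually)
        qed
        show "AE s in lborel. norm (indicator {0..real n} s * ?h s) \<le> norm (indicator {0..} s * ?h s)" for n
          by (auto simp: indicator_def)
      qed measurable
      moreover have "(\<integral>s. indicator {0..real n} s * ?h s \<partial>lborel) = G n" for n
        by (rule has_bochner_integral_integral_eq[OF Gint])
      ultimately show ?thesis by simp
    qed
    have res0: "0 \<le> residual UNIV t \<omega>" for t unfolding residual_def by (intro sum_nonneg) auto
    hence G0: "0 \<le> G n" for n by (simp add: G_def)
    hence W0: "0 \<le> W" using lim by (intro LIMSEQ_le_const) auto
    show ?thesis
    proof (cases "0 < W")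
      case True
      have "eventually (\<lambda>n. W / 2 < G n) sequentially" using True by (intro order_tendstoD(1)[OF lim]) simp
      then obtain n0 where n0: "\<And>n. n \<ge> n0 \<Longrightarrow> W / 2 < G n" by (auto simp: eventually_sequentially)
      obtain m :: nat where m: "2 / W \<le> real m" using real_arch_simple by blast
      have "exp (real n) \<le> real m * (real n * real (card {v. path_sum (\<lambda>v i. A v i \<omega>) v \<le> real n}))" if "n \<ge> n0" for n
      proof -
        \<comment> \<open>The residual time is at most \<open>n\<close> times the population, which
          is why \<open>tree_growth\<close> contains the factor \<open>real n\<close>.\<close>
        have "residual UNIV (real n) \<omega> \<le> real n * real (card {v. birth A v \<omega> \<le> real n})"
          using residual_diff(1)[OF reg, of 0 "real n" UNIV] residual_0[OF reg] by simp
        hence "2 / W * residual UNIV (real n) \<omega> \<le> real m * (real n * real (card {v. birth A v \<omega> \<le> real n}))"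
          by (rule mult_mono[OF m]) (use res0 in auto)
        moreover have "residual UNIV (real n) \<omega> = G n * exp (real n)" by (simp add: G_def exp_minus)
        ultimately have "2 / W * (G n * exp (real n)) \<le> real m * (real n * real (card {v. birth A v \<omega> \<le> real n}))" by simp
        moreover have "exp (real n) \<le> 2 / W * (G n * exp (real n))"
        proof -
          have "1 \<le> 2 / W * G n" using n0[OF that] True by (simp add: field_simps)
          from mult_right_mono[OF this, of "exp (real n)"] show ?thesis by (simp add: mult.assoc)
        qed
        ultimately show ?thesis by (simp add: birth_eq_path_sum)
      qed
      hence "\<omega> \<in> D" unfolding D_def tree_growth_def using sp by auto
      have "ennreal (G n) \<le> (\<integral>\<^sup>+s. (ennreal 4 * (ennreal (exp (- s / 2)) * indicator {0..} s) + ennreal (exp (s / 2) / 16 * (?h s)\<^sup>2) * indicator {0..} s) \<partial>lborel)"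
      proof -
        have "ennreal (G n) = ennreal \<bar>\<integral>s. indicator {0..real n} s * ?h s \<partial>lborel\<bar>"
          using has_bochner_integral_integral_eq[OF Gint] G0 by simp
        also have "\<dots> \<le> (\<integral>\<^sup>+s. ennreal (norm (indicator {0..real n} s * ?h s)) \<partial>lborel)"
          using integral_norm_bound_ennreal[OF integrable.intros[OF Gint[of n]]] by simp
        also have "\<dots> \<le> (\<integral>\<^sup>+s. (ennreal 4 * (ennreal (exp (- s / 2)) * indicator {0..} s) + ennreal (exp (s / 2) / 16 * (?h s)\<^sup>2) * indicator {0..} s) \<partial>lborel)"
        proof (rule nn_integral_mono)
          fix s :: real
          show "ennreal (norm (indicator {0..real n} s * ?h s)) \<le> ennreal 4 * (ennreal (exp (- s / 2)) * indicator {0..} s) + ennreal (exp (s / 2) / 16 * (?h s)\<^sup>2) * indicator {0..} s"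
          proof (cases "0 \<le> s \<and> s \<le> real n")
            case True
            let ?c = "exp (s / 2)"
            \<comment> \<open>The constant 8 splits the density so that the deterministic part
              \<open>4 * exp (- s / 2)\<close> integrates to 8 and the square gets the weight 1/16,
              with mean at most 1/4 after integration.\<close>
            have "0 \<le> (8 - ?c * \<bar>?h s\<bar>)\<^sup>2" by simp
            hence "16 * ?c * \<bar>?h s\<bar> \<le> 64 + ?c * ?c * (?h s)\<^sup>2" by (simp add: power2_eq_square algebra_simps)
            hence "16 * \<bar>?h s\<bar> \<le> (64 + ?c * ?c * (?h s)\<^sup>2) / ?c" by (simp add: pos_le_divide_eq mult_ac)
            also have "\<dots> = 64 * exp (- s / 2) + ?c * (?h s)\<^sup>2"
              by (simp add: add_divide_distrib exp_minus inverse_eq_divide)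
            finally have "\<bar>?h s\<bar> \<le> 4 * exp (- s / 2) + ?c / 16 * (?h s)\<^sup>2" by simp
            hence "ennreal \<bar>?h s\<bar> \<le> ennreal (4 * exp (- s / 2) + ?c / 16 * (?h s)\<^sup>2)" by (rule ennreal_leI)
            also have "\<dots> = ennreal (4 * exp (- s / 2)) + ennreal (?c / 16 * (?h s)\<^sup>2)" by (rule ennreal_plus) auto
            also have "ennreal (4 * exp (- s / 2)) = ennreal 4 * ennreal (exp (- s / 2))" by (rule ennreal_mult) auto
            finally show ?thesis using True by simp
          qed (auto simp: indicator_def)
        qed
        finally show ?thesis .
      qed
      also have "\<dots> = ennreal 4 * ennreal (2 * exp (- 0 / 2)) + Q \<omega>"
        unfolding Q_def nn_integral_exp_half[OF order_refl, symmetric]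
        by (subst nn_integral_add) (simp_all add: nn_integral_cmult)
      also have "ennreal 4 * ennreal (2 * exp (- 0 / 2)) = 8"
        by (subst ennreal_mult[symmetric]) auto
      finally have "ennreal (G n) \<le> 8 + Q \<omega>" .
      also have "\<dots> \<le> 8 * indicator D \<omega> + Q \<omega> + R n \<omega>" using \<open>\<omega> \<in> D\<close> by simp
      finally show ?thesis by (simp add: G_def)
    next
      case False
      hence "W = 0" using W0 by simp
      have i2: "integrable lborel (\<lambda>s. indicator {real n<..} s * ?h s)"
      proof (rule Bochner_Integration.integrable_bound[OF int0])
        show "AE s in lborel. norm (indicator {real n<..} s * ?h s) \<le> norm (indicator {0..} s * ?h s)"
          by (auto simp: indicator_def)
      qed measurable
      have "W = (\<integral>s. indicator {0..real n} s * ?h s + indicator {real n<..} s * ?h s \<partial>lborel)"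
        unfolding W_def by (intro Bochner_Integration.integral_cong) (auto simp: indicator_def)
      also have "\<dots> = G n + (\<integral>s. indicator {real n<..} s * ?h s \<partial>lborel)"
        using Bochner_Integration.integral_add[OF integrable.intros[OF Gint[of n]] i2] has_bochner_integral_integral_eq[OF Gint] by simp
      finally have "G n = - (\<integral>s. indicator {real n<..} s * ?h s \<partial>lborel)" using \<open>W = 0\<close> by simp
      hence "ennreal (G n) \<le> ennreal (norm (\<integral>s. indicator {real n<..} s * ?h s \<partial>lborel))" by (intro ennreal_leI) simp
      also have "\<dots> \<le> (\<integral>\<^sup>+s. ennreal (norm (indicator {real n<..} s * ?h s)) \<partial>lborel)"
        by (rule integral_norm_bound_ennreal[OF i2])
      also have "\<dots> \<le> R n \<omega>" unfolding R_def
        by (intro nn_integral_mono) (auto simp: indicator_def)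
      also have "\<dots> \<le> 8 * indicator D \<omega> + Q \<omega> + R n \<omega>" by simp
      finally show ?thesis by (simp add: G_def)
    qed
  qed
  have main: "ennreal (1 - exp (- real n)) \<le> ennreal (8 * prob D + 1 / 4 + 4 * exp (- real n / 2))" for n
  proof -
    have "(\<integral>\<^sup>+\<omega>. ennreal (exp (- real n) * residual UNIV (real n) \<omega>) \<partial>M) = (\<integral>\<^sup>+\<omega>. ennreal (exp (- real n)) * (\<integral>\<^sup>+v. ennreal (max 0 (real n - birth A v \<omega>)) \<partial>count_space UNIV) \<partial>M)"
    proof (rule nn_integral_cong_AE)
      show "AE \<omega> in M. ennreal (exp (- real n) * residual UNIV (real n) \<omega>) = ennreal (exp (- real n)) * (\<integral>\<^sup>+v. ennreal (max 0 (real n - birth A v \<omega>)) \<partial>count_space UNIV)"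
        using AE_regular
      proof eventually_elim
        case (elim \<omega>)
        let ?S = "{v. birth A v \<omega> \<le> real n}"
        have fin: "finite ?S" using elim by (simp add: regular_def)
        have "(\<integral>\<^sup>+v. ennreal (max 0 (real n - birth A v \<omega>)) \<partial>count_space UNIV) = (\<integral>\<^sup>+v. ennreal (max 0 (real n - birth A v \<omega>)) * indicator ?S v \<partial>count_space UNIV)"
          by (intro nn_integral_cong) (auto simp: indicator_def max_def ennreal_neg)
        also have "\<dots> = (\<integral>\<^sup>+v. ennreal (max 0 (real n - birth A v \<omega>)) \<partial>count_space ?S)"
          by (subst (2) nn_integral_count_space_indicator) auto
        also have "\<dots> = (\<Sum>v\<in>?S. ennreal (max 0 (real n - birth A v \<omega>)))"
          using fin by (simp add: nn_integral_count_space_finite)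
        also have "\<dots> = ennreal (residual UNIV (real n) \<omega>)"
          unfolding residual_def by (subst sum_ennreal) (auto intro!: arg_cong[where f = ennreal] sum.cong)
        finally have "(\<integral>\<^sup>+v. ennreal (max 0 (real n - birth A v \<omega>)) \<partial>count_space UNIV) = ennreal (residual UNIV (real n) \<omega>)" .
        moreover have "0 \<le> residual UNIV (real n) \<omega>" unfolding residual_def by (intro sum_nonneg) auto
        ultimately show ?case by (simp add: ennreal_mult)
      qed
    qed
    also have "\<dots> = ennreal (exp (- real n)) * (\<integral>\<^sup>+\<omega>. (\<integral>\<^sup>+v. ennreal (max 0 (real n - birth A v \<omega>)) \<partial>count_space UNIV) \<partial>M)"
      by (intro nn_integral_cmult measurable_nn_integral_lists) measurable
    also have "(\<integral>\<^sup>+\<omega>. (\<integral>\<^sup>+v. ennreal (max 0 (real n - birth A v \<omega>)) \<partial>count_space UNIV) \<partial>M) = ennreal (exp (real n) - 1)"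
      unfolding expected_size(2)[OF of_nat_0_le_iff, symmetric]
      by (rule nn_integral_count_space_nn_integral) auto
    also have "ennreal (exp (- real n)) * ennreal (exp (real n) - 1) = ennreal (1 - exp (- real n))"
      by (subst ennreal_mult[symmetric]) (auto simp: right_diff_distrib exp_add[symmetric])
    finally have "ennreal (1 - exp (- real n)) = (\<integral>\<^sup>+\<omega>. ennreal (exp (- real n) * residual UNIV (real n) \<omega>) \<partial>M)" ..
    also have "\<dots> \<le> (\<integral>\<^sup>+\<omega>. 8 * indicator D \<omega> + Q \<omega> + R n \<omega> \<partial>M)"
    proof (rule nn_integral_mono_AE)
      show "AE \<omega> in M. ennreal (exp (- real n) * residual UNIV (real n) \<omega>) \<le> 8 * indicator D \<omega> + Q \<omega> + R n \<omega>"
        using AE_regular finR AE_space by eventually_elim (rule key)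
    qed
    also have "\<dots> = 8 * emeasure M D + (\<integral>\<^sup>+\<omega>. Q \<omega> \<partial>M) + (\<integral>\<^sup>+\<omega>. R n \<omega> \<partial>M)"
      using Qm Rm[of n] by (simp add: nn_integral_add nn_integral_cmult)
    also have "\<dots> \<le> ennreal (8 * prob D) + ennreal (1 / 4) + ennreal (4 * exp (- real n / 2))"
    proof (intro add_mono)
      show "8 * emeasure M D \<le> ennreal (8 * prob D)" by (simp add: emeasure_eq_measure ennreal_mult')
      show "(\<integral>\<^sup>+\<omega>. Q \<omega> \<partial>M) \<le> ennreal (1 / 4)" unfolding Q_def by (rule growth_density_weighted_sq)
      show "(\<integral>\<^sup>+\<omega>. R n \<omega> \<partial>M) \<le> ennreal (4 * exp (- real n / 2))" unfolding R_def by (rule growth_density_tail) simp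
    qed
    also have "\<dots> = ennreal (8 * prob D + 1 / 4 + 4 * exp (- real n / 2))"
      by (subst ennreal_plus[symmetric], simp, simp)+ simp
    finally show ?thesis .
  qed
  \<comment> \<open>In the limit the probability of \<open>D\<close> is at least 3/32, a little more
    than claimed.\<close>
  have "1 - 0 \<le> 8 * prob D + 1 / 4 + 4 * 0"
  proof (rule LIMSEQ_le)
    show "(\<lambda>n. 1 - exp (- real n)) \<longlonglongrightarrow> 1 - 0" by real_asymp
    show "(\<lambda>n. 8 * prob D + 1 / 4 + 4 * exp (- real n / 2)) \<longlonglongrightarrow> 8 * prob D + 1 / 4 + 4 * 0" by real_asymp
    show "\<exists>N. \<forall>n\<ge>N. 1 - exp (- real n) \<le> 8 * prob D + 1 / 4 + 4 * exp (- real n / 2)"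
      using main by (subst (asm) ennreal_le_iff) (auto intro!: add_nonneg_nonneg)
  qed
  thus ?thesis unfolding D_def by simp
qed

end

text \<open>Labels are written in reverse, so the subtree of the child \<open>[i]\<close> of the
  root consists of the lists ending in \<open>i\<close>; its birth times are those of a shifted tree
  plus the delay \<open>a [] i\<close>.\<close>

lemma path_sum_append: "path_sum a (v @ [i]) = a [] i + path_sum (\<lambda>w. a (w @ [i])) v"
  by (induction v) auto

lemma measurable_path_sum_family:
  assumes "\<And>v. (\<lambda>x. f x v) \<in> measurable N path_space"
  shows "(\<lambda>x. path_sum (f x) v) \<in> borel_measurable N"
proof (induction v)
  case (Cons i v)
  have [measurable]: "(\<lambda>x. f x v) \<in> measurable N path_space" by fact
  have "(\<lambda>x. f x v i) \<in> borel_measurable N" by measurable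
  thus ?case using Cons by simp
qed simp

lemma measurable_tree_growth:
  assumes "\<And>v. (\<lambda>x. f x v) \<in> measurable N path_space"
  shows "Measurable.pred N (\<lambda>x. tree_growth (f x))"
proof -
  note [measurable] = measurable_path_sum_family[OF assms]
  have [measurable]: "(\<lambda>x. real (card {v. path_sum (f x) v \<le> real n})) \<in> borel_measurable N" for n :: nat
    by (rule measurable_card_lists) measurable
  show ?thesis unfolding tree_growth_def by measurable
qed

section \<open>Growth through independent subtrees\<close>

context random_recursive_tree
begin

lemma shifted_tree: "random_recursive_tree M (\<lambda>v. A (v @ [i]))"
proof (unfold_locales)
  show "unit_poisson_arrivals M (A (v @ [i]))" for v by (rule offspring_poisson)
  have "indep_vars (\<lambda>v. PiM {v @ [i]} (\<lambda>_. path_space)) (\<lambda>v \<omega>. restrict (\<lambda>w j. A w j \<omega>) {v @ [i]}) UNIV"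
    by (rule indep_vars_restrict[OF offspring_indep]) (auto simp: disjoint_family_on_def)
  hence "indep_vars (\<lambda>_. path_space) (\<lambda>v. (\<lambda>y. y (v @ [i])) \<circ> (\<lambda>\<omega>. restrict (\<lambda>w j. A w j \<omega>) {v @ [i]})) UNIV"
    by (rule indep_vars_compose) (rule measurable_singleton_path)
  thus "indep_vars (\<lambda>_. path_space) (\<lambda>v \<omega> j. A (v @ [i]) j \<omega>) UNIV"
    by (simp add: o_def)
qed

text \<open>The growth event of the subtree at \<open>[i]\<close> depends only on labels ending in
  \<open>i\<close>. These label sets are disjoint, so the events are independent with probabilities
  bounded below, and the probability 1/16 is raised to 1.\<close>

lemma AE_subtree_growth: "AE \<omega> in M. \<exists>i. tree_growth (\<lambda>v j. A (v @ [i]) j \<omega>)"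
proof -
  define E where "E i = {\<omega>\<in>space M. tree_growth (\<lambda>v j. A (v @ [i]) j \<omega>)}" for i
  have Em: "E i \<in> sets M" for i
  proof -
    have "Measurable.pred M (\<lambda>\<omega>. tree_growth (\<lambda>v j. A (v @ [i]) j \<omega>))" by (rule measurable_tree_growth) measurable
    thus ?thesis by (simp add: E_def pred_def)
  qed
  have lower: "1 / 16 \<le> prob (E i)" for i
  proof -
    interpret S: random_recursive_tree M "\<lambda>v. A (v @ [i])" by (rule shifted_tree)
    show ?thesis using S.prob_tree_growth Em[of i] unfolding E_def by blast
  qed
  let ?K = "\<lambda>i :: nat. range (\<lambda>v. v @ [i])"
  have "indep_vars (\<lambda>i. PiM (?K i) (\<lambda>_. path_space)) (\<lambda>i \<omega>. restrict (\<lambda>w j. A w j \<omega>) (?K i)) UNIV"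
    by (rule indep_vars_restrict[OF offspring_indep]) (auto simp: disjoint_family_on_def)
  hence "indep_events (\<lambda>i. {\<omega>\<in>space M. tree_growth (\<lambda>v. restrict (\<lambda>w j. A w j \<omega>) (?K i) (v @ [i]))}) UNIV"
  proof (rule indep_eventsI_indep_vars)
    fix i
    have "Measurable.pred (PiM (?K i) (\<lambda>_. path_space)) (\<lambda>y. tree_growth (\<lambda>v. y (v @ [i])))"
      by (rule measurable_tree_growth) (rule measurable_component_singleton, simp)
    thus "{y \<in> space (PiM (?K i) (\<lambda>_. path_space)). tree_growth (\<lambda>v. y (v @ [i]))} \<in> sets (PiM (?K i) (\<lambda>_. path_space))"
      by (simp add: pred_def)
  qed
  hence "indep_events E UNIV" by (simp add: E_def[abs_def])
  moreover have "\<not> summable (\<lambda>i. prob (E i))"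
  proof
    assume "summable (\<lambda>i. prob (E i))"
    hence "(\<lambda>i. prob (E i)) \<longlonglongrightarrow> 0" by (rule summable_LIMSEQ_zero)
    hence "1 / 16 \<le> (0::real)" by (rule LIMSEQ_le_const) (use lower in auto)
    thus False by simp
  qed
  ultimately have "AE \<omega> in M. frequently (\<lambda>i. \<omega> \<in> E i) sequentially" by (rule borel_cantelli_indep)
  thus ?thesis
  proof eventually_elim
    case (elim \<omega>)
    then obtain i where "\<omega> \<in> E i" using frequently_ex by blast
    thus ?case by (auto simp: E_def)
  qed
qed

section \<open>Population bounds and the birth times\<close>

lemma total_count_mono:
  assumes "regular \<omega>" "s \<le> t"
  shows "total_count s \<omega> \<le> total_count t \<omega>"
  unfolding total_count_def using assms by (intro card_mono) (auto simp: regular_def)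

text \<open>The subtree of \<open>[i]\<close> is a tree delayed by \<open>s\<close>. The constant
  \<open>c\<close> pays for the delay, for rounding to integers and for the multiple
  \<open>m\<close>; \<open>exp (- sqrt t)\<close> outweighs it together with the factor
  \<open>t\<close>.\<close>

lemma total_count_lower:
  assumes reg: "regular \<omega>" and growth: "tree_growth (\<lambda>v j. A (v @ [i]) j \<omega>)"
  shows "eventually (\<lambda>t. exp (t - sqrt t) \<le> real (total_count t \<omega>)) at_top"
proof -
  let ?a = "\<lambda>v j. A (v @ [i]) j \<omega>"
  obtain m n0 :: nat where g: "\<And>n. n \<ge> n0 \<Longrightarrow> exp (real n) \<le> real m * (real n * real (card {v. path_sum ?a v \<le> real n}))"
    using growth unfolding tree_growth_def by blast
  define s where "s = A [] i \<omega>"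
  have s: "0 < s" using reg by (simp add: regular_def s_def)
  define c where "c = real m * exp (s + 1)"
  have "((\<lambda>t::real. t * exp (- sqrt t)) \<longlongrightarrow> 0) at_top" by real_asymp
  hence "((\<lambda>t. c * (t * exp (- sqrt t))) \<longlongrightarrow> c * 0) at_top" by (rule tendsto_mult_left)
  hence "eventually (\<lambda>t. c * (t * exp (- sqrt t)) < 1) at_top" by (rule order_tendstoD) simp
  thus ?thesis using eventually_ge_at_top[of "real n0 + s + 1"]
  proof eventually_elim
    case (elim t)
    define n where "n = nat \<lfloor>t - s\<rfloor>"
    have n: "real n \<le> t - s" "t - s < real n + 1" using elim(2) s unfolding n_def by linarith+
    have "real n0 \<le> real n" using n elim(2) by linarith
    hence "n0 \<le> n" by simp
    have "card {v. path_sum ?a v \<le> real n} \<le> total_count t \<omega>"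
      unfolding total_count_def
    proof (rule card_inj_on_le[where f = "\<lambda>v. v @ [i]"])
      show "(\<lambda>v. v @ [i]) ` {v. path_sum ?a v \<le> real n} \<subseteq> {v. birth A v \<omega> \<le> t}"
        using n(1) by (auto simp: birth_eq_path_sum path_sum_append s_def)
    qed (use reg in \<open>auto simp: regular_def inj_on_def\<close>)
    hence le: "real (card {v. path_sum ?a v \<le> real n}) \<le> real (total_count t \<omega>)" by simp
    have "exp (t - s - 1) \<le> exp (real n)" using n by simp
    also have "\<dots> \<le> real m * (real n * real (card {v. path_sum ?a v \<le> real n}))" by (rule g[OF \<open>n0 \<le> n\<close>])
    also have "\<dots> \<le> real m * (t * real (total_count t \<omega>))"
      using n s le by (intro mult_left_mono mult_mono) auto
    finally have *: "exp (t - s - 1) \<le> real m * (t * real (total_count t \<omega>))" .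
    have "exp (t - sqrt t) * 1 = exp (t - s - 1) * (exp (s + 1) * exp (- sqrt t))"
      by (simp add: exp_add[symmetric])
    also have "\<dots> \<le> (real m * (t * real (total_count t \<omega>))) * (exp (s + 1) * exp (- sqrt t))"
      using * by (intro mult_right_mono) auto
    also have "\<dots> = (c * (t * exp (- sqrt t))) * real (total_count t \<omega>)" by (simp add: c_def mult_ac)
    also have "\<dots> \<le> 1 * real (total_count t \<omega>)" using elim(1) by (intro mult_right_mono) auto
    finally show ?case by simp
  qed
qed

text \<open>Markov's inequality at integer times with the summable loss 1 / n^2; monotonicity covers
  the times between, and \<open>exp (sqrt t)\<close> absorbs the polynomial and the
  rounding.\<close>

lemma AE_total_count_upper: "AE \<omega> in M. eventually (\<lambda>t. real (total_count t \<omega>) \<le> exp (t + sqrt t)) at_top"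
proof -
  have [measurable]: "(\<lambda>\<omega>. real (total_count t \<omega>)) \<in> borel_measurable M" for t
    unfolding total_count_def by (rule measurable_card_lists) measurable
  have mean: "(\<integral>\<^sup>+\<omega>. ennreal (real (total_count (real n) \<omega>)) \<partial>M) = ennreal (exp (real n))" for n :: nat
  proof -
    have "(\<integral>\<^sup>+\<omega>. ennreal (real (total_count (real n) \<omega>)) \<partial>M) = (\<integral>\<^sup>+\<omega>. (\<integral>\<^sup>+v. indicator {..real n} (birth A v \<omega>) \<partial>count_space UNIV) \<partial>M)"
    proof (rule nn_integral_cong_AE)
      show "AE \<omega> in M. ennreal (real (total_count (real n) \<omega>)) = (\<integral>\<^sup>+v. indicator {..real n} (birth A v \<omega>) \<partial>count_space UNIV)"
        using AE_regular
      proof eventually_elim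
        case (elim \<omega>)
        have "(\<integral>\<^sup>+v. indicator {..real n} (birth A v \<omega>) \<partial>count_space UNIV) = (\<integral>\<^sup>+v. indicator {v. birth A v \<omega> \<le> real n} v \<partial>count_space UNIV)"
          by (intro nn_integral_cong) (simp add: indicator_def)
        also have "\<dots> = emeasure (count_space UNIV) {v. birth A v \<omega> \<le> real n}" by (rule nn_integral_indicator) simp
        also have "\<dots> = ennreal (real (total_count (real n) \<omega>))"
          using elim by (simp add: regular_def total_count_def ennreal_of_nat_eq_real_of_nat)
        finally show ?case by simp
      qed
    qed
    also have "\<dots> = ennreal (exp (real n))"
      unfolding expected_size(1)[OF of_nat_0_le_iff, symmetric]
      by (rule nn_integral_count_space_nn_integral) auto
    finally show ?thesis .
  qed
  have "AE \<omega> in M. eventually (\<lambda>n. real (total_count (real n) \<omega>) < real n ^ 2 * exp (real n)) sequentially"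
  proof (rule borel_cantelli_mean)
    show "(\<integral>\<^sup>+\<omega>. ennreal (real (total_count (real n) \<omega>)) \<partial>M) \<le> ennreal (exp (real n))" for n :: nat
      by (simp add: mean)
    show "eventually (\<lambda>n. 0 < real n ^ 2 * exp (real n) \<and> exp (real n) / (real n ^ 2 * exp (real n)) \<le> 1 / real n ^ 2) sequentially"
      using eventually_gt_at_top[of 0] by eventually_elim simp
  qed measurable
  thus ?thesis using AE_regular
  proof eventually_elim
    case (elim \<omega>)
    obtain n0 where n0: "\<And>n. n \<ge> n0 \<Longrightarrow> real (total_count (real n) \<omega>) < real n ^ 2 * exp (real n)"
      using elim by (auto simp: eventually_sequentially)
    have "eventually (\<lambda>t::real. (t + 1) ^ 2 * exp (t + 1) \<le> exp (t + sqrt t)) at_top" by real_asymp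
    thus ?case using eventually_ge_at_top[of "real n0"]
    proof eventually_elim
      case (elim t)
      let ?n = "nat \<lceil>t\<rceil>"
      have t: "t \<le> real ?n" "real ?n \<le> t + 1" "n0 \<le> ?n" using elim(2) by linarith+
      have "real (total_count t \<omega>) \<le> real (total_count (real ?n) \<omega>)"
        using total_count_mono[OF \<open>regular \<omega>\<close> t(1)] by simp
      also have "\<dots> \<le> real ?n ^ 2 * exp (real ?n)" using n0[OF t(3)] by simp
      also have "\<dots> \<le> (t + 1) ^ 2 * exp (t + 1)" using t by (intro mult_mono power_mono) auto
      finally show ?case using elim(1) by linarith
    qed
  qed
qed

text \<open>The assumptions give the laws of counts, not of single arrivals. An arrival sitting at
  \<open>c\<close> is counted between \<open>c - e\<close> and \<open>c\<close>, where the mean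
  count is only \<open>e\<close>.\<close>

lemma arrival_no_atom: "(\<integral>\<^sup>+\<omega>. indicator {c} (A v i \<omega>) \<partial>M) = 0"
proof (cases "0 < c")
  case False
  have "AE \<omega> in M. indicator {c} (A v i \<omega>) = (0::ennreal)"
    using AE_arrivals by eventually_elim (use False in \<open>auto simp: indicator_def\<close>)
  thus ?thesis by (subst nn_integral_0_iff_AE) auto
next
  case True
  have le: "(\<integral>\<^sup>+\<omega>. indicator {c} (A v i \<omega>) \<partial>M) \<le> ennreal e" if e: "0 < e" "e < c" for e
  proof -
    let ?d = "\<lambda>\<omega>. real (arrivals_upto (\<lambda>i. A v i \<omega>) c) - real (arrivals_upto (\<lambda>i. A v i \<omega>) (c - e))"
    have hb: "has_bochner_integral M ?d (c - (c - e))"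
      using e by (intro has_bochner_integral_diff arrivals_upto_moments) auto
    have AE: "AE \<omega> in M. indicator {c} (A v i \<omega>) \<le> ?d \<omega>"
      using AE_finite_arrivals AE_arrivals
    proof eventually_elim
      case (elim \<omega>)
      let ?S = "\<lambda>s. {i. 0 < A v i \<omega> \<and> A v i \<omega> \<le> s}"
      have fin: "finite (?S c)" using elim(1) by (auto intro: rev_finite_subset[of "{i. A v i \<omega> \<le> c}"])
      show ?case
      proof (cases "A v i \<omega> = c")
        case True
        have "card (insert i (?S (c - e))) \<le> card (?S c)"
          using fin e True elim(2) by (intro card_mono) auto
        moreover have "finite (?S (c - e))" using fin e by (auto elim: rev_finite_subset)
        ultimately have "Suc (card (?S (c - e))) \<le> card (?S c)" using e True by simp
        thus ?thesis using True by (simp add: arrivals_upto_def)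
      next
        case False
        have "card (?S (c - e)) \<le> card (?S c)" using fin e by (intro card_mono) auto
        thus ?thesis using False by (simp add: arrivals_upto_def)
      qed
    qed
    have "(\<integral>\<^sup>+\<omega>. indicator {c} (A v i \<omega>) \<partial>M) \<le> (\<integral>\<^sup>+\<omega>. ennreal (?d \<omega>) \<partial>M)"
    proof (rule nn_integral_mono_AE)
      from AE show "AE \<omega> in M. indicator {c} (A v i \<omega>) \<le> ennreal (?d \<omega>)"
      proof eventually_elim
        case (elim \<omega>)
        from ennreal_leI[OF elim] show ?case by (cases "A v i \<omega> = c") auto
      qed
    qed
    also have "\<dots> = ennreal (c - (c - e))"
    proof (subst nn_integral_eq_integral)
      show "AE \<omega> in M. 0 \<le> ?d \<omega>" using AE
      proof eventually_elim
        case (elim \<omega>)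
        have "(0::real) \<le> indicator {c} (A v i \<omega>)" by simp
        with elim show ?case by linarith
      qed
    qed (use hb in \<open>auto simp: has_bochner_integral_iff\<close>)
    finally show ?thesis by simp
  qed
  have "(\<integral>\<^sup>+\<omega>. indicator {c} (A v i \<omega>) \<partial>M) \<le> 0"
  proof (rule ennreal_le_epsilon)
    fix e :: real assume "0 < e"
    have "(\<integral>\<^sup>+\<omega>. indicator {c} (A v i \<omega>) \<partial>M) \<le> ennreal (min e (c / 2))" using True \<open>0 < e\<close> by (intro le) auto
    also have "\<dots> \<le> ennreal e" by (intro ennreal_leI) simp
    finally show "(\<integral>\<^sup>+\<omega>. indicator {c} (A v i \<omega>) \<partial>M) \<le> 0 + ennreal e" by simp
  qed
  thus ?thesis by simp
qed

text \<open>For children of different parents, freezing all paths but that of the longer parent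
  forces a coincidence to place one arrival at a fixed value. Siblings differ by strict
  monotonicity, and the root differs from the rest by positivity.\<close>

lemma AE_distinct_births: "AE \<omega> in M. \<forall>v w. v \<noteq> w \<longrightarrow> birth A v \<omega> \<noteq> birth A w \<omega>"
proof -
  have indep: "AE \<omega> in M. birth A (i # v) \<omega> \<noteq> birth A (j # w) \<omega>" if "v \<noteq> w" "length w \<le> length v" for i j v w
  proof -
    let ?N = "PiM (- {v}) (\<lambda>_. path_space)" and ?R = "\<lambda>\<omega>. restrict (\<lambda>w i. A w i \<omega>) (- {v})"
    have [measurable]: "(\<lambda>x. path_sum x v) \<in> borel_measurable ?N" "(\<lambda>x. path_sum x w) \<in> borel_measurable ?N"
      using that by (auto intro!: measurable_path_sum)
    have [measurable]: "(\<lambda>x. x w) \<in> measurable ?N path_space"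
      using that by (intro measurable_component_singleton) auto
    note [measurable] = measurable_singleton_path[of v]
    have R: "path_sum (?R \<omega>) v = birth A v \<omega>" "path_sum (?R \<omega>) w = birth A w \<omega>"
        "?R \<omega> w = (\<lambda>i. A w i \<omega>)" "restrict (\<lambda>w i. A w i \<omega>) {v} v = (\<lambda>i. A v i \<omega>)" for \<omega>
      using that by (simp_all add: path_sum_restrict birth_eq_path_sum)
    define f :: "(nat list \<Rightarrow> nat \<Rightarrow> real) \<times> (nat list \<Rightarrow> nat \<Rightarrow> real) \<Rightarrow> ennreal" where
      "f = (\<lambda>(a, x). indicator {0} (a v i - (path_sum x w + x w j - path_sum x v)))"
    have fm: "f \<in> borel_measurable (PiM {v} (\<lambda>_. path_space) \<Otimes>\<^sub>M ?N)" unfolding f_def by measurable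
    have "(\<integral>\<^sup>+\<omega>. f (restrict (\<lambda>w i. A w i \<omega>) {v}, ?R \<omega>) \<partial>M) = (\<integral>\<^sup>+\<omega>'. (\<integral>\<^sup>+\<omega>. f (restrict (\<lambda>w i. A w i \<omega>) {v}, ?R \<omega>') \<partial>M) \<partial>M)"
      by (rule indep_var_nn_integral[OF indep_var_others fm])
    also have "\<dots> = (\<integral>\<^sup>+\<omega>'. 0 \<partial>M)"
    proof (rule nn_integral_cong)
      fix \<omega>'
      let ?c = "birth A w \<omega>' + A w j \<omega>' - birth A v \<omega>'"
      have "(\<integral>\<^sup>+\<omega>. f (restrict (\<lambda>w i. A w i \<omega>) {v}, ?R \<omega>') \<partial>M) = (\<integral>\<^sup>+\<omega>. indicator {?c} (A v i \<omega>) \<partial>M)"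
        unfolding f_def prod.case R by (intro nn_integral_cong) (auto simp: indicator_def)
      thus "(\<integral>\<^sup>+\<omega>. f (restrict (\<lambda>w i. A w i \<omega>) {v}, ?R \<omega>') \<partial>M) = 0" by (simp only: arrival_no_atom)
    qed
    finally have "(\<integral>\<^sup>+\<omega>. f (restrict (\<lambda>w i. A w i \<omega>) {v}, ?R \<omega>) \<partial>M) = 0" by simp
    hence "(\<integral>\<^sup>+\<omega>. indicator {0} (birth A (i # v) \<omega> - birth A (j # w) \<omega>) \<partial>M) = 0"
      unfolding f_def prod.case R by (simp add: algebra_simps)
    hence "AE \<omega> in M. indicator {0} (birth A (i # v) \<omega> - birth A (j # w) \<omega>) = (0::ennreal)"
      by (subst (asm) nn_integral_0_iff_AE) auto
    thus ?thesis by eventually_elim (auto simp: indicator_def split: if_splits)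
  qed
  have main: "AE \<omega> in M. birth A v \<omega> \<noteq> birth A w \<omega>" if vw: "v \<noteq> w" "length w \<le> length v" for v w
  proof -
    obtain i v' where v: "v = i # v'" using vw by (cases v) auto
    show ?thesis
    proof (cases w)
      case Nil
      show ?thesis using AE_regular
      proof eventually_elim
        case (elim \<omega>)
        have "0 < A v' i \<omega>" using elim by (simp add: regular_def)
        thus ?case using regular_birth_nonneg[OF elim, of v'] Nil v by simp
      qed
    next
      case (Cons j w')
      show ?thesis
      proof (cases "v' = w'")
        case True
        hence "i \<noteq> j" using vw v Cons by auto
        show ?thesis using AE_regular
        proof eventually_elim
          case (elim \<omega>)
          hence "inj (\<lambda>i. A v' i \<omega>)" by (auto simp: regular_def intro: strict_mono_imp_inj_on)
          thus ?case using \<open>i \<noteq> j\<close> v Cons True by (auto dest: injD)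
        qed
      next
        case False
        thus ?thesis using indep[of v' w' i j] vw v Cons by simp
      qed
    qed
  qed
  have "AE \<omega> in M. v \<noteq> w \<longrightarrow> birth A v \<omega> \<noteq> birth A w \<omega>" for v w
  proof (cases "v = w")
    case False
    have "AE \<omega> in M. birth A v \<omega> \<noteq> birth A w \<omega>"
    proof (cases "length w \<le> length v")
      case True thus ?thesis using main False by blast
    next
      case lt: False
      have "AE \<omega> in M. birth A w \<omega> \<noteq> birth A v \<omega>" using main[of w v] False lt by auto
      thus ?thesis by eventually_elim auto
    qed
    thus ?thesis by eventually_elim simp
  qed simp
  thus ?thesis by (simp add: AE_all_countable)
qed

text \<open>Arrivals at the root are unbounded, so the set in \<open>tau\<close> is nonempty; local
  finiteness turns its infimum into a minimum, and distinctness lets exactly one vertex enter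
  there.\<close>

lemma total_count_tau:
  assumes reg: "regular \<omega>" and dist: "\<And>v w. v \<noteq> w \<Longrightarrow> birth A v \<omega> \<noteq> birth A w \<omega>"
  shows "total_count (tau A n \<omega>) \<omega> = Suc n"
proof (induction n)
  case 0
  have "v = []" if "birth A v \<omega> \<le> 0" for v
    using dist[of v "[]"] regular_birth_nonneg[OF reg, of v] that by (cases "v = []") auto
  hence *: "{v. birth A v \<omega> \<le> tau A 0 \<omega>} = {[]}" by auto
  show ?case unfolding total_count_def * by simp
next
  case (Suc n)
  let ?t = "tau A n \<omega>"
  let ?B = "{birth A v \<omega> | v. ?t < birth A v \<omega>}"
  have "filterlim (\<lambda>i. A [] i \<omega>) at_top sequentially" using reg by (simp add: regular_def)
  hence "eventually (\<lambda>i. ?t < A [] i \<omega>) sequentially"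
    using filterlim_at_top_dense[of "\<lambda>i. A [] i \<omega>" sequentially] by blast
  then obtain i where "?t < A [] i \<omega>" by (auto simp: eventually_sequentially)
  hence i: "?t < birth A [i] \<omega>" by simp
  let ?F = "{v. ?t < birth A v \<omega> \<and> birth A v \<omega> \<le> birth A [i] \<omega>}"
  have finF: "finite ?F" using reg by (auto simp: regular_def elim: rev_finite_subset)
  define x where "x = Min ((\<lambda>v. birth A v \<omega>) ` ?F)"
  have ne: "[i] \<in> ?F" using i by simp
  have "x \<in> (\<lambda>v. birth A v \<omega>) ` ?F" unfolding x_def
    by (intro Min_in finite_imageI finF) (use ne in blast)
  then obtain v0 where v0: "v0 \<in> ?F" "x = birth A v0 \<omega>" by auto
  have min: "x \<le> birth A v \<omega>" if "?t < birth A v \<omega>" for v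
  proof (cases "birth A v \<omega> \<le> birth A [i] \<omega>")
    case True
    thus ?thesis unfolding x_def using finF that by (intro Min_le) auto
  next
    case False
    have "x \<le> birth A [i] \<omega>" unfolding x_def
      by (rule Min_le[OF finite_imageI[OF finF] image_eqI[OF refl ne]])
    thus ?thesis using False by simp
  qed
  have "Inf ?B = x"
    by (rule cInf_eq_minimum) (use v0 min in auto)
  hence tau: "tau A (Suc n) \<omega> = birth A v0 \<omega>" using v0 by simp
  have "{v. birth A v \<omega> \<le> birth A v0 \<omega>} = insert v0 {v. birth A v \<omega> \<le> ?t}"
  proof (intro equalityI subsetI)
    fix v assume v: "v \<in> {v. birth A v \<omega> \<le> birth A v0 \<omega>}"
    show "v \<in> insert v0 {v. birth A v \<omega> \<le> ?t}"
    proof (cases "birth A v \<omega> \<le> ?t")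
      case False
      hence "birth A v \<omega> = birth A v0 \<omega>" using min[of v] v v0 by auto
      thus ?thesis using dist[of v v0] by auto
    qed simp
  qed (use v0 in auto)
  moreover have "v0 \<notin> {v. birth A v \<omega> \<le> ?t}" "finite {v. birth A v \<omega> \<le> ?t}"
    using v0 reg by (auto simp: regular_def)
  ultimately show ?case using Suc unfolding total_count_def tau by simp
qed

text \<open>The population at time \<open>tau A n\<close> is \<open>Suc n\<close>, so the growth
  bounds are inverted by taking logarithms.\<close>

lemma AE_tau:
  "AE \<omega> in M. filterlim (\<lambda>n. tau A n \<omega>) at_top sequentially \<and>
     eventually (\<lambda>n. \<bar>ln (real (Suc n)) - tau A n \<omega>\<bar> \<le> sqrt (tau A n \<omega>)) sequentially \<and>
     (\<forall>n. total_count (tau A n \<omega>) \<omega> = Suc n)"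
  using AE_regular AE_distinct_births AE_subtree_growth AE_total_count_upper
proof eventually_elim
  case (elim \<omega>)
  note reg = elim(1)
  have tc: "total_count (tau A n \<omega>) \<omega> = Suc n" for n
    using total_count_tau[OF reg] elim(2) by blast
  have top: "filterlim (\<lambda>n. tau A n \<omega>) at_top sequentially"
    unfolding filterlim_at_top
  proof
    fix Z
    show "eventually (\<lambda>n. Z \<le> tau A n \<omega>) sequentially"
      using eventually_ge_at_top[of "total_count Z \<omega>"]
    proof eventually_elim
      case (elim n)
      show ?case
      proof (rule ccontr)
        assume "\<not> Z \<le> tau A n \<omega>"
        hence "total_count (tau A n \<omega>) \<omega> \<le> total_count Z \<omega>" by (intro total_count_mono reg) simp
        thus False using tc[of n] elim by simp
      qed
    qed
  qed
  obtain i where "tree_growth (\<lambda>v j. A (v @ [i]) j \<omega>)" using elim(3) by blast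
  from total_count_lower[OF reg this]
  have low: "eventually (\<lambda>n. exp (tau A n \<omega> - sqrt (tau A n \<omega>)) \<le> real (total_count (tau A n \<omega>) \<omega>)) sequentially"
    by (rule eventually_compose_filterlim[OF _ top])
  have upp: "eventually (\<lambda>n. real (total_count (tau A n \<omega>) \<omega>) \<le> exp (tau A n \<omega> + sqrt (tau A n \<omega>))) sequentially"
    by (rule eventually_compose_filterlim[OF elim(4) top])
  have "eventually (\<lambda>n. \<bar>ln (real (Suc n)) - tau A n \<omega>\<bar> \<le> sqrt (tau A n \<omega>)) sequentially"
    using low upp
  proof eventually_elim
    case (elim n)
    have "ln (exp (tau A n \<omega> - sqrt (tau A n \<omega>))) \<le> ln (real (Suc n))"
      using elim(1) unfolding tc by (subst ln_le_cancel_iff) auto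
    moreover have "ln (real (Suc n)) \<le> ln (exp (tau A n \<omega> + sqrt (tau A n \<omega>)))"
      using elim(2) unfolding tc by (subst ln_le_cancel_iff) auto
    ultimately show ?case unfolding ln_exp abs_le_iff by linarith
  qed
  thus ?case using top tc by blast
qed

lemma centred_poisson_walk_root: "centred_poisson_walk M root_increment"
proof unfold_locales
  let ?N = "\<lambda>i. arrivals_between (A []) (real i) (real (Suc i))"
  have up: "unit_poisson_arrivals M (A [])" by (rule offspring_poisson)
  have "indep_vars (\<lambda>_. count_space UNIV) ?N UNIV"
    using up unfolding unit_poisson_arrivals_def by (elim conjE allE[of _ real] impE) (auto intro!: monoI)
  hence ind: "indep_vars (\<lambda>_. count_space UNIV) ?N UNIV" .
  from indep_vars_compose2[OF this, of "\<lambda>_ k. real k - 1" "\<lambda>_. borel"]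
  show "indep_vars (\<lambda>_. borel) root_increment UNIV"
    unfolding root_increment_def[abs_def] by simp
  show "has_bochner_integral M (\<lambda>\<omega>. exp (c * root_increment i \<omega>)) (exp (cumulant c))" for i c
  proof -
    have [measurable]: "?N i \<in> measurable M (count_space UNIV)" using ind by (auto simp: indep_vars_def)
    have d: "distr M (count_space UNIV) (?N i) = measure_pmf (poisson_pmf 1)"
      using up unfolding unit_poisson_arrivals_def by (elim conjE allE[of _ "real i"] allE[of _ "real (Suc i)"] impE) auto
    have "has_bochner_integral M (\<lambda>\<omega>. exp (c * real (?N i \<omega>))) (exp (1 * (exp c - 1)))"
      using poisson_moments(3)[of 1 c] unfolding d[symmetric]
      by (simp add: has_bochner_integral_iff integrable_distr_eq integral_distr del: of_nat_Suc)
    from has_bochner_integral_mult_left[OF this, of "exp (- c)"]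
    show ?thesis
      by (simp add: root_increment_def cumulant_def right_diff_distrib exp_diff exp_minus divide_inverse mult.commute)
  qed
qed

end

section \<open>Transfer to the birth times\<close>

text \<open>Discrete intermediate value argument: the sequence keeps returning near both ends with
  steps tending to 0, so on its way up it passes close to every point between.\<close>

lemma limit_points_eq_interval:
  fixes V :: "nat \<Rightarrow> real"
  assumes bound: "\<And>\<epsilon>. 0 < \<epsilon> \<Longrightarrow> eventually (\<lambda>n. \<bar>V n\<bar> \<le> 1 + \<epsilon>) sequentially"
    and up: "\<And>\<epsilon>. 0 < \<epsilon> \<Longrightarrow> frequently (\<lambda>n. 1 - \<epsilon> \<le> V n) sequentially"
    and down: "\<And>\<epsilon>. 0 < \<epsilon> \<Longrightarrow> frequently (\<lambda>n. V n \<le> - (1 - \<epsilon>)) sequentially"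
    and step: "(\<lambda>n. V (Suc n) - V n) \<longlonglongrightarrow> 0"
    and I: "eventually (\<lambda>n. n \<in> I) sequentially"
  shows "limit_points I V = {-1..1}"
proof (intro equalityI subsetI)
  fix l assume "l \<in> limit_points I V"
  then obtain r :: "nat \<Rightarrow> nat" where r: "filterlim r at_top sequentially" "(\<lambda>j. V (r j)) \<longlonglongrightarrow> l"
    by (auto simp: limit_points_def)
  have "\<bar>l\<bar> \<le> 1 + \<epsilon>" if "0 < \<epsilon>" for \<epsilon>
  proof (rule tendsto_upperbound[OF tendsto_rabs[OF r(2)]])
    show "eventually (\<lambda>j. \<bar>V (r j)\<bar> \<le> 1 + \<epsilon>) sequentially"
      by (rule eventually_compose_filterlim[OF bound[OF that] r(1)])
  qed simp
  hence "\<bar>l\<bar> \<le> 1" by (rule field_le_epsilon)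
  thus "l \<in> {-1..1}" by auto
next
  fix x :: real assume x: "x \<in> {-1..1}"
  have dense: "\<exists>n\<ge>N. \<bar>V n - x\<bar> \<le> \<delta>" if d: "0 < \<delta>" for \<delta> N
  proof -
    have "eventually (\<lambda>n. \<bar>V (Suc n) - V n\<bar> < \<delta>) sequentially"
      using tendstoD[OF step d] by (simp add: dist_real_def)
    then obtain N1 where N1: "\<And>n. n \<ge> N1 \<Longrightarrow> \<bar>V (Suc n) - V n\<bar> < \<delta>" by (auto simp: eventually_sequentially)
    obtain n1 where n1: "n1 \<ge> max N N1" "V n1 \<le> - (1 - \<delta>)"
      using down[OF d] unfolding frequently_sequentially by blast
    obtain n2 where n2: "n2 \<ge> n1" "1 - \<delta> \<le> V n2"
      using up[OF d] unfolding frequently_sequentially by blast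
    \<comment> \<open>the first index at which \<open>V\<close>, moving in steps below \<open>\<delta>\<close>, gets up to the target\<close>
    define n where "n = (LEAST n. n1 \<le> n \<and> x - \<delta> \<le> V n)"
    have n: "n1 \<le> n \<and> x - \<delta> \<le> V n" unfolding n_def
      by (rule LeastI[of _ n2]) (use n2 x in auto)
    have "V n \<le> x + \<delta>"
    proof (cases "n = n1")
      case True
      thus ?thesis using n1 x by auto
    next
      case False
      then obtain p where p: "n = Suc p" "n1 \<le> p" using n by (cases n) auto
      have "p < (LEAST n. n1 \<le> n \<and> x - \<delta> \<le> V n)" using p n_def by simp
      from not_less_Least[OF this] have "V p < x - \<delta>" using p by auto
      moreover have "\<bar>V (Suc p) - V p\<bar> < \<delta>" using p n1 by (intro N1) auto
      ultimately show ?thesis using p d by auto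
    qed
    thus ?thesis using n n1 by (intro exI[of _ n]) auto
  qed
  obtain N0 where N0: "\<And>n. n \<ge> N0 \<Longrightarrow> n \<in> I" using I by (auto simp: eventually_sequentially)
  have "\<forall>j. \<exists>n. n \<ge> max N0 j \<and> \<bar>V n - x\<bar> \<le> 1 / real (Suc j)"
    using dense by (metis of_nat_0_less_iff zero_less_Suc zero_less_divide_1_iff)
  then obtain r where r: "\<And>j. r j \<ge> max N0 j" "\<And>j. \<bar>V (r j) - x\<bar> \<le> 1 / real (Suc j)" by metis
  have "filterlim r at_top sequentially"
    by (rule filterlim_at_top_mono[OF filterlim_ident]) (use r in auto)
  moreover have "(\<lambda>j. V (r j)) \<longlonglongrightarrow> x"
  proof (rule LIM_zero_cancel, rule Lim_null_comparison)
    show "eventually (\<lambda>j. norm (V (r j) - x) \<le> 1 / real (Suc j)) sequentially" using r by simp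
    show "(\<lambda>j. 1 / real (Suc j)) \<longlonglongrightarrow> 0" by real_asymp
  qed
  moreover have "\<forall>j. r j \<in> I" using r N0 by auto
  ultimately show "x \<in> limit_points I V" unfolding limit_points_def by blast
qed

text \<open>A shift of time by O(sqrt t) changes the normalisation by a factor tending to 1 and the
  centring t^(k+1) by O(t^(k+1/2)), which the iterated logarithm in the normalisation makes
  negligible. This fixes the precision asked of the birth times.\<close>

lemma lil_norm_perturb:
  fixes p t :: "'b \<Rightarrow> real"
  assumes t: "filterlim t at_top F" and pt: "eventually (\<lambda>x. \<bar>p x - t x\<bar> \<le> c * sqrt (t x)) F"
  shows "((\<lambda>x. lil_norm k (p x) / lil_norm k (t x)) \<longlongrightarrow> 1) F"
    and "((\<lambda>x. (p x ^ Suc k - t x ^ Suc k) / lil_norm k (t x)) \<longlongrightarrow> 0) F"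
    and "((\<lambda>x. t x ^ k * sqrt (t x) / lil_norm k (t x)) \<longlongrightarrow> 0) F"
proof -
  have big: "eventually (\<lambda>x. B \<le> t x) F" for B using t by (simp add: filterlim_at_top)
  have "((\<lambda>t::real. c / sqrt t) \<longlongrightarrow> 0) at_top" by real_asymp
  hence c0: "((\<lambda>x. c / sqrt (t x)) \<longlongrightarrow> 0) F" by (rule filterlim_compose[OF _ t])
  have "((\<lambda>x. p x / t x - 1) \<longlongrightarrow> 0) F"
  proof (rule Lim_null_comparison[OF _ c0])
    show "eventually (\<lambda>x. norm (p x / t x - 1) \<le> c / sqrt (t x)) F"
      using pt big[of 1]
    proof eventually_elim
      case (elim x)
      have "norm (p x / t x - 1) = \<bar>p x - t x\<bar> / t x" using elim by (simp add: field_simps)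
      also have "\<dots> \<le> c * sqrt (t x) / (sqrt (t x) * sqrt (t x))" using elim by (simp add: divide_right_mono)
      also have "\<dots> = c / sqrt (t x)" using elim by (simp del: real_sqrt_mult_self)
      finally show ?case .
    qed
  qed
  hence ratio: "((\<lambda>x. p x / t x) \<longlongrightarrow> 1) F" by (rule LIM_zero_cancel)
  have bnd: "eventually (\<lambda>x. t x / 2 \<le> p x \<and> p x \<le> 2 * t x) F"
  proof -
    have "eventually (\<lambda>x. 1 / 2 < p x / t x) F" "eventually (\<lambda>x. p x / t x < 2) F"
      by (rule order_tendstoD[OF ratio]; simp)+
    thus ?thesis using big[of 1] by eventually_elim (auto simp: field_simps)
  qed
  have "eventually (\<lambda>t::real. 0 < ln (ln t) \<and> 0 < t) at_top" by (intro eventually_conj; real_asymp)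
  from eventually_compose_filterlim[OF this t]
  have pos: "eventually (\<lambda>x. 0 < ln (ln (t x)) \<and> 0 < t x) F" .
  let ?D = "fact k * sqrt (2 * k + 1) :: real"
  have D: "0 < ?D" by simp
  show "((\<lambda>x. lil_norm k (p x) / lil_norm k (t x)) \<longlongrightarrow> 1) F"
    by (rule lil_norm_ratio[OF t ratio])
  have "((\<lambda>t::real. 1 / sqrt (2 * ln (ln t))) \<longlongrightarrow> 0) at_top" by real_asymp
  hence inv0: "((\<lambda>x. 1 / sqrt (2 * ln (ln (t x)))) \<longlongrightarrow> 0) F" by (rule filterlim_compose[OF _ t])
  have norm_ratio: "eventually (\<lambda>x. t x ^ k * sqrt (t x) / lil_norm k (t x) = ?D * (1 / sqrt (2 * ln (ln (t x))))) F"
    using pos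
  proof eventually_elim
    case (elim x)
    have "t x ^ k * sqrt (t x) \<noteq> 0" using elim by simp
    thus ?case unfolding lil_norm_def by simp
  qed
  show lim3: "((\<lambda>x. t x ^ k * sqrt (t x) / lil_norm k (t x)) \<longlongrightarrow> 0) F"
  proof (rule Lim_transform_eventually)
    show "((\<lambda>x. ?D * (1 / sqrt (2 * ln (ln (t x))))) \<longlongrightarrow> 0) F" using tendsto_mult_left[OF inv0, of ?D] by simp
    show "eventually (\<lambda>x. ?D * (1 / sqrt (2 * ln (ln (t x)))) = t x ^ k * sqrt (t x) / lil_norm k (t x)) F"
      using norm_ratio by eventually_elim simp
  qed
  show "((\<lambda>x. (p x ^ Suc k - t x ^ Suc k) / lil_norm k (t x)) \<longlongrightarrow> 0) F"
  proof (rule Lim_null_comparison)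
    let ?K = "\<bar>c\<bar> * real (Suc k) * 2 ^ k"
    show "((\<lambda>x. ?K * (t x ^ k * sqrt (t x) / lil_norm k (t x))) \<longlongrightarrow> 0) F"
      using tendsto_mult_left[OF lim3, of ?K] by simp
    show "eventually (\<lambda>x. norm ((p x ^ Suc k - t x ^ Suc k) / lil_norm k (t x)) \<le> ?K * (t x ^ k * sqrt (t x) / lil_norm k (t x))) F"
      using bnd pt big[of 3]
    proof eventually_elim
      case (elim x)
      have N: "0 < lil_norm k (t x)" using elim by (intro lil_norm_pos) auto
      have p0: "0 \<le> p x" "0 \<le> t x" using elim by auto
      have "p x ^ Suc k - t x ^ Suc k = (p x - t x) * (\<Sum>i<Suc k. p x ^ i * t x ^ (k - i))"
        by (rule power_diff_sumr2[THEN trans]) (simp add: mult.commute)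
      hence "\<bar>p x ^ Suc k - t x ^ Suc k\<bar> = \<bar>p x - t x\<bar> * \<bar>\<Sum>i<Suc k. p x ^ i * t x ^ (k - i)\<bar>"
        by (simp only: abs_mult)
      also have "\<dots> \<le> (\<bar>c\<bar> * sqrt (t x)) * (real (Suc k) * (2 * t x) ^ k)"
      proof (rule mult_mono)
        have "c * sqrt (t x) \<le> \<bar>c\<bar> * sqrt (t x)" using p0 by (intro mult_right_mono) auto
        thus "\<bar>p x - t x\<bar> \<le> \<bar>c\<bar> * sqrt (t x)" using elim by linarith
        have "\<bar>\<Sum>i<Suc k. p x ^ i * t x ^ (k - i)\<bar> = (\<Sum>i<Suc k. p x ^ i * t x ^ (k - i))"
          using p0 by (intro abs_of_nonneg sum_nonneg) auto
        also have "\<dots> \<le> (\<Sum>i<Suc k. (2 * t x) ^ k)"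
        proof (rule sum_mono)
          fix i assume i: "i \<in> {..<Suc k}"
          have "p x ^ i * t x ^ (k - i) \<le> (2 * t x) ^ i * (2 * t x) ^ (k - i)"
            using elim p0 by (intro mult_mono power_mono) auto
          also have "\<dots> = (2 * t x) ^ k" unfolding power_add[symmetric] using i by simp
          finally show "p x ^ i * t x ^ (k - i) \<le> (2 * t x) ^ k" .
        qed
        finally show "\<bar>\<Sum>i<Suc k. p x ^ i * t x ^ (k - i)\<bar> \<le> real (Suc k) * (2 * t x) ^ k" by simp
      qed (use p0 in auto)
      also have "\<dots> = ?K * (t x ^ k * sqrt (t x))" by (simp only: power_mult_distrib mult_ac)
      finally have "\<bar>p x ^ Suc k - t x ^ Suc k\<bar> \<le> ?K * (t x ^ k * sqrt (t x))" .
      hence "\<bar>p x ^ Suc k - t x ^ Suc k\<bar> / lil_norm k (t x) \<le> ?K * (t x ^ k * sqrt (t x)) / lil_norm k (t x)"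
        using N by (intro divide_right_mono) auto
      thus ?case using N by (simp only: real_norm_def abs_divide abs_of_pos times_divide_eq_right)
    qed
  qed
qed

text \<open>\<open>Z\<close> is the size of level \<open>Suc k\<close> as a function of time, and \<open>T\<close> the iterated sum of the root
  process that carries its fluctuations; \<open>Z (\<tau> n)\<close> is the level size in the tree with \<open>n + 1\<close> vertices.\<close>

locale lil_transfer =
  fixes Z :: "real \<Rightarrow> real" and T :: "nat \<Rightarrow> real" and \<tau> :: "nat \<Rightarrow> real" and C :: real and k :: nat
  assumes mono_Z: "\<And>s t. s \<le> t \<Longrightarrow> Z s \<le> Z t"
    and C_nonneg: "0 \<le> C"
    and expansion: "\<And>n::nat. 1 \<le> n \<Longrightarrow> \<bar>Z (real n) - real n ^ Suc k / fact (Suc k) - T n\<bar> \<le> C * (real n ^ k * sqrt (real n))"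
    and T_bound: "\<And>\<epsilon>. 0 < \<epsilon> \<Longrightarrow> eventually (\<lambda>n. \<bar>T n\<bar> \<le> (1 + \<epsilon>) * lil_norm k (real n)) sequentially"
    and T_up: "\<And>\<epsilon>. 0 < \<epsilon> \<Longrightarrow> frequently (\<lambda>n. (1 - \<epsilon>) * lil_norm k (real n) \<le> T n) sequentially"
    and T_down: "\<And>\<epsilon>. 0 < \<epsilon> \<Longrightarrow> frequently (\<lambda>n. (1 - \<epsilon>) * lil_norm k (real n) \<le> - T n) sequentially"
    and tau_top: "filterlim \<tau> at_top sequentially"
    and tau_ln: "eventually (\<lambda>n. \<bar>ln (real (Suc n)) - \<tau> n\<bar> \<le> sqrt (\<tau> n)) sequentially"
    and jump: "\<And>n. Z (\<tau> n) \<le> Z (\<tau> (Suc n)) \<and> Z (\<tau> (Suc n)) \<le> Z (\<tau> n) + 1"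
begin

definition V :: "nat \<Rightarrow> real" where
  "V n = (Z (\<tau> n) - ln (real n) ^ Suc k / fact (Suc k)) / lil_norm k (ln (real n))"

lemma ln_top: "filterlim (\<lambda>n. ln (real n)) at_top sequentially"
  by real_asymp

text \<open>The hypothesis measures the error by \<open>sqrt (\<tau> n)\<close> and has
  \<open>Suc n\<close> under the logarithm. In terms of the two square roots it forces
  \<open>s \<le> q + 1\<close>, after which the factor 2 absorbs both discrepancies.\<close>

lemma tau_between: "eventually (\<lambda>n. ln (real n) - 2 * sqrt (ln (real n)) \<le> \<tau> n \<and> \<tau> n \<le> ln (real n) + 2 * sqrt (ln (real n))) sequentially"
proof -
  have "eventually (\<lambda>n. 25 \<le> ln (real n)) sequentially" using ln_top by (simp add: filterlim_at_top)
  moreover have "eventually (\<lambda>n. 1 \<le> \<tau> n) sequentially" using tau_top by (simp add: filterlim_at_top)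
  ultimately show ?thesis using tau_ln eventually_gt_at_top[of 0]
  proof eventually_elim
    case (elim n)
    define t where "t = ln (real n)"
    define q where "q = sqrt t"
    define s where "s = sqrt (\<tau> n)"
    have q: "5 \<le> q" "q\<^sup>2 = t"
    proof -
      have "sqrt 25 \<le> q" unfolding q_def t_def using elim(1) by (rule real_sqrt_le_mono)
      moreover have "sqrt 25 = (5::real)" by (rule real_sqrt_unique) auto
      ultimately show "5 \<le> q" by simp
      show "q\<^sup>2 = t" using elim unfolding q_def t_def by simp
    qed
    have s: "1 \<le> s" "s\<^sup>2 = \<tau> n" using elim unfolding s_def by auto
    have "ln (real (Suc n)) \<le> t + 1"
    proof -
      have "ln (real (Suc n)) \<le> ln (exp 1 * real n)"
      proof (subst ln_le_cancel_iff)
        have "2 * real n \<le> exp 1 * real n" using exp_ge_add_one_self[of 1] by (intro mult_right_mono) auto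
        moreover have "1 \<le> real n" using elim(4) by simp
        ultimately show "real (Suc n) \<le> exp 1 * real n" unfolding of_nat_Suc by linarith
      qed (use elim in auto)
      thus ?thesis using elim(4) by (simp add: ln_mult t_def)
    qed
    moreover have "t \<le> ln (real (Suc n))" unfolding t_def using elim(4) by simp
    ultimately have 1: "s\<^sup>2 - s \<le> q\<^sup>2 + 1" "q\<^sup>2 \<le> s\<^sup>2 + s"
      using elim(3) unfolding q s s_def[symmetric] by linarith+
    have sq: "s \<le> q + 1"
    proof (rule ccontr)
      assume "\<not> s \<le> q + 1"
      hence "(q + 1) * q < s * (s - 1)" using q by (intro mult_strict_mono) auto
      thus False using 1(1) q(1) by (simp add: power2_eq_square algebra_simps)
    qed
    have "t - 2 * q \<le> \<tau> n" using 1(2) sq q(1) unfolding q s by linarith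
    moreover have "\<tau> n \<le> t + 2 * q" using 1(1) sq q(1) unfolding q(2)[symmetric] s(2)[symmetric] by linarith
    ultimately show ?case unfolding q_def t_def by blast
  qed
qed

text \<open>Three errors are added: the expansion at the integer \<open>p n\<close>, the shift of
  the centring from \<open>p n\<close> to \<open>t n\<close>, and the change of normalisation acting
  on the bounded ratio of \<open>T\<close> to its norm.\<close>

lemma transfer:
  fixes p :: "nat \<Rightarrow> nat" and t :: "nat \<Rightarrow> real"
  assumes p: "filterlim p at_top sequentially" and t: "filterlim t at_top sequentially"
    and pt: "eventually (\<lambda>n. \<bar>real (p n) - t n\<bar> \<le> c * sqrt (t n)) sequentially" "0 \<le> c"
  shows "(\<lambda>n. (Z (real (p n)) - t n ^ Suc k / fact (Suc k)) / lil_norm k (t n) - T (p n) / lil_norm k (real (p n))) \<longlonglongrightarrow> 0"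
proof -
  have pr: "filterlim (\<lambda>n. real (p n)) at_top sequentially" by (rule filterlim_compose[OF filterlim_real_sequentially p])
  have ev3: "eventually (\<lambda>n. 3 \<le> p n) sequentially" using p by (simp add: filterlim_at_top)
  have evt: "eventually (\<lambda>n. 3 \<le> t n) sequentially" using t by (simp add: filterlim_at_top)
  note lims = lil_norm_perturb[OF t pt(1), of k]
  have lim3: "(\<lambda>n. real (p n) ^ k * sqrt (real (p n)) / lil_norm k (real (p n))) \<longlonglongrightarrow> 0"
    using lil_norm_perturb(3)[OF pr, of "\<lambda>n. real (p n)" 0 k] by simp
  have e1: "(\<lambda>n. (Z (real (p n)) - real (p n) ^ Suc k / fact (Suc k) - T (p n)) / lil_norm k (t n)) \<longlonglongrightarrow> 0"
  proof (rule Lim_null_comparison)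
    have "(\<lambda>n. C * ((real (p n) ^ k * sqrt (real (p n)) / lil_norm k (real (p n))) * (lil_norm k (real (p n)) / lil_norm k (t n)))) \<longlonglongrightarrow> C * (0 * 1)"
      by (intro tendsto_mult tendsto_const lim3 lims(1))
    thus "(\<lambda>n. C * ((real (p n) ^ k * sqrt (real (p n)) / lil_norm k (real (p n))) * (lil_norm k (real (p n)) / lil_norm k (t n)))) \<longlonglongrightarrow> 0" by simp
    show "eventually (\<lambda>n. norm ((Z (real (p n)) - real (p n) ^ Suc k / fact (Suc k) - T (p n)) / lil_norm k (t n))
       \<le> C * ((real (p n) ^ k * sqrt (real (p n)) / lil_norm k (real (p n))) * (lil_norm k (real (p n)) / lil_norm k (t n)))) sequentially"
      using ev3 evt
    proof eventually_elim
      case (elim n)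
      have N: "0 < lil_norm k (t n)" "0 < lil_norm k (real (p n))" using elim by (auto intro!: lil_norm_pos)
      have "norm ((Z (real (p n)) - real (p n) ^ Suc k / fact (Suc k) - T (p n)) / lil_norm k (t n))
        = \<bar>Z (real (p n)) - real (p n) ^ Suc k / fact (Suc k) - T (p n)\<bar> / lil_norm k (t n)"
        using N by (simp only: real_norm_def abs_divide abs_of_pos)
      also have "\<dots> \<le> C * (real (p n) ^ k * sqrt (real (p n))) / lil_norm k (t n)"
        using N elim by (intro divide_right_mono expansion) auto
      also have "\<dots> = C * ((real (p n) ^ k * sqrt (real (p n)) / lil_norm k (real (p n))) * (lil_norm k (real (p n)) / lil_norm k (t n)))"
        using N by simp
      finally show ?case .
    qed
  qed
  have e2: "(\<lambda>n. (real (p n) ^ Suc k - t n ^ Suc k) / lil_norm k (t n) / fact (Suc k)) \<longlonglongrightarrow> 0"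
    using tendsto_divide[OF lims(2) tendsto_const[of "fact (Suc k)"]] by simp
  have e3: "(\<lambda>n. T (p n) / lil_norm k (real (p n)) * (lil_norm k (real (p n)) / lil_norm k (t n) - 1)) \<longlonglongrightarrow> 0"
  proof (rule Lim_null_comparison)
    have "(\<lambda>n. 2 * \<bar>lil_norm k (real (p n)) / lil_norm k (t n) - 1\<bar>) \<longlonglongrightarrow> 2 * \<bar>1 - 1\<bar>"
      by (intro tendsto_intros lims(1))
    thus "(\<lambda>n. 2 * \<bar>lil_norm k (real (p n)) / lil_norm k (t n) - 1\<bar>) \<longlonglongrightarrow> 0" by simp
    have "eventually (\<lambda>n. \<bar>T (p n)\<bar> \<le> (1 + 1) * lil_norm k (real (p n))) sequentially"
      by (rule eventually_compose_filterlim[OF T_bound p]) simp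
    with ev3 show "eventually (\<lambda>n. norm (T (p n) / lil_norm k (real (p n)) * (lil_norm k (real (p n)) / lil_norm k (t n) - 1))
      \<le> 2 * \<bar>lil_norm k (real (p n)) / lil_norm k (t n) - 1\<bar>) sequentially"
    proof eventually_elim
      case (elim n)
      have N: "0 < lil_norm k (real (p n))" using elim by (auto intro!: lil_norm_pos)
      hence "\<bar>T (p n) / lil_norm k (real (p n))\<bar> \<le> 2" using elim by (simp add: pos_divide_le_eq)
      thus ?case unfolding real_norm_def abs_mult by (intro mult_right_mono) auto
    qed
  qed
  show ?thesis
  proof (rule Lim_transform_eventually)
    show "(\<lambda>n. (Z (real (p n)) - real (p n) ^ Suc k / fact (Suc k) - T (p n)) / lil_norm k (t n)
        + (real (p n) ^ Suc k - t n ^ Suc k) / lil_norm k (t n) / fact (Suc k)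
        + T (p n) / lil_norm k (real (p n)) * (lil_norm k (real (p n)) / lil_norm k (t n) - 1)) \<longlonglongrightarrow> 0"
      using tendsto_add[OF tendsto_add[OF e1 e2] e3] by simp
    show "eventually (\<lambda>n. (Z (real (p n)) - real (p n) ^ Suc k / fact (Suc k) - T (p n)) / lil_norm k (t n)
        + (real (p n) ^ Suc k - t n ^ Suc k) / lil_norm k (t n) / fact (Suc k)
        + T (p n) / lil_norm k (real (p n)) * (lil_norm k (real (p n)) / lil_norm k (t n) - 1)
        = (Z (real (p n)) - t n ^ Suc k / fact (Suc k)) / lil_norm k (t n) - T (p n) / lil_norm k (real (p n))) sequentially"
      using ev3
    proof eventually_elim
      case (elim n)
      have "(z - a / f - w) / y + (a - b) / y / f + w / x * (x / y - 1) = (z - b / f) / y - w / x" if "x \<noteq> 0" for z a b f w x y :: real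
        using that by (simp add: diff_divide_distrib right_diff_distrib mult.commute)
      moreover have "0 < lil_norm k (real (p n))" using elim by (auto intro!: lil_norm_pos)
      ultimately show ?case by (metis less_irrefl)
    qed
  qed
qed

text \<open>By monotonicity the level size at \<open>\<tau> n\<close> lies between those at the
  integers \<open>d n\<close> and \<open>u n\<close>, which are within
  \<open>3 * sqrt (ln (real n))\<close> of log n, close enough for \<open>transfer\<close>.\<close>

lemma V_bound:
  assumes e: "0 < \<epsilon>"
  shows "eventually (\<lambda>n. \<bar>V n\<bar> \<le> 1 + \<epsilon>) sequentially"
proof -
  define u where "u n = nat \<lceil>ln (real n) + 2 * sqrt (ln (real n))\<rceil>" for n
  define d where "d n = nat \<lfloor>ln (real n) - 2 * sqrt (ln (real n))\<rfloor>" for n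
  have big: "eventually (\<lambda>n. 9 \<le> ln (real n)) sequentially" using ln_top by (simp add: filterlim_at_top)
  have ub: "eventually (\<lambda>n. ln (real n) \<le> real (u n) \<and> real (u n) \<le> ln (real n) + 3 * sqrt (ln (real n)) \<and> ln (real n) + 2 * sqrt (ln (real n)) \<le> real (u n)) sequentially"
    using big
  proof eventually_elim
    case (elim n)
    have "1 \<le> sqrt (ln (real n))" using elim by simp
    thus ?case unfolding u_def using elim by linarith
  qed
  have db: "eventually (\<lambda>n. ln (real n) - 3 * sqrt (ln (real n)) \<le> real (d n) \<and> real (d n) \<le> ln (real n) - 2 * sqrt (ln (real n))) sequentially"
    using big
  proof eventually_elim
    case (elim n)
    have "3 \<le> sqrt (ln (real n))" using real_sqrt_le_mono[OF elim] by (simp add: real_sqrt_unique[of 3 9])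
    moreover have "ln (real n) = sqrt (ln (real n)) * sqrt (ln (real n))" using elim by simp
    ultimately have "0 \<le> ln (real n) - 2 * sqrt (ln (real n))"
      using mult_right_mono[of 2 "sqrt (ln (real n))" "sqrt (ln (real n))"] by linarith
    thus ?case using \<open>3 \<le> sqrt (ln (real n))\<close> unfolding d_def by linarith
  qed
  have utop: "filterlim u at_top sequentially"
  proof -
    have "filterlim (\<lambda>n. real (u n)) at_top sequentially"
      by (rule filterlim_at_top_mono[OF ln_top]) (use ub in eventually_elim, simp)
    thus ?thesis using filterlim_sequentially_iff_filterlim_real by blast
  qed
  have dtop: "filterlim d at_top sequentially"
  proof -
    have "filterlim (\<lambda>n. ln (real n) - 3 * sqrt (ln (real n))) at_top sequentially" by real_asymp
    hence "filterlim (\<lambda>n. real (d n)) at_top sequentially"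
      by (rule filterlim_at_top_mono) (use db in eventually_elim, simp)
    thus ?thesis using filterlim_sequentially_iff_filterlim_real by blast
  qed
  have pu: "eventually (\<lambda>n. \<bar>real (u n) - ln (real n)\<bar> \<le> 3 * sqrt (ln (real n))) sequentially"
    using ub by eventually_elim linarith
  have pd: "eventually (\<lambda>n. \<bar>real (d n) - ln (real n)\<bar> \<le> 3 * sqrt (ln (real n))) sequentially"
    using db big
  proof eventually_elim
    case (elim n)
    have "0 \<le> sqrt (ln (real n))" using elim by simp
    thus ?case using elim by linarith
  qed
  have Tb: "eventually (\<lambda>n. \<bar>T (p n) / lil_norm k (real (p n))\<bar> \<le> 1 + \<epsilon> / 2) sequentially"
    if p: "filterlim p at_top sequentially" for p
  proof -
    have "eventually (\<lambda>n. \<bar>T (p n)\<bar> \<le> (1 + \<epsilon> / 2) * lil_norm k (real (p n))) sequentially"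
      by (rule eventually_compose_filterlim[OF T_bound p]) (use e in simp)
    moreover have "eventually (\<lambda>n. 3 \<le> p n) sequentially" using p by (simp add: filterlim_at_top)
    ultimately show ?thesis
    proof eventually_elim
      case (elim n)
      have "0 < lil_norm k (real (p n))" using elim by (intro lil_norm_pos) auto
      thus ?case using elim by (simp add: pos_divide_le_eq)
    qed
  qed
  have e2: "0 < \<epsilon> / 2" using e by simp
  have c3: "(0::real) \<le> 3" by simp
  show ?thesis
    using tendstoD[OF transfer[OF utop ln_top pu c3] e2] tendstoD[OF transfer[OF dtop ln_top pd c3] e2]
      Tb[OF utop] Tb[OF dtop] tau_between ub db big
  proof eventually_elim
    case (elim n)
    let ?t = "ln (real n)"
    have N: "0 < lil_norm k ?t" using elim by (intro lil_norm_pos) auto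
    have "Z (\<tau> n) \<le> Z (real (u n))" "Z (real (d n)) \<le> Z (\<tau> n)" using elim by (auto intro!: mono_Z)
    hence "V n \<le> (Z (real (u n)) - ?t ^ Suc k / fact (Suc k)) / lil_norm k ?t"
      "(Z (real (d n)) - ?t ^ Suc k / fact (Suc k)) / lil_norm k ?t \<le> V n"
      unfolding V_def using N by (auto intro!: divide_right_mono)
    thus ?case using elim(1-4) unfolding dist_real_def abs_le_iff by linarith
  qed
qed

text \<open>\<open>T\<close> is large at certain integers \<open>m\<close>, which need not be birth
  times. The index \<open>n m\<close> is chosen so that \<open>\<tau> (n m)\<close> comes at
  \<open>m\<close> or later, which keeps the level size large by monotonicity, while log (n m)
  differs from \<open>m\<close> by O(sqrt m) only.\<close>

lemma V_frequently_up:
  assumes e: "0 < \<epsilon>"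
  shows "frequently (\<lambda>n. 1 - \<epsilon> \<le> V n) sequentially"
proof -
  \<comment> \<open>A birth time may fall short of log n by 2 sqrt (log n); the shift by
    \<open>4 * sqrt (real m)\<close> overcompensates this.\<close>
  define n where "n m = nat \<lceil>exp (real m + 4 * sqrt (real m))\<rceil>" for m :: nat
  have nb: "exp (real m + 4 * sqrt (real m)) \<le> real (n m)" "real (n m) \<le> exp (real m + 4 * sqrt (real m)) + 1" for m
    using exp_gt_zero[of "real m + 4 * sqrt (real m)"] unfolding n_def by linarith+
  have lnb: "real m + 4 * sqrt (real m) \<le> ln (real (n m))" "ln (real (n m)) \<le> real m + 4 * sqrt (real m) + 1" for m
  proof -
    let ?x = "real m + 4 * sqrt (real m)"
    have pos: "0 < real (n m)" using nb(1)[of m] exp_gt_zero[of ?x] by linarith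
    have "ln (exp ?x) \<le> ln (real (n m))" using nb(1)[of m] pos by (subst ln_le_cancel_iff) auto
    thus "?x \<le> ln (real (n m))" by simp
    have "1 \<le> exp ?x" by simp
    hence "real (n m) \<le> 2 * exp ?x" using nb(2)[of m] by linarith
    also have "\<dots> \<le> exp 1 * exp ?x" using exp_ge_add_one_self[of 1] by (intro mult_right_mono) auto
    also have "\<dots> = exp (?x + 1)" by (simp add: exp_add)
    finally have "ln (real (n m)) \<le> ln (exp (?x + 1))" using pos by (subst ln_le_cancel_iff) auto
    thus "ln (real (n m)) \<le> ?x + 1" by simp
  qed
  have mle: "real m \<le> ln (real (n m))" for m
  proof -
    have "0 \<le> sqrt (real m)" by simp
    thus ?thesis using lnb(1)[of m] by linarith
  qed
  have lt: "filterlim (\<lambda>m. ln (real (n m))) at_top sequentially"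
    by (rule filterlim_at_top_mono[OF filterlim_real_sequentially]) (use mle in auto)
  have ntop: "filterlim n at_top sequentially"
  proof (rule filterlim_at_top_mono[OF filterlim_ident])
    have "real m \<le> real (n m)" for m
    proof -
      have "real m + 1 \<le> exp (real m)" using exp_ge_add_one_self[of "real m"] by linarith
      also have "\<dots> \<le> exp (real m + 4 * sqrt (real m))" by simp
      finally show ?thesis using nb(1)[of m] by linarith
    qed
    thus "eventually (\<lambda>m. m \<le> n m) sequentially" by simp
  qed
  have pt: "eventually (\<lambda>m. \<bar>real (id m) - ln (real (n m))\<bar> \<le> 5 * sqrt (ln (real (n m)))) sequentially"
    using eventually_ge_at_top[of 1]
  proof eventually_elim
    case (elim m)
    have "1 \<le> sqrt (real m)" "sqrt (real m) \<le> sqrt (ln (real (n m)))" using elim mle[of m] by simp_all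
    thus ?case using lnb[of m] mle[of m] unfolding id_def abs_le_iff by linarith
  qed
  have e2: "0 < \<epsilon> / 2" using e by simp
  have c5: "(0::real) \<le> 5" by simp
  have tr: "eventually (\<lambda>m. dist ((Z (real (id m)) - ln (real (n m)) ^ Suc k / fact (Suc k)) / lil_norm k (ln (real (n m))) - T (id m) / lil_norm k (real (id m))) 0 < \<epsilon> / 2) sequentially"
    by (rule tendstoD[OF transfer[OF _ lt pt c5] e2]) (simp add: id_def filterlim_ident)
  have low: "eventually (\<lambda>m. real m \<le> \<tau> (n m)) sequentially"
    using eventually_compose_filterlim[OF tau_between ntop] eventually_ge_at_top[of 4]
  proof eventually_elim
    case (elim m)
    define q where "q = sqrt (real m)"
    have q: "2 \<le> q" "q * q = real m"
      using elim(2) unfolding q_def by (auto intro!: real_le_rsqrt)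
    define r where "r = sqrt (ln (real (n m)))"
    have r: "0 \<le> r" "r * r = ln (real (n m))" using mle[of m] by (auto simp: r_def)
    have "q * q + 4 * q \<le> r * r" using lnb(1)[of m] unfolding q(2) r(2) by (simp add: q_def)
    have "q + 1 \<le> r"
    proof (rule ccontr)
      assume "\<not> q + 1 \<le> r"
      hence "r * r < (q + 1) * (q + 1)" using r(1) by (intro mult_strict_mono) auto
      thus False using \<open>q * q + 4 * q \<le> r * r\<close> q(1) by (simp add: algebra_simps)
    qed
    have "q * q \<le> r * r - 2 * r"
    proof -
      have "q * q + 1 \<le> (r - 1) * (r - 1)"
      proof (cases "r \<le> q + 2")
        case True
        have "(r - 1) * (r - 1) = r * r - 2 * r + 1" by (simp add: algebra_simps)
        thus ?thesis using \<open>q * q + 4 * q \<le> r * r\<close> True q(1) by linarith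
      next
        case False
        hence "(q + 1) * (q + 1) \<le> (r - 1) * (r - 1)" using q(1) by (intro mult_mono) auto
        thus ?thesis using q(1) by (simp add: algebra_simps)
      qed
      thus ?thesis by (simp add: algebra_simps)
    qed
    thus ?case using elim(1)[folded r_def] q(2) r(2) by linarith
  qed
  have ev: "eventually (\<lambda>m. (1 - \<epsilon> / 2) * lil_norm k (real m) \<le> T m \<longrightarrow> 1 - \<epsilon> \<le> V (n m)) sequentially"
    using tr low eventually_ge_at_top[of 3]
  proof eventually_elim
    case (elim m)
    have N: "0 < lil_norm k (real m)" "0 < lil_norm k (ln (real (n m)))" using elim mle[of m] by (auto intro!: lil_norm_pos)
    show ?case
    proof
      assume "(1 - \<epsilon> / 2) * lil_norm k (real m) \<le> T m"
      hence 1: "1 - \<epsilon> / 2 \<le> T m / lil_norm k (real m)" using N by (simp add: pos_le_divide_eq)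
      have "(Z (real m) - ln (real (n m)) ^ Suc k / fact (Suc k)) / lil_norm k (ln (real (n m))) \<le> V (n m)"
        unfolding V_def using N mono_Z[OF elim(2)] by (intro divide_right_mono) auto
      thus "1 - \<epsilon> \<le> V (n m)" using 1 elim(1) unfolding dist_real_def id_def by linarith
    qed
  qed
  have "frequently (\<lambda>m. 1 - \<epsilon> \<le> V (n m)) sequentially"
    using frequently_eventually_frequently[OF T_up[OF e2] ev] by (rule frequently_elim1) blast
  thus ?thesis unfolding frequently_def
    using eventually_compose_filterlim[OF _ ntop, of "\<lambda>n. \<not> 1 - \<epsilon> \<le> V n"] by blast
qed

lemma V_frequently_down:
  assumes e: "0 < \<epsilon>"
  shows "frequently (\<lambda>n. V n \<le> - (1 - \<epsilon>)) sequentially"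
proof -
  \<comment> \<open>Now the birth time has to come at \<open>m\<close> or earlier, so the shift and
    the rounding go the other way.\<close>
  define n where "n m = nat \<lfloor>exp (real m - 4 * sqrt (real m))\<rfloor>" for m :: nat
  have top1: "filterlim (\<lambda>m. real m - 4 * sqrt (real m) - 1) at_top sequentially" by real_asymp
  have big: "eventually (\<lambda>m. 16 \<le> real m - 4 * sqrt (real m) - 1) sequentially"
    using filterlim_at_top[THEN iffD1, OF top1] by blast
  have lnb: "eventually (\<lambda>m. real m - 4 * sqrt (real m) - 1 \<le> ln (real (n m)) \<and> ln (real (n m)) \<le> real m - 4 * sqrt (real m)) sequentially"
    using big
  proof eventually_elim
    case (elim m)
    let ?x = "real m - 4 * sqrt (real m)"
    have x: "17 \<le> ?x" using elim by simp
    have e2: "2 \<le> exp ?x" using exp_ge_add_one_self[of ?x] x by linarith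
    have nb: "real (n m) \<le> exp ?x" "exp ?x - 1 \<le> real (n m)" using e2 unfolding n_def by linarith+
    have pos: "0 < real (n m)" using nb e2 by linarith
    have "ln (real (n m)) \<le> ln (exp ?x)" using nb(1) pos by (subst ln_le_cancel_iff) auto
    moreover have "exp (?x - 1) \<le> real (n m)"
    proof -
      have "exp (?x - 1) * 2 \<le> exp (?x - 1) * exp 1" using exp_ge_add_one_self[of 1] by (intro mult_left_mono) auto
      also have "\<dots> = exp ?x" by (simp add: exp_add[symmetric])
      finally show ?thesis using nb(2) e2 by linarith
    qed
    hence "ln (exp (?x - 1)) \<le> ln (real (n m))" using pos by (subst ln_le_cancel_iff) auto
    ultimately show ?case by simp
  qed
  have lt: "filterlim (\<lambda>m. ln (real (n m))) at_top sequentially"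
    by (rule filterlim_at_top_mono[OF top1]) (use lnb in eventually_elim, simp)
  have ntop: "filterlim n at_top sequentially"
  proof -
    have "filterlim (\<lambda>m. real (n m)) at_top sequentially"
    proof (rule filterlim_at_top_mono[OF lt])
      show "eventually (\<lambda>m. ln (real (n m)) \<le> real (n m)) sequentially"
      proof (intro always_eventually allI)
        fix m show "ln (real (n m)) \<le> real (n m)"
          by (cases "n m = 0") (auto intro: order_trans[OF ln_le_minus_one])
      qed
    qed
    thus ?thesis using filterlim_sequentially_iff_filterlim_real by blast
  qed
  \<comment> \<open>The distance is at most 5 sqrt m, and sqrt m is at most twice the square root of
    log (n m); hence the factor 10.\<close>
  have pt: "eventually (\<lambda>m. \<bar>real (id m) - ln (real (n m))\<bar> \<le> 10 * sqrt (ln (real (n m)))) sequentially"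
    using big lnb eventually_ge_at_top[of 100]
  proof eventually_elim
    case (elim m)
    define q where "q = sqrt (real m)"
    have q: "10 \<le> q" "q * q = real m"
    proof -
      have "sqrt 100 \<le> q" unfolding q_def using elim(3) by (intro real_sqrt_le_mono) simp
      thus "10 \<le> q" by (simp add: real_sqrt_unique[of 10 100])
    qed (simp add: q_def)
    have "10 * q \<le> q * q" using q(1) by (intro mult_right_mono) auto
    hence "q * q \<le> 4 * ln (real (n m))" using elim(2)[folded q_def] q by linarith
    hence "sqrt (q * q) \<le> sqrt (4 * ln (real (n m)))" by (rule real_sqrt_le_mono)
    hence "q \<le> 2 * sqrt (ln (real (n m)))" using q(1) by (simp add: real_sqrt_mult)
    thus ?case using elim(2) q(1) unfolding q_def[symmetric] id_def abs_le_iff by linarith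
  qed
  have e2: "0 < \<epsilon> / 2" using e by simp
  have c10: "(0::real) \<le> 10" by simp
  have tr: "eventually (\<lambda>m. dist ((Z (real (id m)) - ln (real (n m)) ^ Suc k / fact (Suc k)) / lil_norm k (ln (real (n m))) - T (id m) / lil_norm k (real (id m))) 0 < \<epsilon> / 2) sequentially"
    by (rule tendstoD[OF transfer[OF _ lt pt c10] e2]) (simp add: id_def filterlim_ident)
  have upp: "eventually (\<lambda>m. \<tau> (n m) \<le> real m) sequentially"
    using eventually_compose_filterlim[OF tau_between ntop] lnb big
  proof eventually_elim
    case (elim m)
    have "sqrt (ln (real (n m))) \<le> sqrt (real m)"
    proof (rule real_sqrt_le_mono)
      have "0 \<le> sqrt (real m)" by simp
      thus "ln (real (n m)) \<le> real m" using elim(2) by linarith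
    qed
    moreover have "0 \<le> sqrt (real m)" by simp
    ultimately show ?case using elim(1,2) by linarith
  qed
  have lt3: "eventually (\<lambda>m. 3 \<le> ln (real (n m))) sequentially" using lt by (simp add: filterlim_at_top)
  have ev: "eventually (\<lambda>m. (1 - \<epsilon> / 2) * lil_norm k (real m) \<le> - T m \<longrightarrow> V (n m) \<le> - (1 - \<epsilon>)) sequentially"
    using tr upp lt3 eventually_ge_at_top[of 3]
  proof eventually_elim
    case (elim m)
    have N: "0 < lil_norm k (real m)" "0 < lil_norm k (ln (real (n m)))" using elim by (auto intro!: lil_norm_pos)
    show ?case
    proof
      assume "(1 - \<epsilon> / 2) * lil_norm k (real m) \<le> - T m"
      hence "1 - \<epsilon> / 2 \<le> - T m / lil_norm k (real m)" using N by (simp only: pos_le_divide_eq)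
      hence 1: "1 - \<epsilon> / 2 \<le> - (T m / lil_norm k (real m))" by simp
      have "V (n m) \<le> (Z (real m) - ln (real (n m)) ^ Suc k / fact (Suc k)) / lil_norm k (ln (real (n m)))"
        unfolding V_def using N mono_Z[OF elim(2)] by (intro divide_right_mono) auto
      thus "V (n m) \<le> - (1 - \<epsilon>)" using 1 elim(1) unfolding dist_real_def id_def by linarith
    qed
  qed
  have "frequently (\<lambda>m. V (n m) \<le> - (1 - \<epsilon>)) sequentially"
    using frequently_eventually_frequently[OF T_down[OF e2] ev] by (rule frequently_elim1) blast
  thus ?thesis unfolding frequently_def
    using eventually_compose_filterlim[OF _ ntop, of "\<lambda>n. \<not> V n \<le> - (1 - \<epsilon>)"] by blast
qed

text \<open>Per step there is at most one new vertex in the level, a small change of the centring,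
  and a relative change of the normalisation; the last is multiplied by \<open>V n\<close>, which is
  bounded.\<close>

lemma V_step: "(\<lambda>n. V (Suc n) - V n) \<longlonglongrightarrow> 0"
proof -
  let ?t = "\<lambda>n. ln (real n)"
  let ?N = "\<lambda>n. lil_norm k (?t n)"
  have pt: "eventually (\<lambda>n. \<bar>?t (Suc n) - ?t n\<bar> \<le> 1 * sqrt (?t n)) sequentially" by real_asymp
  note lims = lil_norm_perturb[OF ln_top pt, of k]
  have big: "eventually (\<lambda>n. 3 \<le> ?t n) sequentially" using ln_top by (simp add: filterlim_at_top)
  have big': "eventually (\<lambda>n. 3 \<le> ?t (Suc n)) sequentially"
    using big eventually_sequentially_Suc[of "\<lambda>n. 3 \<le> ?t n"] by blast
  have inv: "(\<lambda>n. ?N n / ?N (Suc n)) \<longlonglongrightarrow> 1"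
  proof -
    have "(\<lambda>n. inverse (?N (Suc n) / ?N n)) \<longlonglongrightarrow> inverse 1" by (intro tendsto_inverse lims(1)) simp
    thus ?thesis by (simp add: inverse_divide)
  qed
  have e1: "(\<lambda>n. (Z (\<tau> (Suc n)) - Z (\<tau> n)) / ?N n) \<longlonglongrightarrow> 0"
  proof (rule Lim_null_comparison[OF _ lims(3)])
    show "eventually (\<lambda>n. norm ((Z (\<tau> (Suc n)) - Z (\<tau> n)) / ?N n) \<le> ?t n ^ k * sqrt (?t n) / ?N n) sequentially"
      using big
    proof eventually_elim
      case (elim n)
      have N: "0 < ?N n" using elim by (rule lil_norm_pos)
      have "1 * 1 \<le> ?t n ^ k * sqrt (?t n)" using elim by (intro mult_mono) auto
      moreover have "\<bar>Z (\<tau> (Suc n)) - Z (\<tau> n)\<bar> \<le> 1" using jump[of n] by linarith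
      ultimately have "\<bar>Z (\<tau> (Suc n)) - Z (\<tau> n)\<bar> / ?N n \<le> ?t n ^ k * sqrt (?t n) / ?N n"
        using N by (intro divide_right_mono) auto
      thus ?case using N by (simp only: real_norm_def abs_divide abs_of_pos)
    qed
  qed
  have e2: "(\<lambda>n. (?t (Suc n) ^ Suc k - ?t n ^ Suc k) / ?N n / fact (Suc k)) \<longlonglongrightarrow> 0"
    using tendsto_divide[OF lims(2) tendsto_const[of "fact (Suc k)"]] by simp
  have e3: "(\<lambda>n. V n * (?N n / ?N (Suc n) - 1)) \<longlonglongrightarrow> 0"
  proof (rule Lim_null_comparison)
    have "(\<lambda>n. 2 * \<bar>?N n / ?N (Suc n) - 1\<bar>) \<longlonglongrightarrow> 2 * \<bar>1 - 1\<bar>" by (intro tendsto_intros inv)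
    thus "(\<lambda>n. 2 * \<bar>?N n / ?N (Suc n) - 1\<bar>) \<longlonglongrightarrow> 0" by simp
    show "eventually (\<lambda>n. norm (V n * (?N n / ?N (Suc n) - 1)) \<le> 2 * \<bar>?N n / ?N (Suc n) - 1\<bar>) sequentially"
      using V_bound[of 1] unfolding real_norm_def abs_mult
      by (auto elim!: eventually_mono intro!: mult_right_mono)
  qed
  show ?thesis
  proof (rule Lim_transform_eventually)
    have "(\<lambda>n. ((Z (\<tau> (Suc n)) - Z (\<tau> n)) / ?N n - (?t (Suc n) ^ Suc k - ?t n ^ Suc k) / ?N n / fact (Suc k)) * (?N n / ?N (Suc n))
       + V n * (?N n / ?N (Suc n) - 1)) \<longlonglongrightarrow> (0 - 0) * 1 + 0"
      by (intro tendsto_intros e1 e2 e3 inv)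
    thus "(\<lambda>n. ((Z (\<tau> (Suc n)) - Z (\<tau> n)) / ?N n - (?t (Suc n) ^ Suc k - ?t n ^ Suc k) / ?N n / fact (Suc k)) * (?N n / ?N (Suc n))
       + V n * (?N n / ?N (Suc n) - 1)) \<longlonglongrightarrow> 0" by simp
    show "eventually (\<lambda>n. ((Z (\<tau> (Suc n)) - Z (\<tau> n)) / ?N n - (?t (Suc n) ^ Suc k - ?t n ^ Suc k) / ?N n / fact (Suc k)) * (?N n / ?N (Suc n))
       + V n * (?N n / ?N (Suc n) - 1) = V (Suc n) - V n) sequentially"
      using big big'
    proof eventually_elim
      case (elim n)
      have N: "?N n \<noteq> 0" "?N (Suc n) \<noteq> 0" using lil_norm_pos[OF elim(1), of k] lil_norm_pos[OF elim(2), of k] by auto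
      have alg: "((z' - z) / x - (b' - b) / x / f) * (x / y) + (z - b / f) / x * (x / y - 1) = (z' - b' / f) / y - (z - b / f) / x"
        if "x \<noteq> 0" "y \<noteq> 0" "f \<noteq> 0" for z z' b b' f x y :: real
        using that by (simp add: field_simps)
      show ?case unfolding V_def by (rule alg[OF N]) simp
    qed
  qed
qed

lemma limit_points_V:
  assumes "eventually (\<lambda>n. n \<in> I) sequentially"
  shows "limit_points I V = {-1..1}"
  by (rule limit_points_eq_interval[OF V_bound V_frequently_up V_frequently_down V_step assms])

end

section \<open>Agreement with the normalisation of the statement\<close>

lemma limit_points_cong:
  assumes "\<And>n. n \<in> I \<Longrightarrow> x n = y n"
  shows "limit_points I x = limit_points I y"
  using assms unfolding limit_points_def by (simp cong: conj_cong)

lemma lil_norm_eq: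
  assumes "1 < t"
  shows "lil_norm k t = sqrt (2 * t ^ (2 * k + 1) * ln (ln t)) / (fact k * sqrt (real (2 * k + 1)))"
proof -
  have "sqrt (t ^ (2 * k + 1)) = t ^ k * sqrt t"
    using assms by (simp add: real_sqrt_mult power_mult real_sqrt_power power_even_eq)
  hence "sqrt (2 * t ^ (2 * k + 1) * ln (ln t)) = t ^ k * sqrt t * sqrt (2 * ln (ln t))"
    by (simp only: real_sqrt_mult mult_ac)
  thus ?thesis by (simp add: lil_norm_def)
qed

theorem theorem2p1:
  fixes M :: "'a measure" and A :: "nat list \<Rightarrow> nat \<Rightarrow> 'a \<Rightarrow> real" and k :: nat
  assumes "random_recursive_tree M A" and "k \<ge> 1"
  shows "AE \<omega> in M.
    limit_points {n. real n > exp (exp 1)}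
      (\<lambda>n. fact (k - 1) * sqrt (real (2 * k - 1))
             * (real (level_size A n k \<omega>) - ln (real n) ^ k / fact k)
           / sqrt (2 * ln (real n) ^ (2 * k - 1) * ln (ln (ln (real n)))))
    = {-1..1}"
proof -
  interpret random_recursive_tree M A by fact
  interpret W: centred_poisson_walk M root_increment by (rule centred_poisson_walk_root)
  \<comment> \<open>Level \<open>k\<close> belongs to the root walk summed \<open>\<kappa>\<close>
    further times.\<close>
  obtain \<kappa> where k: "k = Suc \<kappa>" using assms(2) by (cases k) auto
  have one: "\<bar>1::real\<bar> = 1" "\<bar>- 1::real\<bar> = 1" by simp_all
  show ?thesis
    using AE_regular AE_level_count_expansion AE_tau W.lil_upper[of \<kappa>] W.lil_lower[OF one(1), of \<kappa>] W.lil_lower[OF one(2), of \<kappa>]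
  proof eventually_elim
    case (elim \<omega>)
    note reg = elim(1)
    obtain C where C: "0 \<le> C" "\<And>n. 1 \<le> n \<Longrightarrow> \<bar>real (level_count (Suc \<kappa>) (real n) \<omega>) - real n ^ Suc \<kappa> / fact (Suc \<kappa>)
      - W.walk_sum \<kappa> n \<omega>\<bar> \<le> C * (real n ^ \<kappa> * sqrt (real n))"
      using elim(2) unfolding W.walk_sum_def by blast
    have tc: "total_count (tau A n \<omega>) \<omega> = Suc n" for n using elim(3) by blast
    \<comment> \<open>Read off from the population sizes rather than from the infimum that defines
      \<open>tau\<close>.\<close>
    have tau_mono: "tau A n \<omega> \<le> tau A (Suc n) \<omega>" for n
    proof (rule ccontr)
      assume "\<not> tau A n \<omega> \<le> tau A (Suc n) \<omega>"
      hence "total_count (tau A (Suc n) \<omega>) \<omega> \<le> total_count (tau A n \<omega>) \<omega>"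
        by (intro total_count_mono[OF reg]) simp
      thus False using tc[of n] tc[of "Suc n"] by linarith
    qed
    \<comment> \<open>The whole tree gains exactly one vertex from \<open>tau A n\<close> to
      \<open>tau A (Suc n)\<close>, so a single level gains at most one.\<close>
    have jump: "level_count (Suc \<kappa>) (tau A (Suc n) \<omega>) \<omega> \<le> level_count (Suc \<kappa>) (tau A n \<omega>) \<omega> + 1" for n
    proof -
      let ?B = "\<lambda>n. {v. birth A v \<omega> \<le> tau A n \<omega>}"
      have fin: "finite (?B n)" for n using reg by (simp add: regular_def)
      have sub: "?B n \<subseteq> ?B (Suc n)" using tau_mono[of n] by auto
      have "card (?B (Suc n) - ?B n) = 1"
        using tc[of n] tc[of "Suc n"] card_Diff_subset[OF fin sub] unfolding total_count_def by simp
      moreover have "{v. length v = Suc \<kappa> \<and> birth A v \<omega> \<le> tau A (Suc n) \<omega>}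
          \<subseteq> {v. length v = Suc \<kappa> \<and> birth A v \<omega> \<le> tau A n \<omega>} \<union> (?B (Suc n) - ?B n)" by auto
      hence "card {v. length v = Suc \<kappa> \<and> birth A v \<omega> \<le> tau A (Suc n) \<omega>}
          \<le> card ({v. length v = Suc \<kappa> \<and> birth A v \<omega> \<le> tau A n \<omega>} \<union> (?B (Suc n) - ?B n))"
        by (intro card_mono finite_UnI finite_Diff fin) (auto intro: rev_finite_subset[OF fin[of n]])
      ultimately show ?thesis
        using card_Un_le[of "{v. length v = Suc \<kappa> \<and> birth A v \<omega> \<le> tau A n \<omega>}" "?B (Suc n) - ?B n"]
        unfolding level_count_def by linarith
    qed
    interpret L: lil_transfer "\<lambda>t. real (level_count (Suc \<kappa>) t \<omega>)" "\<lambda>n. W.walk_sum \<kappa> n \<omega>" "\<lambda>n. tau A n \<omega>" C \<kappa>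
    proof
      show "real (level_count (Suc \<kappa>) s \<omega>) \<le> real (level_count (Suc \<kappa>) t \<omega>)" if "s \<le> t" for s t
        using level_count_mono[OF reg that] by simp
      show "frequently (\<lambda>n. (1 - \<epsilon>) * lil_norm \<kappa> (real n) \<le> W.walk_sum \<kappa> n \<omega>) sequentially" if "0 < \<epsilon>" for \<epsilon>
        using elim(5) that by simp
      show "frequently (\<lambda>n. (1 - \<epsilon>) * lil_norm \<kappa> (real n) \<le> - W.walk_sum \<kappa> n \<omega>) sequentially" if "0 < \<epsilon>" for \<epsilon>
        using elim(6) that by simp
      show "real (level_count (Suc \<kappa>) (tau A n \<omega>) \<omega>) \<le> real (level_count (Suc \<kappa>) (tau A (Suc n) \<omega>) \<omega>) \<and>
          real (level_count (Suc \<kappa>) (tau A (Suc n) \<omega>) \<omega>) \<le> real (level_count (Suc \<kappa>) (tau A n \<omega>) \<omega>) + 1" for n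
        using jump[of n] level_count_mono[OF reg tau_mono[of n], of "Suc \<kappa>"] by linarith
    qed (use C elim in auto)
    have "eventually (\<lambda>n. n \<in> {n. real n > exp (exp 1)}) sequentially"
      using filterlim_at_top_dense[THEN iffD1, OF filterlim_real_sequentially] by simp
    from L.limit_points_V[OF this]
    have "limit_points {n. real n > exp (exp 1)} L.V = {-1..1}" .
    also have "limit_points {n. real n > exp (exp 1)} L.V = limit_points {n. real n > exp (exp 1)}
      (\<lambda>n. fact (k - 1) * sqrt (real (2 * k - 1))
             * (real (level_size A n k \<omega>) - ln (real n) ^ k / fact k)
           / sqrt (2 * ln (real n) ^ (2 * k - 1) * ln (ln (ln (real n)))))"
    proof (rule limit_points_cong)
      fix n assume "n \<in> {n. real n > exp (exp 1)}"
      hence "exp (exp 1) < real n" by simp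
      moreover have "0 < exp (exp (1::real))" by simp
      ultimately have "ln (exp (exp 1)) < ln (real n)" by (subst ln_less_cancel_iff) linarith+
      hence "exp 1 < ln (real n)" by simp
      moreover have "1 < exp (1::real)" by simp
      ultimately have t: "1 < ln (real n)" by linarith
      have "level_size A n k \<omega> = level_count (Suc \<kappa>) (tau A n \<omega>) \<omega>"
        unfolding level_size_def level_count_def k by (rule arg_cong[where f = card]) auto
      moreover have "2 * k - 1 = 2 * \<kappa> + 1" "k - 1 = \<kappa>" using k by auto
      ultimately show "L.V n = fact (k - 1) * sqrt (real (2 * k - 1))
             * (real (level_size A n k \<omega>) - ln (real n) ^ k / fact k)
           / sqrt (2 * ln (real n) ^ (2 * k - 1) * ln (ln (ln (real n))))"
        unfolding L.V_def lil_norm_eq[OF t] by (simp only: k divide_divide_eq_right mult_ac)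
    qed
    finally show ?case .
  qed
qed

end
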